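(* Let $\mathbf{k}$ be a field, let $n\ge 1$, and let $w=(w_1,\dots,w_n)$ be an $n$-tuple of positive even integers. Let $R_w$ be the graded ring of $\mathrm{SL}_2$-invariant sections of powers of $\mathcal{O}(w_1,\dots,w_n)$ on $(\mathbb{P}^1)^n$, and let $I_w$ be the ideal of relations between its lowest-degree generators $s_\tau$. Then $I_w$ admits a squarefree quadratic Gröbner basis, i.e. there is a monomial order $\prec$ on the polynomial ring $\mathbf{k}[X_\tau]$ such that $I_w$ has a Gröbner basis with respect to $\prec$ consisting of quadratic polynomials whose leading monomials are squarefree. In particular, $R_w$ is Koszul.
   Context: Let $S=\mathbf{k}[x_1,y_1,\dots,x_n,y_n]$, graded by $\mathbb{N}^n$ with $\deg x_i=\deg y_i=e_i$ (the $i$-th standard basis vector), with graded pieces $S_r=H^0((\mathbb{P}^1)^n,\mathcal{O}(r_1,\dots,r_n))$. The group $\mathrm{SL}_2$ acts on $S$ through left multiplication on the $2\times n$ matrix with columns $(x_i,y_i)^T$. Invariants are taken with respect to the algebraic group (group scheme) $\mathrm{SL}_2$; for infinite $\mathbf{k}$ this is the same as invariants of $\mathrm{SL}(2,\mathbf{k})$. Then $R_w=\bigoplus_{d\ge0}(S_{dw})^{\mathrm{SL}_2}$, with degree-$d$ part $(S_{dw})^{\mathrm{SL}_2}$. Let $|w|=w_1+\cdots+w_n$. A tableau of shape $(k,k)$ is a pair of rows $i_1,\dots,i_k$ (top) and $j_1,\dots,j_k$ (bottom) with entries in $\{1,\dots,n\}$; it is semistandard if $i_1\le\cdots\le i_k$,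 $j_1\le\cdots\le j_k$ and $i_\ell<j_\ell$ for all $\ell$; its content is the vector whose $i$-th entry is the number of occurrences of $i$. Put $p_{ij}=x_iy_j-x_jy_i$ and $s_\tau=p_{i_1j_1}\cdots p_{i_kj_k}$. The $s_\tau$ with $\tau$ semistandard of shape $(|w|/2,|w|/2)$ and content $w$ form a basis of $(R_w)_1$ and generate $R_w$ as a $\mathbf{k}$-algebra (Kempe's theorem). Let $\mathbf{k}[X_\tau]$ be the polynomial ring with one variable for each such $\tau$; $I_w$ is the kernel of the surjection $\mathbf{k}[X_\tau]\to R_w$, $X_\tau\mapsto s_\tau$. A graded $\mathbf{k}$-algebra $R$ is Koszul if $\mathbf{k}$ admits a linear free resolution as an $R$-module. *)

theory Defs
  imports
    "HOL-Algebra.Algebra"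
    "HOL-Algebra.Algebraic_Closure_Type"
    "HOL-Library.Poly_Mapping"
begin

section \<open>Polynomial rings\<close>

text \<open>Monomials in variables from a type \<open>'v\<close> are finitely supported exponent vectors and
  polynomials are finitely supported families of coefficients; the ring operations are those
  of \<^theory>\<open>HOL-Library.Poly_Mapping\<close>. The polynomial ring on a set of variables \<open>V\<close> is the
  corresponding subring, as a structure in the sense of HOL-Algebra.\<close>

type_synonym 'v monomial = "'v \<Rightarrow>\<^sub>0 nat"
type_synonym ('v, 'k) mpoly = "'v monomial \<Rightarrow>\<^sub>0 'k"

definition Const :: "'k::zero \<Rightarrow> ('v, 'k) mpoly"
  where "Const c = Poly_Mapping.single 0 c"

definition Var :: "'v \<Rightarrow> ('v, 'k::comm_ring_1) mpoly"
  where "Var v = Poly_Mapping.single (Poly_Mapping.single v 1) 1"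

definition monomials :: "'v set \<Rightarrow> 'v monomial set"
  where "monomials V = {m. Poly_Mapping.keys m \<subseteq> V}"

definition polys :: "'v set \<Rightarrow> ('v, 'k::comm_ring_1) mpoly set"
  where "polys V = {f. Poly_Mapping.keys f \<subseteq> monomials V}"

definition mpoly_ring :: "'v set \<Rightarrow> ('v, 'k::comm_ring_1) mpoly ring"
  where "mpoly_ring V = ring_of_type_algebra\<lparr>carrier := polys V\<rparr>"

text \<open>The \<open>\<bold>k\<close>-algebra homomorphism sending each variable \<open>v\<close> to \<open>h v\<close>.\<close>

definition poly_subst ::
    "('v \<Rightarrow> ('u, 'k::comm_ring_1) mpoly) \<Rightarrow> ('v, 'k) mpoly \<Rightarrow> ('u, 'k) mpoly"
  where "poly_subst h f =
    (\<Sum>m\<in>Poly_Mapping.keys f. Const (Poly_Mapping.lookup f m) *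
       (\<Prod>v\<in>Poly_Mapping.keys m. h v ^ Poly_Mapping.lookup m v))"


section \<open>Groebner bases\<close>

definition monomial_order :: "'v set \<Rightarrow> 'v monomial rel \<Rightarrow> bool"
  where "monomial_order V r \<longleftrightarrow>
    well_order_on (monomials V) r \<and>
    (\<forall>a b c. (a, b) \<in> r \<longrightarrow> c \<in> monomials V \<longrightarrow> (a + c, b + c) \<in> r)"

definition lead_monom :: "'v monomial rel \<Rightarrow> ('v, 'k::comm_ring_1) mpoly \<Rightarrow> 'v monomial"
  where "lead_monom r f =
    (THE m. m \<in> Poly_Mapping.keys f \<and> (\<forall>m'\<in>Poly_Mapping.keys f. (m', m) \<in> r))"

definition initial_ideal ::
    "'v set \<Rightarrow> 'v monomial rel \<Rightarrow> ('v, 'k::comm_ring_1) mpoly set \<Rightarrow> ('v, 'k) mpoly set"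
  where "initial_ideal V r F =
    Idl\<^bsub>mpoly_ring V\<^esub> ((\<lambda>f. Poly_Mapping.single (lead_monom r f) 1) ` (F - {0}))"

definition groebner_basis ::
    "'v set \<Rightarrow> 'v monomial rel \<Rightarrow> ('v, 'k::comm_ring_1) mpoly set \<Rightarrow> ('v, 'k) mpoly set \<Rightarrow> bool"
  where "groebner_basis V r I G \<longleftrightarrow>
    finite G \<and> G \<subseteq> I - {0} \<and> initial_ideal V r G = initial_ideal V r I"

definition total_degree :: "'v monomial \<Rightarrow> nat"
  where "total_degree m = (\<Sum>v\<in>Poly_Mapping.keys m. Poly_Mapping.lookup m v)"

definition quadratic :: "('v, 'k::comm_ring_1) mpoly \<Rightarrow> bool"
  where "quadratic f \<longleftrightarrow> f \<noteq> 0 \<and> (\<forall>m\<in>Poly_Mapping.keys f. total_degree m = 2)"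

definition squarefree_monomial :: "'v monomial \<Rightarrow> bool"
  where "squarefree_monomial m \<longleftrightarrow> (\<forall>v. Poly_Mapping.lookup m v \<le> 1)"


section \<open>Koszul algebras\<close>

text \<open>A connected graded \<open>\<bold>k\<close>-algebra: \<open>\<iota>\<close> is the structure map, \<open>A d\<close> the piece of degree \<open>d\<close>,
  and \<open>A 0 = \<bold>k\<close>.\<close>

definition connected_graded_algebra ::
    "('k::field \<Rightarrow> 'r) \<Rightarrow> 'r ring \<Rightarrow> (nat \<Rightarrow> 'r set) \<Rightarrow> bool"
  where "connected_graded_algebra \<iota> R A \<longleftrightarrow>
    cring R \<and>
    \<iota> \<in> ring_hom ring_of_type_algebra R \<and> bij_betw \<iota> UNIV (A 0) \<and>
    (\<forall>d. additive_subgroup (A d) R) \<and>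
    (\<forall>d e. \<forall>a\<in>A d. \<forall>b\<in>A e. a \<otimes>\<^bsub>R\<^esub> b \<in> A (d + e)) \<and>
    (\<forall>a\<in>carrier R. \<exists>!f. (\<forall>d. f d \<in> A d) \<and> finite {d. f d \<noteq> \<zero>\<^bsub>R\<^esub>} \<and>
       a = finsum R f {d. f d \<noteq> \<zero>\<^bsub>R\<^esub>})"

definition mod_hom ::
    "'r ring \<Rightarrow> ('r, 'm) module \<Rightarrow> ('r, 'n) module \<Rightarrow> ('m \<Rightarrow> 'n) set"
  where "mod_hom R M N =
    {h \<in> carrier M \<rightarrow> carrier N.
      (\<forall>u\<in>carrier M. \<forall>v\<in>carrier M. h (u \<oplus>\<^bsub>M\<^esub> v) = h u \<oplus>\<^bsub>N\<^esub> h v) \<and>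
      (\<forall>a\<in>carrier R. \<forall>u\<in>carrier M. h (a \<odot>\<^bsub>M\<^esub> u) = a \<odot>\<^bsub>N\<^esub> h u)}"

text \<open>Graded homomorphisms (of degree \<open>0\<close>) between modules with gradings \<open>gM\<close> and \<open>gN\<close>.\<close>

definition graded_hom ::
    "'r ring \<Rightarrow> ('r, 'm) module \<Rightarrow> (nat \<Rightarrow> 'm set) \<Rightarrow>
      ('r, 'n) module \<Rightarrow> (nat \<Rightarrow> 'n set) \<Rightarrow> ('m \<Rightarrow> 'n) set"
  where "graded_hom R M gM N gN =
    {h \<in> mod_hom R M N. \<forall>d. h ` gM d \<subseteq> gN d}"

text \<open>The free module \<open>\<Oplus>\<^bsub>b\<in>B\<^esub> R\<close>; the multiplicative fields of the record are unused.\<close>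

definition free_module :: "'r ring \<Rightarrow> 'b set \<Rightarrow> ('r, 'b \<Rightarrow> 'r) module"
  where "free_module R B =
    \<lparr>carrier = {u \<in> B \<rightarrow>\<^sub>E carrier R. finite {b \<in> B. u b \<noteq> \<zero>\<^bsub>R\<^esub>}},
     monoid.mult = undefined, monoid.one = undefined,
     ring.zero = (\<lambda>b\<in>B. \<zero>\<^bsub>R\<^esub>),
     ring.add = (\<lambda>u v. \<lambda>b\<in>B. u b \<oplus>\<^bsub>R\<^esub> v b),
     module.smult = (\<lambda>a u. \<lambda>b\<in>B. a \<otimes>\<^bsub>R\<^esub> u b)\<rparr>"

text \<open>The grading of \<open>\<Oplus>\<^bsub>b\<in>B\<^esub> R(-i)\<close>, for which the standard basis lies in degree \<open>i\<close>.\<close>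

definition free_grading ::
    "'r ring \<Rightarrow> (nat \<Rightarrow> 'r set) \<Rightarrow> 'b set \<Rightarrow> nat \<Rightarrow> nat \<Rightarrow> ('b \<Rightarrow> 'r) set"
  where "free_grading R A B i d =
    {u \<in> carrier (free_module R B). \<forall>b\<in>B. u b \<in> (if i \<le> d then A (d - i) else {\<zero>\<^bsub>R\<^esub>})}"

definition irrelevant_ideal :: "'r ring \<Rightarrow> (nat \<Rightarrow> 'r set) \<Rightarrow> 'r set"
  where "irrelevant_ideal R A = Idl\<^bsub>R\<^esub> (\<Union>d\<in>{1..}. A d)"

text \<open>The \<open>R\<close>-module \<open>\<bold>k = R/R\<^sub>+\<close>, concentrated in degree \<open>0\<close>.\<close>

definition residue_module :: "'r ring \<Rightarrow> (nat \<Rightarrow> 'r set) \<Rightarrow> ('r, 'r set) module"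
  where "residue_module R A = (let J = irrelevant_ideal R A; K = R Quot J in
    \<lparr>carrier = carrier K, monoid.mult = monoid.mult K, monoid.one = monoid.one K, ring.zero = ring.zero K, ring.add = ring.add K,
     module.smult = (\<lambda>a C. (J +>\<^bsub>R\<^esub> a) \<otimes>\<^bsub>K\<^esub> C)\<rparr>)"

definition residue_grading :: "'r ring \<Rightarrow> (nat \<Rightarrow> 'r set) \<Rightarrow> nat \<Rightarrow> 'r set set"
  where "residue_grading R A d =
    (if d = 0 then carrier (residue_module R A) else {\<zero>\<^bsub>residue_module R A\<^esub>})"

text \<open>A linear free resolution \<open>\<cdots> \<rightarrow> F\<^sub>2 \<rightarrow> F\<^sub>1 \<rightarrow> F\<^sub>0 \<rightarrow> \<bold>k \<rightarrow> 0\<close>: an exact sequence of graded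
  modules in which \<open>F\<^sub>i\<close> is free on generators of degree \<open>i\<close>, indexed by \<open>B i\<close>.\<close>

definition linear_free_resolution ::
    "'r ring \<Rightarrow> (nat \<Rightarrow> 'r set) \<Rightarrow> (nat \<Rightarrow> 'b set) \<Rightarrow>
      (nat \<Rightarrow> ('b \<Rightarrow> 'r) \<Rightarrow> ('b \<Rightarrow> 'r)) \<Rightarrow> (('b \<Rightarrow> 'r) \<Rightarrow> 'r set) \<Rightarrow> bool"
  where "linear_free_resolution R A B \<delta> \<epsilon> \<longleftrightarrow>
    (let F = (\<lambda>i. free_module R (B i)); gF = (\<lambda>i. free_grading R A (B i) i);
         K = residue_module R A
     in (\<forall>i. \<delta> i \<in> graded_hom R (F (Suc i)) (gF (Suc i)) (F i) (gF i)) \<and>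
        \<epsilon> \<in> graded_hom R (F 0) (gF 0) K (residue_grading R A) \<and>
        \<epsilon> ` carrier (F 0) = carrier K \<and>
        \<delta> 0 ` carrier (F 1) = a_kernel (F 0) K \<epsilon> \<and>
        (\<forall>i. \<delta> (Suc i) ` carrier (F (Suc (Suc i))) = a_kernel (F (Suc i)) (F i) (\<delta> i)))"

text \<open>The generators of each \<open>F\<^sub>i\<close> are indexed by a set of natural numbers. This is no restriction
  if \<open>A 1\<close> has countable dimension: a linear resolution is minimal, so \<open>F\<^sub>i\<close> has as many
  generators as \<open>dim Tor\<^sub>i(\<bold>k,\<bold>k)\<^sub>i\<close>, and this is a subspace of the \<open>i\<close>-fold tensor power of \<open>A 1\<close>.\<close>

definition koszul :: "('k::field \<Rightarrow> 'r) \<Rightarrow> 'r ring \<Rightarrow> (nat \<Rightarrow> 'r set) \<Rightarrow> bool"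
  where "koszul \<iota> R A \<longleftrightarrow>
    connected_graded_algebra \<iota> R A \<and>
    (\<exists>(B :: nat \<Rightarrow> nat set) \<delta> \<epsilon>. linear_free_resolution R A B \<delta> \<epsilon>)"


section \<open>The ring of invariants\<close>

text \<open>A tuple \<open>w = (w\<^sub>1,\<dots>,w\<^sub>n)\<close> is a function of which only the values on \<open>{1..n}\<close> matter.\<close>

datatype coord = Xc nat | Yc nat

definition coords :: "nat \<Rightarrow> coord set"
  where "coords n = Xc ` {1..n} \<union> Yc ` {1..n}"

definition multigraded_piece :: "nat \<Rightarrow> (nat \<Rightarrow> nat) \<Rightarrow> (coord, 'k::comm_ring_1) mpoly set"
  where "multigraded_piece n r =
    {f \<in> polys (coords n). \<forall>m\<in>Poly_Mapping.keys f. \<forall>i\<in>{1..n}.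
       Poly_Mapping.lookup m (Xc i) + Poly_Mapping.lookup m (Yc i) = r i}"

text \<open>Invariants of the group scheme \<open>SL\<^sub>2\<close>. Its coordinate ring is
  \<open>\<bold>k[g\<^sub>1\<^sub>1,g\<^sub>1\<^sub>2,g\<^sub>2\<^sub>1,g\<^sub>2\<^sub>2]/(det - 1)\<close>, so \<open>S \<otimes> \<O>(SL\<^sub>2)\<close> is \<open>S[g\<^sub>1\<^sub>1,g\<^sub>1\<^sub>2,g\<^sub>2\<^sub>1,g\<^sub>2\<^sub>2]/(det - 1)\<close>, and \<open>f\<close> is
  invariant iff its image under the coaction equals \<open>f \<otimes> 1\<close>, i.e. iff the generic matrix
  \<open>g\<close> fixes \<open>f\<close> modulo \<open>det - 1\<close>. Variables \<open>Inl\<close> are the coordinates and variables \<open>Inr\<close>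
  the matrix entries.\<close>

datatype entry = G11 | G12 | G21 | G22

fun generic_act :: "coord \<Rightarrow> (coord + entry, 'k::comm_ring_1) mpoly"
  where
    "generic_act (Xc i) = Var (Inr G11) * Var (Inl (Xc i)) + Var (Inr G12) * Var (Inl (Yc i))"
  | "generic_act (Yc i) = Var (Inr G21) * Var (Inl (Xc i)) + Var (Inr G22) * Var (Inl (Yc i))"

definition generic_det :: "(coord + entry, 'k::comm_ring_1) mpoly"
  where "generic_det =
    Var (Inr G11) * Var (Inr G22) - Var (Inr G12) * Var (Inr G21)"

definition SL2_invariant :: "(coord, 'k::comm_ring_1) mpoly \<Rightarrow> bool"
  where "SL2_invariant f \<longleftrightarrow>
    generic_det - 1 dvd poly_subst generic_act f - poly_subst (\<lambda>v. Var (Inl v)) f"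

definition Rw_piece :: "nat \<Rightarrow> (nat \<Rightarrow> nat) \<Rightarrow> nat \<Rightarrow> (coord, 'k::field) mpoly set"
  where "Rw_piece n w d = {f \<in> multigraded_piece n (\<lambda>i. d * w i). SL2_invariant f}"

text \<open>For \<open>n \<ge> 1\<close> and positive \<open>w\<close> the multidegrees \<open>d w\<close> are pairwise distinct, so that
  \<open>R\<^sub>w = \<Oplus>\<^sub>d (S\<^bsub>dw\<^esub>)\<^bsup>SL\<^sub>2\<^esup>\<close> is the sum of its pieces inside \<open>S\<close>.\<close>

definition Rw :: "nat \<Rightarrow> (nat \<Rightarrow> nat) \<Rightarrow> (coord, 'k::field) mpoly ring"
  where "Rw n w = ring_of_type_algebra
    \<lparr>carrier := {(\<Sum>d\<le>N. f d) |N f. \<forall>d. f d \<in> Rw_piece n w d}\<rparr>"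


section \<open>Tableaux and the ideal of relations\<close>

text \<open>A tableau of shape \<open>(k,k)\<close> is the pair of its top and its bottom row.\<close>

type_synonym tableau = "nat list \<times> nat list"

definition semistandard :: "nat \<Rightarrow> nat \<Rightarrow> tableau \<Rightarrow> bool"
  where "semistandard n k = (\<lambda>(is, js).
    length is = k \<and> length js = k \<and> set is \<union> set js \<subseteq> {1..n} \<and>
    sorted is \<and> sorted js \<and> (\<forall>l<k. is ! l < js ! l))"

definition tableau_content :: "tableau \<Rightarrow> nat \<Rightarrow> nat"
  where "tableau_content = (\<lambda>(is, js) i. count_list is i + count_list js i)"

definition weight :: "nat \<Rightarrow> (nat \<Rightarrow> nat) \<Rightarrow> nat"
  where "weight n w = (\<Sum>i\<in>{1..n}. w i)"

definition tableaux :: "nat \<Rightarrow> (nat \<Rightarrow> nat) \<Rightarrow> tableau set"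
  where "tableaux n w =
    {\<tau>. semistandard n (weight n w div 2) \<tau> \<and> (\<forall>i\<in>{1..n}. tableau_content \<tau> i = w i)}"

definition pluecker :: "nat \<Rightarrow> nat \<Rightarrow> (coord, 'k::comm_ring_1) mpoly"
  where "pluecker i j = Var (Xc i) * Var (Yc j) - Var (Xc j) * Var (Yc i)"

definition tableau_section :: "tableau \<Rightarrow> (coord, 'k::comm_ring_1) mpoly"
  where "tableau_section = (\<lambda>(is, js). prod_list (map2 pluecker is js))"

definition relation_ideal :: "nat \<Rightarrow> (nat \<Rightarrow> nat) \<Rightarrow> (tableau, 'k::field) mpoly set"
  where "relation_ideal n w =
    a_kernel (mpoly_ring (tableaux n w)) (Rw n w) (poly_subst tableau_section)"

end

theory Submission
  imports Defs "HOL-Library.Product_Plus"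
begin

text \<open>Order monomials lexicographically by their exponents in \<open>x\<^sub>1, \<dots>, x\<^sub>n\<close>. Under this order
  \<open>s\<^sub>\<tau>\<close> has a leading monomial that determines \<open>\<tau>\<close>: it is recorded by the numbers \<open>T\<^sub>m\<close> of entries
  at most \<open>m\<close> in the top row, and semistandardness becomes a triangle inequality for consecutive
  values of \<open>T\<close>. A unipotent substitution shows that the leading monomial of every invariant of
  degree \<open>d\<close> satisfies the same inequalities, scaled by \<open>d\<close>. Since all \<open>w\<^sub>i\<close> are even, the walls of
  these inequalities are compatible with the zigzag order on the integers, in which the odd numbers
  cover their neighbours: every scaled solution is in a unique way the sum of \<open>d\<close> solutions forming
  a chain for the coordinatewise zigzag order. Hence the products of chains of tableaux form a basis
  of \<open>R\<^sub>w\<close>, and the straightening relations of incomparable pairs are a Groebner basis for an order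
  that refines the order of leading monomials by a preference for balanced monomials.

  Sorted words in the tableaux then form a PBW basis of \<open>R\<^sub>w\<close>, because comparability is transitive on
  consecutive letters. The linear resolution is built inductively as in Priddy's theorem: its
  \<open>i\<close>-th module is free on the words of length \<open>i\<close> without a sorted pair of consecutive letters.\<close>

text \<open>Put a_m = 2 T_m - d (w_1 + ... + w_m), the surplus of top over bottom entries up to m.
  The conditions on T say exactly that a_(m-1), a_m and d w_m obey the three triangle inequalities.
  As the weights are even, each wall reads T_m = T_(m-1) + 2cd or T_m + T_(m-1) = 2cd. The zigzag
  order is invariant under t -> t + 2c and t -> 2c - t, hence so is the unique decomposition of an
  integer into a chain; being monotone as well, it carries each inequality for T to the same
  inequality for the parts. Leading monomials of arbitrary invariants have to be bounded over every
  field. The coefficient followed through the unipotent substitution is multiplied only by 1, so the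
  characteristic does not matter. Generation in degree one is a consequence of this bound. Several
  monomials in the variables share one leading monomial of the image, and the standard one must be
  the smallest. Sums of squares detect an unbalanced pair. An incomparable pair that is balanced
  everywhere has odd sets that are not nested, which the sizes of their union and intersection
  detect.\<close>

abbreviation lookup :: "('a \<Rightarrow>\<^sub>0 'b::zero) \<Rightarrow> 'a \<Rightarrow> 'b" where "lookup \<equiv> Poly_Mapping.lookup"
abbreviation keys :: "('a \<Rightarrow>\<^sub>0 'b::zero) \<Rightarrow> 'a set" where "keys \<equiv> Poly_Mapping.keys"
abbreviation single :: "'a \<Rightarrow> 'b \<Rightarrow> ('a \<Rightarrow>\<^sub>0 'b::zero)" where "single \<equiv> Poly_Mapping.single"

section \<open>Finitely supported functions as sums of single terms\<close>

lemma poly_mapping_sum_single: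
  fixes f :: "'a \<Rightarrow>\<^sub>0 'b::comm_monoid_add"
  assumes "finite A" "keys f \<subseteq> A"
  shows "f = (\<Sum>m\<in>A. single m (lookup f m))"
proof (rule poly_mapping_eqI)
  fix k
  show "lookup f k = lookup (\<Sum>m\<in>A. single m (lookup f m)) k"
    using assms by (auto simp: lookup_sum lookup_single when_def in_keys_iff)
qed

lemma poly_mapping_induct_single [case_names single add]:
  fixes f :: "'a \<Rightarrow>\<^sub>0 'b::comm_monoid_add"
  assumes "\<And>m c. P (single m c)" and "\<And>f g. P f \<Longrightarrow> P g \<Longrightarrow> P (f + g)"
  shows "P f"
proof -
  have "P (\<Sum>m\<in>A. single m (lookup f m))" if "finite A" for A
    using that
  proof (induction A rule: finite_induct)
    case empty
    show ?case using assms(1)[of _ 0] by simp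
  qed (simp add: assms)
  then show ?thesis using poly_mapping_sum_single[of "keys f" f]
    by (metis finite_keys order_refl)
qed

section \<open>Evaluation homomorphisms\<close>

definition mon_eval :: "('v \<Rightarrow> 'r::comm_monoid_mult) \<Rightarrow> 'v monomial \<Rightarrow> 'r"
  where "mon_eval h m = (\<Prod>v\<in>keys m. h v ^ lookup m v)"

text \<open>The target is the monoid algebra of an arbitrary commutative monoid \<open>'e\<close>,
  which extends \<open>poly_subst\<close>: \<open>torus_weight\<close> substitutes a Laurent
  variable, whose exponents are integers.\<close>

definition evaluate ::
    "('v \<Rightarrow> ('e::comm_monoid_add \<Rightarrow>\<^sub>0 'k::comm_ring_1)) \<Rightarrow> ('v, 'k) mpoly \<Rightarrow> ('e \<Rightarrow>\<^sub>0 'k)"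
  where "evaluate h f = (\<Sum>m\<in>keys f. single 0 (lookup f m) * mon_eval h m)"

lemma poly_subst_eq_evaluate: "poly_subst h f = evaluate h f"
  by (simp add: poly_subst_def evaluate_def mon_eval_def Const_def)

lemma mon_eval_superset:
  assumes "finite A" "keys m \<subseteq> A"
  shows "mon_eval h m = (\<Prod>v\<in>A. h v ^ lookup m v)"
  unfolding mon_eval_def using assms
  by (intro prod.mono_neutral_left) (auto simp: in_keys_iff)

lemma mon_eval_zero [simp]: "mon_eval h 0 = 1"
  by (simp add: mon_eval_def)

lemma mon_eval_add: "mon_eval h (m + m') = mon_eval h m * mon_eval h m'"
proof -
  let ?A = "keys m \<union> keys m'"
  have "keys (m + m') \<subseteq> ?A" by (rule Poly_Mapping.keys_add)
  then show ?thesis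
    by (simp add: mon_eval_superset[of ?A] lookup_add power_add prod.distrib)
qed

lemma mon_eval_single [simp]: "mon_eval h (single v k) = h v ^ k"
  by (cases "k = 0") (simp_all add: mon_eval_def)

lemma evaluate_superset:
  assumes "finite A" "keys f \<subseteq> A"
  shows "evaluate h f = (\<Sum>m\<in>A. single 0 (lookup f m) * mon_eval h m)"
  unfolding evaluate_def using assms
  by (intro sum.mono_neutral_left) (auto simp: in_keys_iff)

lemma evaluate_single: "evaluate h (single m c) = single 0 c * mon_eval h m"
  by (subst evaluate_superset[of "{m}"]) simp_all

lemma evaluate_zero [simp]: "evaluate h 0 = 0"
  by (simp add: evaluate_def)

lemma evaluate_one [simp]: "evaluate h 1 = 1"
  using evaluate_single[of h 0 1] by simp

lemma evaluate_Var [simp]: "evaluate h (Var v) = h v"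
  by (simp add: Var_def evaluate_single)

lemma evaluate_Const: "evaluate h (Const c) = single 0 c"
  by (simp add: Const_def evaluate_single)

lemma evaluate_add: "evaluate h (f + g) = evaluate h f + evaluate h g"
proof -
  let ?A = "keys f \<union> keys g"
  have "keys (f + g) \<subseteq> ?A" by (rule Poly_Mapping.keys_add)
  then show ?thesis
    by (simp add: evaluate_superset[of ?A] lookup_add single_add distrib_right sum.distrib)
qed

lemma evaluate_uminus: "evaluate h (- f) = - evaluate h f"
  using evaluate_add[of h f "- f"] by (simp add: eq_neg_iff_add_eq_0 add.commute)

lemma evaluate_diff: "evaluate h (f - g) = evaluate h f - evaluate h g"
  using evaluate_add[of h f "- g"] by (simp add: evaluate_uminus)

lemma evaluate_sum: "evaluate h (sum f A) = (\<Sum>a\<in>A. evaluate h (f a))"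
  by (induction A rule: infinite_finite_induct) (simp_all add: evaluate_add)

lemma evaluate_mult:
  fixes h :: "'v \<Rightarrow> ('e::comm_monoid_add \<Rightarrow>\<^sub>0 'k::comm_ring_1)"
  shows "evaluate h (f * g) = evaluate h f * evaluate h g"
proof (induction f rule: poly_mapping_induct_single)
  case (single m c)
  show ?case
  proof (induction g rule: poly_mapping_induct_single)
    case (single m' c')
    have c: "single 0 (c * c') = (single 0 c * single 0 c' :: 'e \<Rightarrow>\<^sub>0 'k)" by (simp add: mult_single)
    have "evaluate h (single m c * single m' c') = single 0 (c * c') * (mon_eval h m * mon_eval h m')"
      by (simp only: mult_single evaluate_single mon_eval_add)
    also have "\<dots> = (single 0 c * mon_eval h m) * (single 0 c' * mon_eval h m')"
      by (subst c) (simp only: mult_ac)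
    finally show ?case by (simp only: evaluate_single)
  qed (simp add: distrib_left evaluate_add)
qed (simp add: distrib_right evaluate_add)

lemma evaluate_power: "evaluate h (f ^ k) = evaluate h f ^ k"
  by (induction k) (simp_all add: evaluate_mult)

lemma evaluate_prod: "evaluate h (prod f A) = (\<Prod>a\<in>A. evaluate h (f a))"
  by (induction A rule: infinite_finite_induct) (simp_all add: evaluate_mult)

lemma evaluate_mon_eval: "evaluate h (mon_eval g m) = mon_eval (\<lambda>v. evaluate h (g v)) m"
  by (simp add: mon_eval_def evaluate_prod evaluate_power)

lemma evaluate_evaluate: "evaluate h (evaluate g f) = evaluate (\<lambda>v. evaluate h (g v)) f"
proof (induction f rule: poly_mapping_induct_single)
  case (single m c)
  show ?case
    by (simp add: evaluate_single evaluate_mult evaluate_mon_eval)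
qed (simp add: evaluate_add)

lemma lookup_single_zero_mult: "lookup (single 0 c * f) e = c * lookup f e"
  by (induction f rule: poly_mapping_induct_single)
    (simp_all add: mult_single lookup_single lookup_add distrib_left mult_when)

lemma lookup_evaluate:
  "lookup (evaluate h f) e = (\<Sum>m\<in>keys f. lookup f m * lookup (mon_eval h m) e)"
  by (simp add: evaluate_def lookup_sum lookup_single_zero_mult)

lemma keys_evaluate: "e \<in> keys (evaluate h f) \<Longrightarrow> \<exists>m\<in>keys f. e \<in> keys (mon_eval h m)"
proof (rule ccontr)
  assume "e \<in> keys (evaluate h f)" and "\<not> (\<exists>m\<in>keys f. e \<in> keys (mon_eval h m))"
  then show False by (simp add: in_keys_iff lookup_evaluate)
qed


section \<open>Exponent bounds and leading terms\<close>

lemma keys_multE: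
  assumes "e \<in> keys (f * g)"
  obtains a b where "a \<in> keys f" "b \<in> keys g" "e = a + b"
  using assms Poly_Mapping.keys_mult[of f g] by blast

text \<open>The weight \<mu> is additive, so bounds on the factors add up. Its values are integers
  so that a negated degree can serve as \<mu>, which gives the lower bound at the end of
  \<open>invariant_ballot\<close>.\<close>

lemma keys_prod_bounded:
  fixes F :: "'i \<Rightarrow> ('e::comm_monoid_add \<Rightarrow>\<^sub>0 'k::comm_ring_1)" and \<mu> :: "'e \<Rightarrow> int"
  assumes add: "\<And>a b. \<mu> (a + b) = \<mu> a + \<mu> b"
    and "\<And>i e. i \<in> I \<Longrightarrow> e \<in> keys (F i) \<Longrightarrow> \<mu> e \<le> B i"
    and "e \<in> keys (prod F I)"
  shows "\<mu> e \<le> sum B I"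
  using assms(2,3)
proof (induction I arbitrary: e rule: infinite_finite_induct)
  case (insert i I)
  obtain a b where "a \<in> keys (F i)" "b \<in> keys (prod F I)" "e = a + b"
    using insert.prems insert.hyps keys_multE by (metis prod.insert)
  then show ?case using insert.prems(1)[of i a] insert.IH[of b] insert.prems insert.hyps add
    by fastforce
qed (use add[of 0 0] in \<open>auto split: if_splits\<close>)

lemma keys_power_bounded:
  fixes f :: "'e::comm_monoid_add \<Rightarrow>\<^sub>0 'k::comm_ring_1" and \<mu> :: "'e \<Rightarrow> int"
  assumes "\<And>a b. \<mu> (a + b) = \<mu> a + \<mu> b"
    and "\<And>e. e \<in> keys f \<Longrightarrow> \<mu> e \<le> B"
    and "e \<in> keys (f ^ k)"
  shows "\<mu> e \<le> int k * B"
  using keys_prod_bounded[of \<mu> "{..<k}" "\<lambda>_. f" "\<lambda>_. B" e] assms by simp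

lemma keys_mon_eval_bounded:
  fixes h :: "'v \<Rightarrow> ('e::comm_monoid_add \<Rightarrow>\<^sub>0 'k::comm_ring_1)" and \<mu> :: "'e \<Rightarrow> int"
  assumes add: "\<And>a b. \<mu> (a + b) = \<mu> a + \<mu> b"
    and B: "\<And>v e. v \<in> keys m \<Longrightarrow> e \<in> keys (h v) \<Longrightarrow> \<mu> e \<le> B v"
    and "e \<in> keys (mon_eval h m)" "finite A" "keys m \<subseteq> A"
  shows "\<mu> e \<le> (\<Sum>v\<in>A. int (lookup m v) * B v)"
proof -
  have "\<mu> e \<le> (\<Sum>v\<in>keys m. int (lookup m v) * B v)"
    using assms(3) unfolding mon_eval_def
    by (rule keys_prod_bounded[OF add, rotated]) (use keys_power_bounded[OF add B] in blast)
  also have "\<dots> = (\<Sum>v\<in>A. int (lookup m v) * B v)"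
    using assms(4,5) by (intro sum.mono_neutral_left) (auto simp: in_keys_iff)
  finally show ?thesis .
qed

text \<open>A strict partial order only: \<open>xless\<close> compares the exponents of the
  x-variables and leaves some distinct exponents unrelated. Leading terms are therefore expressed by
  \<open>monic_at\<close>, where one exponent dominates all the others.\<close>

locale additive_order =
  fixes less :: "'e::comm_monoid_add \<Rightarrow> 'e \<Rightarrow> bool"  (infix \<open>\<sqsubset>\<close> 50)
  assumes irrefl: "\<not> a \<sqsubset> a"
    and trans: "a \<sqsubset> b \<Longrightarrow> b \<sqsubset> c \<Longrightarrow> a \<sqsubset> c"
    and add_right: "a \<sqsubset> b \<Longrightarrow> a + c \<sqsubset> b + c"
begin

definition monic_at :: "('e \<Rightarrow>\<^sub>0 'k::comm_ring_1) \<Rightarrow> 'e \<Rightarrow> bool"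
  where "monic_at f m \<longleftrightarrow> lookup f m = 1 \<and> (\<forall>m'\<in>keys f. m' = m \<or> m' \<sqsubset> m)"

lemma add_mono: "a \<sqsubset> b \<or> a = b \<Longrightarrow> c \<sqsubset> d \<or> c = d \<Longrightarrow> a + c \<sqsubset> b + d \<or> a = b \<and> c = d"
  using add_right[of a b c] add_right[of c d b] trans by (auto simp: add.commute)

lemma monic_at_single: "monic_at (single m 1) m"
  by (simp add: monic_at_def)

lemma monic_at_one: "monic_at 1 0"
  using monic_at_single[of 0] by simp

text \<open>Replacing \<open>a\<close> or \<open>b\<close> by a smaller exponent makes the sum
  strictly smaller, so \<open>a + b\<close> arises from a single pair and its coefficient is 1 times
  1, whatever the coefficient ring.\<close>

lemma monic_at_mult:
  fixes f g :: "'e \<Rightarrow>\<^sub>0 'k::comm_ring_1"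
  assumes "monic_at f a" "monic_at g b"
  shows "monic_at (f * g) (a + b)"
proof -
  have part: "lookup (\<Sum>l\<in>keys f. \<Sum>q\<in>keys g. single (l + q) (lookup f l * lookup g q)) (a + b) =
      lookup f a * lookup g b"
  proof -
    have *: "l + q = a + b \<longleftrightarrow> l = a \<and> q = b" if "l \<in> keys f" "q \<in> keys g" for l q
    proof -
      have "l \<sqsubset> a \<or> l = a" "q \<sqsubset> b \<or> q = b" using assms that by (auto simp: monic_at_def)
      then show ?thesis using add_mono[of l a q b] irrefl[of "a + b"] by auto
    qed
    have "lookup (\<Sum>l\<in>keys f. \<Sum>q\<in>keys g. single (l + q) (lookup f l * lookup g q)) (a + b) =
        (\<Sum>l\<in>keys f. \<Sum>q\<in>keys g. if l = a then if q = b then lookup f l * lookup g q else 0 else 0)"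
      by (auto simp: lookup_sum lookup_single when_def * intro!: sum.cong)
    also have "\<dots> = (\<Sum>l\<in>keys f. if l = a then lookup f a * lookup g b else 0)"
      by (intro sum.cong) (auto simp: in_keys_iff)
    also have "\<dots> = lookup f a * lookup g b" by (simp add: in_keys_iff)
    finally show ?thesis .
  qed
  have "f * g = (\<Sum>l\<in>keys f. single l (lookup f l)) * (\<Sum>q\<in>keys g. single q (lookup g q))"
    using poly_mapping_sum_single[of "keys f" f] poly_mapping_sum_single[of "keys g" g] by simp
  also have "\<dots> = (\<Sum>l\<in>keys f. \<Sum>q\<in>keys g. single (l + q) (lookup f l * lookup g q))"
    by (simp add: sum_product mult_single)
  finally have "lookup (f * g) (a + b) = 1"
    using part assms by (simp add: monic_at_def)
  moreover have "e = a + b \<or> e \<sqsubset> a + b" if "e \<in> keys (f * g)" for e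
  proof -
    obtain l q where lq: "l \<in> keys f" "q \<in> keys g" "e = l + q"
      using \<open>e \<in> keys (f * g)\<close> by (rule keys_multE)
    then have "l \<sqsubset> a \<or> l = a" "q \<sqsubset> b \<or> q = b" using assms by (auto simp: monic_at_def)
    then show ?thesis using add_mono[of l a q b] lq by auto
  qed
  ultimately show ?thesis by (simp add: monic_at_def)
qed

lemma monic_at_power: "monic_at f a \<Longrightarrow> monic_at (f ^ k) (\<Sum>i<k. a)"
  by (induction k) (simp_all add: monic_at_one monic_at_mult add.commute)

lemma monic_at_prod:
  "(\<And>i. i \<in> I \<Longrightarrow> monic_at (F i) (a i)) \<Longrightarrow> monic_at (prod F I) (sum a I)"
  by (induction I rule: infinite_finite_induct) (simp_all add: monic_at_one monic_at_mult)

lemma monic_at_mon_eval: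
  "(\<And>v. v \<in> keys m \<Longrightarrow> monic_at (h v) (a v)) \<Longrightarrow>
    monic_at (mon_eval h m) (\<Sum>v\<in>keys m. \<Sum>i<lookup m v. a v)"
  unfolding mon_eval_def by (intro monic_at_prod monic_at_power)

lemma maximal_key:
  assumes "finite M" "M \<noteq> {}"
  obtains m where "m \<in> M" "\<And>m'. m' \<in> M \<Longrightarrow> \<not> m \<sqsubset> m'"
proof -
  have "\<exists>m\<in>M. \<forall>m'\<in>M. m' \<noteq> m \<longrightarrow> \<not> m \<sqsubset> m'"
  proof (rule Finite_Set.bex_max_element[OF assms(1) _ _ assms(2)])
    show "asymp_on M (\<sqsubset>)" by (rule asymp_onI) (meson irrefl trans)
    show "transp_on M (\<sqsubset>)" by (rule transp_onI) (rule trans)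
  qed
  then obtain m where m: "m \<in> M" "\<forall>m'\<in>M. m' \<noteq> m \<longrightarrow> \<not> m \<sqsubset> m'" by blast
  show ?thesis
  proof (rule that[OF m(1)])
    show "\<not> m \<sqsubset> m'" if "m' \<in> M" for m' using m that by (cases "m' = m") (simp_all add: irrefl)
  qed
qed

end

text \<open>Both \<open>xless\<close> and \<open>mless\<close> are instances. Keys are integers
  because one of the keys of \<open>mless\<close> is a negated sum of squares.\<close>

definition key_less :: "(nat \<Rightarrow> 'e \<Rightarrow> int) \<Rightarrow> nat \<Rightarrow> 'e \<Rightarrow> 'e \<Rightarrow> bool"
  where "key_less \<kappa> K a b \<longleftrightarrow> (\<exists>j<K. \<kappa> j a < \<kappa> j b \<and> (\<forall>i<j. \<kappa> i a = \<kappa> i b))"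

lemma key_less_trans:
  assumes "key_less \<kappa> K a b" "key_less \<kappa> K b c"
  shows "key_less \<kappa> K a c"
proof -
  obtain i j where i: "i < K" "\<kappa> i a < \<kappa> i b" "\<forall>l<i. \<kappa> l a = \<kappa> l b"
    and j: "j < K" "\<kappa> j b < \<kappa> j c" "\<forall>l<j. \<kappa> l b = \<kappa> l c"
    using assms by (auto simp: key_less_def)
  have "\<kappa> (min i j) a < \<kappa> (min i j) c"
    using i j by (cases i j rule: linorder_cases) (simp_all add: min_def)
  moreover have "\<forall>l<min i j. \<kappa> l a = \<kappa> l c" "min i j < K" using i j by auto
  ultimately show ?thesis unfolding key_less_def by blast
qed

lemma key_less_total: "\<not> key_less \<kappa> K a b \<Longrightarrow> \<not> key_less \<kappa> K b a \<Longrightarrow> j < K \<Longrightarrow> \<kappa> j a = \<kappa> j b"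
proof (induction j rule: less_induct)
  case (less j)
  then have "\<forall>i<j. \<kappa> i a = \<kappa> i b" by auto
  then show ?case using less.prems unfolding key_less_def by (metis linorder_neqE_linordered_idom)
qed

lemma key_less_additive_order:
  assumes "\<And>j a b. \<kappa> j (a + b) = \<kappa> j a + \<kappa> j b"
  shows "additive_order (key_less \<kappa> K)"
proof
  show "\<not> key_less \<kappa> K a a" for a by (simp add: key_less_def)
  show "key_less \<kappa> K a c" if "key_less \<kappa> K a b" "key_less \<kappa> K b c" for a b c
    using that by (rule key_less_trans)
  show "key_less \<kappa> K (a + c) (b + c)" if "key_less \<kappa> K a b" for a b c
    using that by (simp add: key_less_def assms)
qed


section \<open>Resolutions over PBW algebras\<close>

text \<open>\<open>cf r u\<close> is the coefficient of the standard word \<open>u\<close> in \<open>r\<close>, and \<open>gm u\<close> is the product of the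
  generators along \<open>u\<close>. Straightening a nonstandard word yields smaller standard words.\<close>

locale pbw_algebra =
  fixes C :: "'r::comm_ring_1 set" and A :: "nat \<Rightarrow> 'r set" and \<iota> :: "'k::field \<Rightarrow> 'r"
    and L :: "'a set" and g :: "'a \<Rightarrow> 'r" and N :: "'a \<Rightarrow> 'a \<Rightarrow> bool"
    and less :: "'a list \<Rightarrow> 'a list \<Rightarrow> bool"  (infix \<open>\<sqsubset>\<close> 50)
    and cf :: "'r \<Rightarrow> 'a list \<Rightarrow> 'k"
    and gm std
  defines "gm \<equiv> \<lambda>u. prod_list (map g u)" and "std \<equiv> \<lambda>u. set u \<subseteq> L \<and> successively N u"
  assumes finite_L: "finite L"
    and irrefl: "\<not> u \<sqsubset> u"
    and trans: "u \<sqsubset> v \<Longrightarrow> v \<sqsubset> u' \<Longrightarrow> u \<sqsubset> u'"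
    and wf: "wf {(u, v). u \<sqsubset> v \<and> set u \<subseteq> L \<and> set v \<subseteq> L}"
    and less_length: "u \<sqsubset> v \<Longrightarrow> length u = length v"
    and less_left: "u \<sqsubset> v \<Longrightarrow> p @ u \<sqsubset> p @ v"
    and less_right: "u \<sqsubset> v \<Longrightarrow> u @ p \<sqsubset> v @ p"
    and C_one: "1 \<in> C" and C_add: "r \<in> C \<Longrightarrow> s \<in> C \<Longrightarrow> r + s \<in> C"
    and C_mult: "r \<in> C \<Longrightarrow> s \<in> C \<Longrightarrow> r * s \<in> C"
    and C_scalar: "\<iota> c \<in> C" and C_gen: "a \<in> L \<Longrightarrow> g a \<in> C"
    and \<iota>_add: "\<iota> (c + d) = \<iota> c + \<iota> d" and \<iota>_mult: "\<iota> (c * d) = \<iota> c * \<iota> d" and \<iota>_one: "\<iota> 1 = 1"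
    and cf_add: "r \<in> C \<Longrightarrow> s \<in> C \<Longrightarrow> cf (r + s) u = cf r u + cf s u"
    and cf_scale: "r \<in> C \<Longrightarrow> cf (\<iota> c * r) u = c * cf r u"
    and cf_finite: "r \<in> C \<Longrightarrow> finite {u. cf r u \<noteq> 0}"
    and cf_std: "r \<in> C \<Longrightarrow> cf r u \<noteq> 0 \<Longrightarrow> std u"
    and expand: "r \<in> C \<Longrightarrow> r = (\<Sum>u | cf r u \<noteq> 0. \<iota> (cf r u) * gm u)"
    and cf_gm: "std u \<Longrightarrow> cf (gm u) v = (if v = u then 1 else 0)"
    and straighten: "set u \<subseteq> L \<Longrightarrow> \<not> std u \<Longrightarrow> cf (gm u) v \<noteq> 0 \<Longrightarrow> v \<sqsubset> u"
    and A_iff: "r \<in> A n \<longleftrightarrow> r \<in> C \<and> (\<forall>u. cf r u \<noteq> 0 \<longrightarrow> length u = n)"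
begin

section \<open>Coefficients and spans of standard words\<close>

lemma \<iota>_zero: "\<iota> 0 = 0"
  using \<iota>_add[of 0 0] by simp

lemma \<iota>_minus_one: "\<iota> (- 1) = - 1"
  using \<iota>_add[of 1 "- 1"] by (simp add: \<iota>_zero \<iota>_one eq_neg_iff_add_eq_0 add.commute)

lemma C_zero: "0 \<in> C"
  using C_scalar[of 0] by (simp add: \<iota>_zero)

lemma C_uminus: "r \<in> C \<Longrightarrow> - r \<in> C"
  using C_mult[OF C_scalar[of "- 1"], of r] by (simp add: \<iota>_minus_one)

lemma C_diff: "r \<in> C \<Longrightarrow> s \<in> C \<Longrightarrow> r - s \<in> C"
  using C_add[OF _ C_uminus, of r s] by simp

lemma C_sum: "(\<And>i. i \<in> I \<Longrightarrow> f i \<in> C) \<Longrightarrow> sum f I \<in> C"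
  by (induction I rule: infinite_finite_induct) (simp_all add: C_zero C_add)

lemma C_gm: "set u \<subseteq> L \<Longrightarrow> gm u \<in> C"
  by (induction u) (simp_all add: gm_def C_one C_mult C_gen)

lemma gm_append: "gm (u @ v) = gm u * gm v"
  by (simp add: gm_def)

lemma cf_zero [simp]: "cf 0 u = 0"
  using cf_scale[of 0 0 u] by (simp add: C_zero)

lemma cf_uminus: "r \<in> C \<Longrightarrow> cf (- r) u = - cf r u"
  using cf_scale[of r "- 1" u] by (simp add: \<iota>_minus_one)

lemma cf_diff: "r \<in> C \<Longrightarrow> s \<in> C \<Longrightarrow> cf (r - s) u = cf r u - cf s u"
  using cf_add[of r "- s" u] by (simp add: C_uminus cf_uminus)

lemma cf_sum: "(\<And>i. i \<in> I \<Longrightarrow> f i \<in> C) \<Longrightarrow> cf (sum f I) u = (\<Sum>i\<in>I. cf (f i) u)"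
  by (induction I rule: infinite_finite_induct) (simp_all add: C_sum cf_add)

lemma cf_eqI: "r \<in> C \<Longrightarrow> (\<And>u. cf r u = 0) \<Longrightarrow> r = 0"
  using expand[of r] by simp

text \<open>The span of the products \<open>gm v\<close> over the standard words \<open>v\<close>
  with \<open>P v\<close>, expressed through coefficients.\<close>

definition Sp :: "('a list \<Rightarrow> bool) \<Rightarrow> 'r set"
  where "Sp P = {r \<in> C. \<forall>v. cf r v \<noteq> 0 \<longrightarrow> P v}"

lemma SpD: "r \<in> Sp P \<Longrightarrow> r \<in> C" "r \<in> Sp P \<Longrightarrow> cf r v \<noteq> 0 \<Longrightarrow> P v"
  by (auto simp: Sp_def)

lemma Sp_sum:
  assumes "\<And>i. i \<in> I \<Longrightarrow> f i \<in> Sp P"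
  shows "sum f I \<in> Sp P"
proof -
  have "sum f I \<in> C" using assms by (intro C_sum) (auto simp: Sp_def)
  moreover have "P v" if "cf (sum f I) v \<noteq> 0" for v
  proof -
    have "cf (sum f I) v = (\<Sum>i\<in>I. cf (f i) v)" using assms by (intro cf_sum) (auto simp: Sp_def)
    then have "(\<Sum>i\<in>I. cf (f i) v) \<noteq> 0" using that by simp
    then obtain i where "i \<in> I" "cf (f i) v \<noteq> 0"
      by (rule sum.not_neutral_contains_not_neutral)
    then show ?thesis using assms by (auto simp: Sp_def)
  qed
  ultimately show ?thesis by (simp add: Sp_def)
qed

lemma Sp_scale: "r \<in> Sp P \<Longrightarrow> \<iota> c * r \<in> Sp P"
  by (auto simp: Sp_def cf_scale C_mult C_scalar)

lemma gm_Sp: "set u \<subseteq> L \<Longrightarrow> gm u \<in> Sp (\<lambda>v. v = u \<or> v \<sqsubset> u)"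
  by (cases "std u") (auto simp: Sp_def C_gm cf_gm intro: straighten split: if_splits)

text \<open>Multiplication by \<open>gm u\<close> turns \<open>gm v\<close> into
  \<open>gm (u @ v)\<close>, which is standard or straightens into smaller words; hence the
  condition on \<open>Q\<close> at and below \<open>u @ v\<close>.\<close>

lemma gm_mult_Sp:
  assumes r: "r \<in> Sp P" and u: "set u \<subseteq> L"
    and PQ: "\<And>v v'. P v \<Longrightarrow> std v \<Longrightarrow> v' = u @ v \<or> v' \<sqsubset> u @ v \<Longrightarrow> Q v'"
  shows "gm u * r \<in> Sp Q"
proof -
  have rC: "r \<in> C" using r by (rule SpD)
  have "gm u * r = (\<Sum>v | cf r v \<noteq> 0. \<iota> (cf r v) * gm (u @ v))"
    by (subst expand[OF rC]) (simp add: sum_distrib_left gm_append mult_ac)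
  also have "\<dots> \<in> Sp Q"
  proof (intro Sp_sum Sp_scale)
    fix v assume "v \<in> {v. cf r v \<noteq> 0}"
    then have v: "P v" "std v" using r rC by (auto simp: Sp_def cf_std)
    then have "set (u @ v) \<subseteq> L" using u by (simp add: std_def)
    from gm_Sp[OF this] show "gm (u @ v) \<in> Sp Q"
      using PQ[OF v] by (auto simp: Sp_def)
  qed
  finally show ?thesis .
qed

text \<open>These words form a basis of the Koszul dual of the monomial algebra whose relations are
  the nonstandard pairs; they index the generators of the \<open>i\<close>-th free module.\<close>

definition W :: "nat \<Rightarrow> 'a list set"
  where "W i = {b. length b = i \<and> set b \<subseteq> L \<and> successively (\<lambda>x y. \<not> N x y) b}"

lemma finite_W: "finite (W i)"
  by (rule finite_subset[OF _ finite_lists_length_eq[OF finite_L, of i]]) (auto simp: W_def)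

lemma W_zero: "W 0 = {[]}"
  by (auto simp: W_def)

lemma W_SucE:
  assumes "b \<in> W (Suc i)"
  obtains a c where "b = a # c" "a \<in> L" "c \<in> W i" "c = [] \<or> \<not> N a (hd c)"
  using assms by (cases b) (auto simp: W_def successively_Cons)

lemma W_SucI: "a \<in> L \<Longrightarrow> c \<in> W i \<Longrightarrow> c = [] \<or> \<not> N a (hd c) \<Longrightarrow> a # c \<in> W (Suc i)"
  by (auto simp: W_def successively_Cons)

text \<open>The \<open>i\<close>-th free module. Coordinates are extended by 0 outside
  \<open>W i\<close>, so that equality of vectors is equality of functions.\<close>

definition Vec :: "nat \<Rightarrow> ('a list \<Rightarrow> 'r) set"
  where "Vec i = {y. (\<forall>b\<in>W i. y b \<in> C) \<and> (\<forall>b. b \<notin> W i \<longrightarrow> y b = 0)}"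

definition VSp :: "nat \<Rightarrow> ('a list \<Rightarrow> 'a list \<Rightarrow> bool) \<Rightarrow> ('a list \<Rightarrow> 'r) set"
  where "VSp i P = {y \<in> Vec i. \<forall>c\<in>W i. \<forall>v. cf (y c) v \<noteq> 0 \<longrightarrow> P v c}"

text \<open>The basis elements \<open>E u b\<close> of the \<open>i\<close>-th free module are of two types. The differential will send
  those of type N, up to smaller terms, bijectively to those not of type N one step below, by moving
  the first letter of \<open>b\<close> to the end of \<open>u\<close>; this makes the complex exact.\<close>

definition E :: "'a list \<Rightarrow> 'a list \<Rightarrow> 'a list \<Rightarrow> 'r"
  where "E u b = (\<lambda>c. if c = b then gm u else 0)"

definition typeN :: "'a list \<Rightarrow> 'a list \<Rightarrow> bool"
  where "typeN u b \<longleftrightarrow> u = [] \<or> (b \<noteq> [] \<and> N (last u) (hd b))"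

definition \<delta> :: "nat \<Rightarrow> ('a list \<Rightarrow> 'a list \<Rightarrow> 'r) \<Rightarrow> ('a list \<Rightarrow> 'r) \<Rightarrow> 'a list \<Rightarrow> 'r"
  where "\<delta> i D x = (\<lambda>c. if c \<in> W i then \<Sum>b\<in>W (Suc i). x b * D b c else 0)"

text \<open>The boundary of the generator \<open>b\<close>: a cycle with leading term
  \<open>E [hd b] (tl b)\<close> whose other terms are of type N and have smaller words. A choice
  operator is used because the cycles \<open>Z\<close> are defined by recursion through
  \<open>pick\<close>, before such a cycle is known to exist; \<open>D_spec\<close> supplies
  it.\<close>

definition pick :: "('a list \<Rightarrow> 'r) set \<Rightarrow> 'a list \<Rightarrow> 'a list \<Rightarrow> 'r"
  where "pick Z b = (SOME z. z \<in> Z \<and>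
    (\<lambda>c. z c - E [hd b] (tl b) c) \<in> VSp (length b - 1) (\<lambda>v c. typeN v c \<and> v @ c \<sqsubset> b))"

text \<open>The kernel of the augmentation in step 0 and of the differential in later steps. The
  differential into step \<open>i\<close> is itself built from \<open>Z i\<close>, so cycles and
  differentials arise together.\<close>

primrec Z :: "nat \<Rightarrow> ('a list \<Rightarrow> 'r) set"
  where "Z 0 = {y \<in> Vec 0. cf (y []) [] = 0}"
  | "Z (Suc i) = {y \<in> Vec (Suc i). \<delta> i (pick (Z i)) y = (\<lambda>_. 0)}"

abbreviation D :: "nat \<Rightarrow> 'a list \<Rightarrow> 'a list \<Rightarrow> 'r"
  where "D i \<equiv> pick (Z i)"

section \<open>Calculus in the free modules\<close>

lemma Vec_C: "y \<in> Vec i \<Longrightarrow> y b \<in> C"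
  by (cases "b \<in> W i") (auto simp: Vec_def C_zero)

lemma Vec_out: "y \<in> Vec i \<Longrightarrow> b \<notin> W i \<Longrightarrow> y b = 0"
  by (simp add: Vec_def)

lemma Vec_zero: "(\<lambda>_. 0) \<in> Vec i"
  by (simp add: Vec_def C_zero)

lemma Vec_add: "x \<in> Vec i \<Longrightarrow> y \<in> Vec i \<Longrightarrow> (\<lambda>c. x c + y c) \<in> Vec i"
  by (simp add: Vec_def C_add)

lemma Vec_scale: "r \<in> C \<Longrightarrow> y \<in> Vec i \<Longrightarrow> (\<lambda>c. r * y c) \<in> Vec i"
  by (simp add: Vec_def C_mult)

lemma E_Vec: "set u \<subseteq> L \<Longrightarrow> b \<in> W i \<Longrightarrow> E u b \<in> Vec i"
  by (auto simp: Vec_def E_def C_gm C_zero)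

lemma VSp_Vec: "y \<in> VSp i P \<Longrightarrow> y \<in> Vec i"
  by (simp add: VSp_def)

lemma VSp_zero: "(\<lambda>_. 0) \<in> VSp i P"
  by (simp add: VSp_def Vec_zero)

lemma VSp_add: "x \<in> VSp i P \<Longrightarrow> y \<in> VSp i P \<Longrightarrow> (\<lambda>c. x c + y c) \<in> VSp i P"
  by (auto simp: VSp_def Vec_add cf_add Vec_C) (metis add_0)

lemma VSp_scale: "y \<in> VSp i P \<Longrightarrow> (\<lambda>c. \<iota> k * y c) \<in> VSp i P"
  by (auto simp: VSp_def Vec_scale C_scalar cf_scale Vec_C)

lemma VSp_uminus: "y \<in> VSp i P \<Longrightarrow> (\<lambda>c. - y c) \<in> VSp i P"
  using VSp_scale[of y i P "- 1"] by (simp add: \<iota>_minus_one)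

lemma VSp_mono: "y \<in> VSp i P \<Longrightarrow> (\<And>v c. c \<in> W i \<Longrightarrow> P v c \<Longrightarrow> Q v c) \<Longrightarrow> y \<in> VSp i Q"
  by (auto simp: VSp_def)

lemma E_VSp:
  assumes "std u" "b \<in> W i" "P u b"
  shows "E u b \<in> VSp i P"
proof -
  have "E u b \<in> Vec i" using assms by (intro E_Vec) (auto simp: std_def)
  moreover have "P v c" if "cf (E u b c) v \<noteq> 0" for c v
    using that assms by (auto simp: E_def cf_gm split: if_splits)
  ultimately show ?thesis by (auto simp: VSp_def)
qed

text \<open>Expands \<open>y\<close> over the field in the elements \<open>E v b\<close>. The case
  for basis elements retains that \<open>v\<close> occurs in \<open>y b\<close>, so a restriction on
  the support of \<open>y\<close> is available for each term.\<close>

lemma Vec_induct [consumes 1, case_names zero add basis]: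
  assumes y: "y \<in> Vec i" and zero: "Q (\<lambda>_. 0)"
    and add: "\<And>x x'. Q x \<Longrightarrow> Q x' \<Longrightarrow> Q (\<lambda>c. x c + x' c)"
    and basis: "\<And>k v b. b \<in> W i \<Longrightarrow> cf (y b) v \<noteq> 0 \<Longrightarrow> std v \<Longrightarrow> Q (\<lambda>c. \<iota> k * E v b c)"
  shows "Q y"
proof -
  have Qsum: "Q (\<lambda>c. \<Sum>j\<in>J. F j c)" if "\<And>j. j \<in> J \<Longrightarrow> Q (F j)"
    for J :: "'a list set" and F
    using that by (induction J rule: infinite_finite_induct) (simp_all add: zero add)
  have "y = (\<lambda>c. \<Sum>b\<in>W i. \<Sum>v | cf (y b) v \<noteq> 0. \<iota> (cf (y b) v) * E v b c)"
  proof
    fix c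
    have "(\<Sum>b\<in>W i. \<Sum>v | cf (y b) v \<noteq> 0. \<iota> (cf (y b) v) * E v b c) =
        (\<Sum>b\<in>W i. if c = b then \<Sum>v | cf (y b) v \<noteq> 0. \<iota> (cf (y b) v) * gm v else 0)"
      by (intro sum.cong) (auto simp: E_def)
    also have "\<dots> = (\<Sum>b\<in>W i. if c = b then y b else 0)"
      by (intro sum.cong) (use expand[OF Vec_C[OF y]] in auto)
    also have "\<dots> = y c" using finite_W Vec_out[OF y] by simp
    finally show "y c = (\<Sum>b\<in>W i. \<Sum>v | cf (y b) v \<noteq> 0. \<iota> (cf (y b) v) * E v b c)" ..
  qed
  moreover have "Q (\<lambda>c. \<Sum>v | cf (y b) v \<noteq> 0. \<iota> (cf (y b) v) * E v b c)" if "b \<in> W i" for b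
    using cf_std[OF Vec_C[OF y]] that by (intro Qsum basis) auto
  then have "Q (\<lambda>c. \<Sum>b\<in>W i. \<Sum>v | cf (y b) v \<noteq> 0. \<iota> (cf (y b) v) * E v b c)" by (rule Qsum)
  ultimately show ?thesis by simp
qed

lemma \<delta>_zero: "\<delta> i M (\<lambda>_. 0) = (\<lambda>_. 0)"
  by (rule ext) (simp add: \<delta>_def)

lemma \<delta>_add: "\<delta> i M (\<lambda>c. x c + y c) = (\<lambda>c. \<delta> i M x c + \<delta> i M y c)"
  by (auto simp: \<delta>_def distrib_right sum.distrib)

lemma \<delta>_scale: "\<delta> i M (\<lambda>c. r * y c) = (\<lambda>c. r * \<delta> i M y c)"
  by (auto simp: \<delta>_def sum_distrib_left mult_ac)

lemma \<delta>_diff: "\<delta> i M (\<lambda>c. x c - y c) = (\<lambda>c. \<delta> i M x c - \<delta> i M y c)"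
  by (auto simp: \<delta>_def left_diff_distrib sum_subtractf)

lemma \<delta>_E:
  assumes "b \<in> W (Suc i)" "c \<in> W i"
  shows "\<delta> i M (E u b) c = gm u * M b c"
proof -
  have "(\<Sum>b'\<in>W (Suc i). E u b b' * M b' c) = (\<Sum>b'\<in>W (Suc i). if b' = b then gm u * M b c else 0)"
    by (intro sum.cong) (auto simp: E_def)
  then show ?thesis using assms by (simp add: \<delta>_def finite_W)
qed

text \<open>The cycles \<open>Z i\<close> are a complement to the span of the elements of type N, compatibly with the
  order on words.\<close>

definition good :: "nat \<Rightarrow> bool"
  where "good i \<longleftrightarrow>
    Z i \<subseteq> Vec i \<and> (\<lambda>_. 0) \<in> Z i \<and>
    (\<forall>x\<in>Z i. \<forall>y\<in>Z i. (\<lambda>c. x c + y c) \<in> Z i) \<and> (\<forall>r\<in>C. \<forall>y\<in>Z i. (\<lambda>c. r * y c) \<in> Z i) \<and>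
    (\<forall>y\<in>Z i. y \<in> VSp i typeN \<longrightarrow> y = (\<lambda>_. 0)) \<and>
    (\<forall>v b. std v \<longrightarrow> b \<in> W i \<longrightarrow> \<not> typeN v b \<longrightarrow>
      (\<exists>\<nu>\<in>VSp i (\<lambda>v' c. typeN v' c \<and> v' @ c \<sqsubset> v @ b). (\<lambda>c. E v b c - \<nu> c) \<in> Z i))"

context
  fixes i
  assumes good: "good i"
begin

lemma Z_Vec: "y \<in> Z i \<Longrightarrow> y \<in> Vec i"
  using good by (auto simp: good_def)

lemma Z_zero: "(\<lambda>_. 0) \<in> Z i"
  using good by (simp add: good_def)

lemma Z_add: "x \<in> Z i \<Longrightarrow> y \<in> Z i \<Longrightarrow> (\<lambda>c. x c + y c) \<in> Z i"
  using good by (simp add: good_def)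

lemma Z_scale: "r \<in> C \<Longrightarrow> y \<in> Z i \<Longrightarrow> (\<lambda>c. r * y c) \<in> Z i"
  using good by (simp add: good_def)

lemma Z_diff: "x \<in> Z i \<Longrightarrow> y \<in> Z i \<Longrightarrow> (\<lambda>c. x c - y c) \<in> Z i"
  using Z_add[OF _ Z_scale[OF C_uminus[OF C_one]], of x y] by simp

lemma Z_typeN: "y \<in> Z i \<Longrightarrow> y \<in> VSp i typeN \<Longrightarrow> y = (\<lambda>_. 0)"
  using good by (simp add: good_def)

text \<open>The tail of \<open>b\<close> is empty or \<open>b\<close> begins with a nonstandard
  pair; either way \<open>E [hd b] (tl b)\<close> is not of type N, and the complement property of
  the cycles corrects it by smaller elements of type N.\<close>

lemma D_spec:
  assumes "b \<in> W (Suc i)"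
  shows "D i b \<in> Z i"
    and "(\<lambda>c. D i b c - E [hd b] (tl b) c) \<in> VSp i (\<lambda>v c. typeN v c \<and> v @ c \<sqsubset> b)"
proof -
  obtain a c0 where b: "b = a # c0" "a \<in> L" "c0 \<in> W i" "c0 = [] \<or> \<not> N a (hd c0)"
    using assms by (rule W_SucE)
  have "std [a]" "\<not> typeN [a] c0" using b by (auto simp: std_def typeN_def)
  moreover have "std [a] \<longrightarrow> c0 \<in> W i \<longrightarrow> \<not> typeN [a] c0 \<longrightarrow>
      (\<exists>\<nu>\<in>VSp i (\<lambda>v' c. typeN v' c \<and> v' @ c \<sqsubset> [a] @ c0). (\<lambda>c. E [a] c0 c - \<nu> c) \<in> Z i)"
    using good unfolding good_def by blast
  ultimately obtain \<nu> where \<nu>: "\<nu> \<in> VSp i (\<lambda>v' c. typeN v' c \<and> v' @ c \<sqsubset> b)"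
    "(\<lambda>c. E [a] c0 c - \<nu> c) \<in> Z i"
    using b by auto
  have "length b - 1 = i" using assms by (simp add: W_def)
  then have "\<exists>z. z \<in> Z i \<and>
      (\<lambda>c. z c - E [hd b] (tl b) c) \<in> VSp (length b - 1) (\<lambda>v c. typeN v c \<and> v @ c \<sqsubset> b)"
    using \<nu> VSp_uminus[OF \<nu>(1)] b by (intro exI[of _ "\<lambda>c. E [a] c0 c - \<nu> c"]) simp
  from someI_ex[OF this, folded pick_def]
  show "D i b \<in> Z i" "(\<lambda>c. D i b c - E [hd b] (tl b) c) \<in> VSp i (\<lambda>v c. typeN v c \<and> v @ c \<sqsubset> b)"
    using \<open>length b - 1 = i\<close> by auto
qed

lemma \<delta>_Z: "x \<in> Vec (Suc i) \<Longrightarrow> \<delta> i (D i) x \<in> Z i"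
proof -
  assume x: "x \<in> Vec (Suc i)"
  have "(\<lambda>c. \<Sum>b\<in>B. x b * D i b c) \<in> Z i" if "B \<subseteq> W (Suc i)" for B
    using finite_subset[OF that finite_W] that
  proof (induction B rule: finite_induct)
    case (insert b B)
    then show ?case
      by (simp add: Z_add Z_scale Vec_C[OF x] D_spec)
  qed (simp add: Z_zero)
  moreover have "\<delta> i (D i) x = (\<lambda>c. \<Sum>b\<in>W (Suc i). x b * D i b c)"
    using Vec_out[OF Z_Vec[OF D_spec(1)]] by (auto simp: \<delta>_def)
  ultimately show ?thesis by simp
qed

text \<open>Left multiplication by \<open>gm u\<close> respects the order on concatenated words. The
  leading term keeps the total word \<open>u @ b\<close> and only shifts the cut by one letter;
  \<open>u @ [hd b]\<close> may well be nonstandard.\<close>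

lemma \<delta>_basis:
  assumes u: "set u \<subseteq> L" and b: "b \<in> W (Suc i)"
  obtains l where "l \<in> VSp i (\<lambda>v c. v @ c \<sqsubset> u @ b)"
    and "\<delta> i (D i) (E u b) = (\<lambda>c. E (u @ [hd b]) (tl b) c + l c)"
proof
  let ?d = "\<lambda>c. D i b c - E [hd b] (tl b) c"
  let ?l = "\<lambda>c. gm u * ?d c"
  have d: "?d \<in> VSp i (\<lambda>v c. typeN v c \<and> v @ c \<sqsubset> b)" by (rule D_spec(2)[OF b])
  show "?l \<in> VSp i (\<lambda>v c. v @ c \<sqsubset> u @ b)"
    unfolding VSp_def
  proof (intro CollectI conjI ballI allI impI)
    show "?l \<in> Vec i" using d by (intro Vec_scale C_gm u) (auto simp: VSp_def)
    fix c v assume c: "c \<in> W i" and v: "cf (gm u * ?d c) v \<noteq> 0"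
    have "?d c \<in> C" using Vec_C[OF VSp_Vec[OF d], of c] by simp
    then have "?d c \<in> Sp (\<lambda>v. v @ c \<sqsubset> b)" using d c by (auto simp: VSp_def Sp_def)
    then have "gm u * ?d c \<in> Sp (\<lambda>v. v @ c \<sqsubset> u @ b)"
    proof (rule gm_mult_Sp[OF _ u])
      fix v v' assume "v @ c \<sqsubset> b" and v': "v' = u @ v \<or> v' \<sqsubset> u @ v"
      then have *: "u @ v @ c \<sqsubset> u @ b" by (intro less_left)
      show "v' @ c \<sqsubset> u @ b"
        using v' * less_right[of v' "u @ v" c] trans by auto
    qed
    then show "v @ c \<sqsubset> u @ b" using v by (rule SpD)
  qed
  show "\<delta> i (D i) (E u b) = (\<lambda>c. E (u @ [hd b]) (tl b) c + ?l c)"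
  proof
    fix c
    have tl: "tl b \<in> W i" using b by (auto elim: W_SucE)
    show "\<delta> i (D i) (E u b) c = E (u @ [hd b]) (tl b) c + ?l c"
    proof (cases "c \<in> W i")
      case True
      have "E (u @ [hd b]) (tl b) c = gm u * E [hd b] (tl b) c" by (simp add: E_def gm_append)
      then show ?thesis using \<delta>_E[OF b True] by (simp add: right_diff_distrib)
    next
      case False
      then show ?thesis using tl Vec_out[OF Z_Vec[OF D_spec(1)[OF b]] False]
        by (auto simp: \<delta>_def E_def)
    qed
  qed
qed

text \<open>\<open>x\<close> is reduced to elements of type N modulo boundaries of elements of type
  N. The predicate \<open>P\<close> keeps all total words occurring in the reduction under
  control.\<close>

definition elim :: "('a list \<Rightarrow> bool) \<Rightarrow> ('a list \<Rightarrow> 'r) \<Rightarrow> bool"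
  where "elim P x \<longleftrightarrow>
    (\<exists>y\<in>VSp (Suc i) (\<lambda>u b. typeN u b \<and> P (u @ b)). \<exists>\<nu>\<in>VSp i (\<lambda>v c. typeN v c \<and> P (v @ c)).
      x = (\<lambda>c. \<delta> i (D i) y c + \<nu> c))"

lemma elim_mono:
  assumes "elim P x" and PQ: "\<And>w. P w \<Longrightarrow> Q w"
  shows "elim Q x"
proof -
  obtain y \<nu> where y: "y \<in> VSp (Suc i) (\<lambda>u b. typeN u b \<and> P (u @ b))"
      "\<nu> \<in> VSp i (\<lambda>v c. typeN v c \<and> P (v @ c))"
    and x: "x = (\<lambda>c. \<delta> i (D i) y c + \<nu> c)"
    using assms(1) unfolding elim_def by blast
  have "y \<in> VSp (Suc i) (\<lambda>u b. typeN u b \<and> Q (u @ b))" "\<nu> \<in> VSp i (\<lambda>v c. typeN v c \<and> Q (v @ c))"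
    using y PQ by (auto elim!: VSp_mono)
  then show ?thesis using x unfolding elim_def by blast
qed

lemma elim_zero: "elim P (\<lambda>_. 0)"
  unfolding elim_def by (intro bexI[of _ "\<lambda>_. 0"]) (simp_all add: \<delta>_zero VSp_zero)

lemma elim_add: "elim P x \<Longrightarrow> elim P x' \<Longrightarrow> elim P (\<lambda>c. x c + x' c)"
proof -
  assume "elim P x" "elim P x'"
  then obtain y \<nu> y' \<nu>' where y: "y \<in> VSp (Suc i) (\<lambda>u b. typeN u b \<and> P (u @ b))"
      "y' \<in> VSp (Suc i) (\<lambda>u b. typeN u b \<and> P (u @ b))"
      "\<nu> \<in> VSp i (\<lambda>v c. typeN v c \<and> P (v @ c))" "\<nu>' \<in> VSp i (\<lambda>v c. typeN v c \<and> P (v @ c))"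
    and x: "x = (\<lambda>c. \<delta> i (D i) y c + \<nu> c)" "x' = (\<lambda>c. \<delta> i (D i) y' c + \<nu>' c)"
    unfolding elim_def by blast
  show ?thesis unfolding elim_def
    by (rule bexI[OF _ VSp_add[OF y(1,2)]], rule bexI[OF _ VSp_add[OF y(3,4)]])
      (simp add: x \<delta>_add algebra_simps)
qed

lemma elim_scale: "elim P x \<Longrightarrow> elim P (\<lambda>c. \<iota> k * x c)"
proof -
  assume "elim P x"
  then obtain y \<nu> where y: "y \<in> VSp (Suc i) (\<lambda>u b. typeN u b \<and> P (u @ b))"
      "\<nu> \<in> VSp i (\<lambda>v c. typeN v c \<and> P (v @ c))"
    and x: "x = (\<lambda>c. \<delta> i (D i) y c + \<nu> c)"
    unfolding elim_def by blast
  show ?thesis unfolding elim_def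
    by (rule bexI[OF _ VSp_scale[OF y(1)]], rule bexI[OF _ VSp_scale[OF y(2)]])
      (simp add: x \<delta>_scale distrib_left)
qed

text \<open>If \<open>E v c\<close> is not of type N, write \<open>v\<close> as
  \<open>u @ [a]\<close>. As \<open>v\<close> is standard and the pair at the cut is not,
  \<open>E u (a # c)\<close> is of type N one step higher and its boundary is \<open>E v c\<close>
  plus terms with smaller words, which the induction handles.\<close>

lemma elim_basis: "std v \<Longrightarrow> c \<in> W i \<Longrightarrow> elim (\<lambda>w. w = v @ c \<or> w \<sqsubset> v @ c) (E v c)"
proof (induction "v @ c" arbitrary: v c rule: wf_induct_rule[OF wf])
  case (1 v c)
  let ?P = "\<lambda>w. w = v @ c \<or> w \<sqsubset> v @ c"
  show ?case
  proof (cases "typeN v c")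
    case True
    then show ?thesis
      unfolding elim_def
      by (intro bexI[of _ "\<lambda>_. 0"] bexI[of _ "E v c"] E_VSp "1.prems" VSp_zero) (simp_all add: \<delta>_zero)
  next
    case False
    then have "v \<noteq> []" by (simp add: typeN_def)
    then obtain u a where v: "v = u @ [a]" by (metis append_butlast_last_id)
    then have a: "a \<in> L" "c = [] \<or> \<not> N a (hd c)" and u: "std u" "typeN u (a # c)"
      using "1.prems" False by (auto simp: std_def typeN_def successively_append_iff)
    have b: "a # c \<in> W (Suc i)" using a "1.prems" by (intro W_SucI)
    have uL: "set u \<subseteq> L" using u by (simp add: std_def)
    obtain l where l: "l \<in> VSp i (\<lambda>v' c'. v' @ c' \<sqsubset> u @ (a # c))"
      and \<delta>: "\<delta> i (D i) (E u (a # c)) = (\<lambda>c'. E (u @ [a]) c c' + l c')"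
      using \<delta>_basis[OF uL b] by auto
    have "elim ?P l" using VSp_Vec[OF l]
    proof (induction rule: Vec_induct)
      case (basis k v' c')
      then have less: "v' @ c' \<sqsubset> v @ c" using l v by (simp add: VSp_def)
      have "elim (\<lambda>w. w = v' @ c' \<or> w \<sqsubset> v' @ c') (E v' c')"
      proof (rule "1.hyps")
        show "(v' @ c', v @ c) \<in> {(u, v). u \<sqsubset> v \<and> set u \<subseteq> L \<and> set v \<subseteq> L}"
          using less basis "1.prems" by (auto simp: std_def W_def)
      qed (use basis in auto)
      then show ?case
        by (intro elim_scale) (erule elim_mono, use less trans in blast)
    qed (simp_all add: elim_zero elim_add)
    then have "elim ?P (\<lambda>c. \<iota> (- 1) * l c)" by (rule elim_scale)
    moreover have "elim ?P (\<delta> i (D i) (E u (a # c)))"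
      unfolding elim_def
      by (intro bexI[of _ "E u (a # c)"] bexI[of _ "\<lambda>_. 0"] E_VSp VSp_zero) (use u b v in auto)
    ultimately have "elim ?P (\<lambda>c'. \<delta> i (D i) (E u (a # c)) c' + \<iota> (- 1) * l c')"
      by (rule elim_add[rotated])
    then show ?thesis by (simp add: \<delta> v \<iota>_minus_one)
  qed
qed

lemma elim_VSp:
  assumes x: "x \<in> VSp i (\<lambda>v c. P (v @ c))" and P: "\<And>w w'. P w \<Longrightarrow> w' \<sqsubset> w \<Longrightarrow> P w'"
  shows "elim P x"
  using VSp_Vec[OF x]
proof (induction rule: Vec_induct)
  case (basis k v c)
  then have "P (v @ c)" using x by (simp add: VSp_def)
  then show ?case
    by (intro elim_scale elim_mono[OF elim_basis]) (use P basis in blast)+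
qed (simp_all add: elim_zero elim_add)

text \<open>What elimination leaves of a cycle is a cycle of type N, hence 0. So a cycle is a
  boundary, with a preimage of type N whose words still satisfy \<open>P\<close>.\<close>

lemma Z_elim:
  assumes "y \<in> Z i" "y \<in> VSp i (\<lambda>v c. P (v @ c))" and P: "\<And>w w'. P w \<Longrightarrow> w' \<sqsubset> w \<Longrightarrow> P w'"
  obtains x where "x \<in> VSp (Suc i) (\<lambda>u b. typeN u b \<and> P (u @ b))" "y = \<delta> i (D i) x"
proof -
  have "elim P y" using assms(2,3) by (rule elim_VSp)
  then obtain x \<nu> where x: "x \<in> VSp (Suc i) (\<lambda>u b. typeN u b \<and> P (u @ b))"
    and \<nu>: "\<nu> \<in> VSp i (\<lambda>v c. typeN v c \<and> P (v @ c))" and y: "y = (\<lambda>c. \<delta> i (D i) x c + \<nu> c)"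
    unfolding elim_def by blast
  have "\<nu> = (\<lambda>c. y c - \<delta> i (D i) x c)" by (simp add: y)
  then have "\<nu> \<in> Z i" using Z_diff[OF assms(1) \<delta>_Z[OF VSp_Vec[OF x]]] by simp
  then have "\<nu> = (\<lambda>_. 0)" using \<nu> by (intro Z_typeN) (auto elim: VSp_mono)
  then show ?thesis using that x y by simp
qed

lemma exact: "Z i = \<delta> i (D i) ` Vec (Suc i)"
proof (intro equalityI subsetI)
  fix y assume y: "y \<in> Z i"
  have "y \<in> VSp i (\<lambda>v c. True)" using Z_Vec[OF y] by (simp add: VSp_def)
  then obtain x where "x \<in> VSp (Suc i) (\<lambda>u b. typeN u b \<and> True)" "y = \<delta> i (D i) x"
    using Z_elim[OF y, of "\<lambda>_. True"] by metis
  then show "y \<in> \<delta> i (D i) ` Vec (Suc i)" using VSp_Vec by simp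
qed (auto simp: \<delta>_Z)

text \<open>The leading words of the images of the basis elements of type N are pairwise distinct.\<close>

lemma \<delta>_typeN_inj:
  assumes y: "y \<in> VSp (Suc i) typeN" and \<delta>y: "\<delta> i (D i) y = (\<lambda>_. 0)"
  shows "y = (\<lambda>_. 0)"
proof (rule ccontr)
  assume "y \<noteq> (\<lambda>_. 0)"
  define S where "S = {(u, b). b \<in> W (Suc i) \<and> cf (y b) u \<noteq> 0}"
  have yC: "y b \<in> C" for b using y by (auto simp: VSp_def Vec_C)
  have "S = (\<Union>b\<in>W (Suc i). (\<lambda>u. (u, b)) ` {u. cf (y b) u \<noteq> 0})" by (auto simp: S_def)
  then have "finite S" using finite_W cf_finite[OF yC] by simp
  moreover obtain b0 where "y b0 \<noteq> 0" using \<open>y \<noteq> _\<close> by auto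
  then have "b0 \<in> W (Suc i)" using Vec_out[OF VSp_Vec[OF y]] by blast
  moreover obtain u0 where "cf (y b0) u0 \<noteq> 0" using \<open>y b0 \<noteq> 0\<close> cf_eqI[OF yC] by blast
  ultimately have "finite S" "S \<noteq> {}" by (auto simp: S_def)
  have "\<exists>s\<in>S. \<forall>t\<in>S. t \<noteq> s \<longrightarrow> \<not> fst s @ snd s \<sqsubset> fst t @ snd t"
  proof (rule Finite_Set.bex_max_element[OF \<open>finite S\<close> _ _ \<open>S \<noteq> {}\<close>])
    show "asymp_on S (\<lambda>s t. fst s @ snd s \<sqsubset> fst t @ snd t)"
      by (rule asymp_onI) (meson irrefl trans)
    show "transp_on S (\<lambda>s t. fst s @ snd s \<sqsubset> fst t @ snd t)"
      by (rule transp_onI) (rule trans)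
  qed
  then obtain u b where ub: "(u, b) \<in> S"
    and "\<forall>t\<in>S. t \<noteq> (u, b) \<longrightarrow> \<not> u @ b \<sqsubset> fst t @ snd t" by auto
  then have max: "\<not> u @ b \<sqsubset> u' @ b'" if "(u', b') \<in> S" for u' b'
    using irrefl[of "u @ b"] that by (cases "(u', b') = (u, b)") force+
  define a c where "a = hd b" and "c = tl b"
  have bW: "b \<in> W (Suc i)" using ub by (simp add: S_def)
  then have b: "b = a # c" and cW: "c \<in> W i" by (auto simp: a_def c_def elim: W_SucE)
  have std_app: "std (u' @ [hd b'])" if "(u', b') \<in> S" for u' b'
  proof -
    have "std u'" "typeN u' b'" "b' \<in> W (Suc i)"
      using that y cf_std[OF yC] by (auto simp: S_def VSp_def)
    then show ?thesis by (elim W_SucE) (auto simp: std_def typeN_def successively_append_iff)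
  qed
  \<comment> \<open>Lower terms of a boundary cannot reach the word \<open>u @ b\<close>, since it
    is maximal in the support. Among the leading terms, moving the cut is injective, so only the
    pair \<open>(u, b)\<close> contributes.\<close>
  have coeff: "cf (\<delta> i (D i) (E u' b') c) (u @ [a]) = (if u' = u \<and> b' = b then 1 else 0)"
    if S: "(u', b') \<in> S" for u' b'
  proof -
    have b'W: "b' \<in> W (Suc i)" and "std u'" using S cf_std[OF yC] by (auto simp: S_def)
    then have u'L: "set u' \<subseteq> L" by (simp add: std_def)
    obtain a' c' where b': "b' = a' # c'" using b'W by (rule W_SucE)
    obtain l where l: "l \<in> VSp i (\<lambda>v c. v @ c \<sqsubset> u' @ b')"
      and \<delta>: "\<delta> i (D i) (E u' b') = (\<lambda>c. E (u' @ [hd b']) (tl b') c + l c)"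
      using \<delta>_basis[OF u'L b'W] by blast
    have "\<not> (u @ [a]) @ c \<sqsubset> u' @ b'" using max[OF S] b by simp
    then have "cf (l c) (u @ [a]) = 0"
      using l cW unfolding VSp_def by blast
    moreover have "cf (E (u' @ [hd b']) (tl b') c) (u @ [a]) = (if u' = u \<and> b' = b then 1 else 0)"
      using cf_gm[OF std_app[OF S]] b b' by (auto simp: E_def)
    moreover have "E (u' @ [hd b']) (tl b') c \<in> C" "l c \<in> C"
      using std_app[OF S] VSp_Vec[OF l] by (auto simp: E_def C_zero std_def C_gm Vec_C)
    ultimately show ?thesis by (simp add: \<delta> cf_add)
  qed
  have E_C: "\<delta> i (D i) (E u' b') c \<in> C" if "b' \<in> W (Suc i)" "std u'" for u' b'
    using that Vec_C[OF Z_Vec[OF \<delta>_Z[OF E_Vec]]] by (simp add: std_def)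
  have "cf (\<delta> i (D i) y c) (u @ [a]) = (\<Sum>b'\<in>W (Suc i). cf (y b' * D i b' c) (u @ [a]))"
    using cW Vec_C[OF Z_Vec[OF D_spec(1)]] by (simp add: \<delta>_def) (intro cf_sum C_mult yC)
  also have "\<dots> = (\<Sum>b'\<in>W (Suc i). if b' = b then cf (y b) u else 0)"
  proof (intro sum.cong refl)
    fix b' assume b'W: "b' \<in> W (Suc i)"
    have EC: "\<delta> i (D i) (E u' b') c \<in> C" if "cf (y b') u' \<noteq> 0" for u'
      using E_C[OF b'W cf_std[OF yC that]] .
    have "y b' * D i b' c = (\<Sum>u' | cf (y b') u' \<noteq> 0. \<iota> (cf (y b') u') * gm u') * D i b' c"
      using expand[OF yC, of b'] by simp
    also have "\<dots> = (\<Sum>u' | cf (y b') u' \<noteq> 0. \<iota> (cf (y b') u') * \<delta> i (D i) (E u' b') c)"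
      by (simp add: sum_distrib_right \<delta>_E[OF b'W cW] mult.assoc)
    finally have yD: "y b' * D i b' c =
        (\<Sum>u' | cf (y b') u' \<noteq> 0. \<iota> (cf (y b') u') * \<delta> i (D i) (E u' b') c)" .
    have "cf (y b' * D i b' c) (u @ [a]) =
        (\<Sum>u' | cf (y b') u' \<noteq> 0. cf (\<iota> (cf (y b') u') * \<delta> i (D i) (E u' b') c) (u @ [a]))"
      unfolding yD by (rule cf_sum) (use EC in \<open>auto intro: C_mult C_scalar\<close>)
    also have "\<dots> = (\<Sum>u' | cf (y b') u' \<noteq> 0. cf (y b') u' * (if u' = u \<and> b' = b then 1 else 0))"
    proof (intro sum.cong refl)
      fix u' assume "u' \<in> {u'. cf (y b') u' \<noteq> 0}"
      then have "(u', b') \<in> S" and "\<delta> i (D i) (E u' b') c \<in> C" using b'W EC by (auto simp: S_def)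
      then show "cf (\<iota> (cf (y b') u') * \<delta> i (D i) (E u' b') c) (u @ [a]) =
          cf (y b') u' * (if u' = u \<and> b' = b then 1 else 0)"
        by (simp only: cf_scale coeff)
    qed
    also have "\<dots> = (\<Sum>u' | cf (y b') u' \<noteq> 0. if u' = u then if b' = b then cf (y b) u else 0 else 0)"
      by (intro sum.cong) auto
    also have "\<dots> = (if b' = b then cf (y b) u else 0)"
      using ub cf_finite[OF yC, of b'] by (simp add: S_def)
    finally show "cf (y b' * D i b' c) (u @ [a]) = (if b' = b then cf (y b) u else 0)" .
  qed
  also have "\<dots> = cf (y b) u" using bW finite_W by simp
  finally show False using \<delta>y ub by (simp add: S_def)
qed

text \<open>If \<open>E v b\<close> is not of type N, then \<open>v @ [hd b]\<close> is nonstandard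
  and the leading term of the boundary straightens. The boundary is thus a cycle with words below
  \<open>v @ b\<close>, so it is also the boundary of some \<open>x\<close> of type N with such
  words, and \<open>E v b\<close> minus \<open>x\<close> is the required cycle.\<close>

lemma good_Suc: "good (Suc i)"
  unfolding good_def
proof (intro conjI ballI allI impI)
  show "Z (Suc i) \<subseteq> Vec (Suc i)" by auto
  show "(\<lambda>_. 0) \<in> Z (Suc i)" by (simp add: Vec_zero \<delta>_zero)
  show "(\<lambda>c. x c + y c) \<in> Z (Suc i)" if "x \<in> Z (Suc i)" "y \<in> Z (Suc i)" for x y
    using that by (simp add: Vec_add \<delta>_add)
  show "(\<lambda>c. r * y c) \<in> Z (Suc i)" if "r \<in> C" "y \<in> Z (Suc i)" for r y
    using that by (simp add: Vec_scale \<delta>_scale)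
  show "y = (\<lambda>_. 0)" if "y \<in> Z (Suc i)" "y \<in> VSp (Suc i) typeN" for y
    using that(2) by (rule \<delta>_typeN_inj) (use that(1) in simp)
  fix v b assume v: "std v" and b: "b \<in> W (Suc i)" and "\<not> typeN v b"
  obtain a c where ac: "b = a # c" "a \<in> L" "c \<in> W i" using b by (rule W_SucE)
  have vL: "set v \<subseteq> L" using v by (simp add: std_def)
  have nstd: "\<not> std (v @ [a])"
    using \<open>\<not> typeN v b\<close> ac by (auto simp: typeN_def std_def successively_append_iff)
  obtain l where l: "l \<in> VSp i (\<lambda>v' c'. v' @ c' \<sqsubset> v @ b)"
    and \<delta>: "\<delta> i (D i) (E v b) = (\<lambda>c'. E (v @ [a]) c c' + l c')"
    using \<delta>_basis[OF vL b] ac by auto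
  have "w @ c' \<sqsubset> v @ b" if "cf (E (v @ [a]) c c') w \<noteq> 0" for w c'
    using that straighten[OF _ nstd, of w] vL ac less_right[of w "v @ [a]" c]
    by (auto simp: E_def split: if_splits)
  moreover have "E (v @ [a]) c \<in> Vec i" using vL ac by (intro E_Vec) auto
  ultimately have "E (v @ [a]) c \<in> VSp i (\<lambda>v' c'. v' @ c' \<sqsubset> v @ b)" by (simp add: VSp_def)
  from VSp_add[OF this l] have "\<delta> i (D i) (E v b) \<in> VSp i (\<lambda>v' c'. v' @ c' \<sqsubset> v @ b)"
    by (simp add: \<delta>)
  moreover have "\<delta> i (D i) (E v b) \<in> Z i" using vL b by (intro \<delta>_Z E_Vec)
  ultimately obtain x where x: "x \<in> VSp (Suc i) (\<lambda>u b'. typeN u b' \<and> u @ b' \<sqsubset> v @ b)"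
    "\<delta> i (D i) (E v b) = \<delta> i (D i) x"
    using Z_elim[of "\<delta> i (D i) (E v b)" "\<lambda>w. w \<sqsubset> v @ b"] trans by blast
  have "(\<lambda>c. E v b c - x c) \<in> Vec (Suc i)"
    using Vec_add[OF E_Vec[OF vL b] VSp_Vec[OF VSp_uminus[OF x(1)]]] by simp
  then have "(\<lambda>c. E v b c - x c) \<in> Z (Suc i)" using x(2) by (simp add: \<delta>_diff)
  then show "\<exists>\<nu>\<in>VSp (Suc i) (\<lambda>v' c. typeN v' c \<and> v' @ c \<sqsubset> v @ b). (\<lambda>c. E v b c - \<nu> c) \<in> Z (Suc i)"
    using x(1) by blast
qed

end

text \<open>Straightening preserves length, so a product with a nonempty word never yields the empty
  word.\<close>

lemma cf_mult_Nil:
  assumes "r \<in> C" "s \<in> C" "cf s [] = 0"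
  shows "cf (r * s) [] = 0"
proof -
  have "r * s = (\<Sum>u | cf r u \<noteq> 0. \<iota> (cf r u) * (gm u * s))"
    by (subst expand[OF assms(1)]) (simp add: sum_distrib_right mult.assoc)
  also have "\<dots> \<in> Sp (\<lambda>v. v \<noteq> [])"
  proof (intro Sp_sum Sp_scale)
    fix u assume "u \<in> {u. cf r u \<noteq> 0}"
    then have "set u \<subseteq> L" using cf_std[OF assms(1)] by (auto simp: std_def)
    moreover have "s \<in> Sp (\<lambda>v. v \<noteq> [])" using assms by (auto simp: Sp_def)
    ultimately show "gm u * s \<in> Sp (\<lambda>v. v \<noteq> [])"
      by (elim gm_mult_Sp) (use less_length in fastforce)+
  qed
  finally show ?thesis by (auto simp: Sp_def)
qed

lemma good_zero: "good 0"
  unfolding good_def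
proof (intro conjI ballI allI impI)
  show "Z 0 \<subseteq> Vec 0" by auto
  show "(\<lambda>_. 0) \<in> Z 0" by (simp add: Vec_zero)
  show "(\<lambda>c. x c + y c) \<in> Z 0" if "x \<in> Z 0" "y \<in> Z 0" for x y
    using that by (auto simp: Vec_add cf_add Vec_C[of _ 0])
  show "(\<lambda>c. r * y c) \<in> Z 0" if "r \<in> C" "y \<in> Z 0" for r y
    using that by (auto simp: Vec_scale cf_mult_Nil Vec_C[of _ 0])
  show "y = (\<lambda>_. 0)" if "y \<in> Z 0" "y \<in> VSp 0 typeN" for y
  proof
    fix c
    have "y [] = 0" using that by (intro cf_eqI) (auto simp: VSp_def W_zero typeN_def Vec_C)
    then show "y c = 0" using that Vec_out[of y 0 c] by (cases "c = []") (auto simp: W_zero)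
  qed
  fix v b assume "std v" "b \<in> W 0" "\<not> typeN v b"
  then have "E v b \<in> Z 0"
    using E_Vec[of v b 0] by (auto simp: W_zero typeN_def E_def cf_gm std_def)
  then show "\<exists>\<nu>\<in>VSp 0 (\<lambda>v' c. typeN v' c \<and> v' @ c \<sqsubset> v @ b). (\<lambda>c. E v b c - \<nu> c) \<in> Z 0"
    by (intro bexI[of _ "\<lambda>_. 0"] VSp_zero) simp
qed

lemma good: "good i"
  by (induction i) (simp_all add: good_zero good_Suc)

end


section \<open>Rings given by a carrier inside a ring type\<close>

lemma ring_of_type_algebra_carrier_simps [simp]:
  "carrier (ring_of_type_algebra\<lparr>carrier := C\<rparr>) = C"
  "x \<otimes>\<^bsub>ring_of_type_algebra\<lparr>carrier := C\<rparr>\<^esub> y = x * y"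
  "\<one>\<^bsub>ring_of_type_algebra\<lparr>carrier := C\<rparr>\<^esub> = 1"
  "\<zero>\<^bsub>ring_of_type_algebra\<lparr>carrier := C\<rparr>\<^esub> = 0"
  "x \<oplus>\<^bsub>ring_of_type_algebra\<lparr>carrier := C\<rparr>\<^esub> y = x + y"
  "x \<otimes>\<^bsub>ring_of_type_algebra\<^esub> y = x * y"
  "\<one>\<^bsub>ring_of_type_algebra\<^esub> = 1"
  "\<zero>\<^bsub>ring_of_type_algebra\<^esub> = 0"
  "x \<oplus>\<^bsub>ring_of_type_algebra\<^esub> y = x + y"
  by (simp_all add: ring_of_type_algebra_def)

lemma cring_of_type_algebra_carrier:
  fixes C :: "'a::comm_ring_1 set"
  assumes "1 \<in> C" "\<And>x y. x \<in> C \<Longrightarrow> y \<in> C \<Longrightarrow> x + y \<in> C" "\<And>x y. x \<in> C \<Longrightarrow> y \<in> C \<Longrightarrow> x * y \<in> C"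
    and neg: "\<And>x. x \<in> C \<Longrightarrow> - x \<in> C"
  shows "cring (ring_of_type_algebra\<lparr>carrier := C\<rparr>)"
proof (rule cringI)
  have "0 \<in> C" using assms(2)[OF assms(1) neg[OF assms(1)]] by simp
  then show "abelian_group (ring_of_type_algebra\<lparr>carrier := C\<rparr>)"
    using assms by (intro abelian_groupI) (auto simp: add_ac intro!: bexI[OF _ neg])
  show "comm_monoid (ring_of_type_algebra\<lparr>carrier := C\<rparr>)"
    using assms by (intro comm_monoidI) (auto simp: mult_ac)
qed (simp add: distrib_right)

lemma additive_subgroup_of_type_algebra:
  fixes C :: "'a::comm_ring_1 set"
  assumes ring: "ring (ring_of_type_algebra\<lparr>carrier := C\<rparr>)" and "S \<subseteq> C" "0 \<in> S"
    and add: "\<And>x y. x \<in> S \<Longrightarrow> y \<in> S \<Longrightarrow> x + y \<in> S" and neg: "\<And>x. x \<in> S \<Longrightarrow> - x \<in> S"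
  shows "additive_subgroup S (ring_of_type_algebra\<lparr>carrier := C\<rparr>)"
proof (rule additive_subgroupI, rule group.subgroupI)
  let ?R = "ring_of_type_algebra\<lparr>carrier := C\<rparr>"
  show grp: "group (add_monoid ?R)" by (intro abelian_group.a_group ring.is_abelian_group ring)
  show "inv\<^bsub>add_monoid ?R\<^esub> a \<in> S" if "a \<in> S" for a
  proof -
    have "inv\<^bsub>add_monoid ?R\<^esub> a = - a"
      using that \<open>S \<subseteq> C\<close> neg by (intro group.inv_equality grp) auto
    then show ?thesis using neg that by simp
  qed
qed (use assms in auto)

context pbw_algebra
begin

abbreviation R :: "'r ring" where "R \<equiv> ring_of_type_algebra\<lparr>carrier := C\<rparr>"

lemma cring_R: "cring R"
  using C_one C_add C_mult C_uminus by (rule cring_of_type_algebra_carrier)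

definition J :: "'r set" where "J = {r \<in> C. cf r [] = 0}"

lemma ideal_J: "ideal J R"
proof (rule idealI)
  show ring: "ring R" using cring_R by (rule cring.axioms)
  have "additive_subgroup J R"
    by (rule additive_subgroup_of_type_algebra[OF ring])
      (auto simp: J_def C_zero C_add C_uminus cf_add cf_uminus)
  then show "subgroup J (add_monoid R)" by (rule additive_subgroup.a_subgroup)
  show "x \<otimes>\<^bsub>R\<^esub> a \<in> J" if "a \<in> J" "x \<in> carrier R" for a x
    using that by (simp add: J_def C_mult cf_mult_Nil)
  then show "a \<otimes>\<^bsub>R\<^esub> x \<in> J" if "a \<in> J" "x \<in> carrier R" for a x
    using that by (simp add: mult.commute)
qed

lemma gm_A: "std u \<Longrightarrow> gm u \<in> A (length u)"
  by (auto simp: A_iff cf_gm std_def C_gm split: if_splits)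

lemma A_C: "r \<in> A d \<Longrightarrow> r \<in> C"
  by (simp add: A_iff)

lemma irrelevant_ideal_eq: "irrelevant_ideal R A = J"
proof
  have "(\<Union>d\<in>{1..}. A d) \<subseteq> J" by (fastforce simp: J_def A_iff)
  then show "irrelevant_ideal R A \<subseteq> J"
    unfolding irrelevant_ideal_def
    by (intro ring.genideal_minimal ideal_J cring.axioms(1) cring_R)
  interpret I: ideal "irrelevant_ideal R A" R
    unfolding irrelevant_ideal_def
    by (intro ring.genideal_ideal cring.axioms(1) cring_R) (auto simp: A_C)
  show "J \<subseteq> irrelevant_ideal R A"
  proof
    fix r assume r: "r \<in> J"
    then have rC: "r \<in> C" by (simp add: J_def)
    have "(\<Sum>u\<in>U. \<iota> (cf r u) * gm u) \<in> irrelevant_ideal R A"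
      if "finite U" "U \<subseteq> {u. cf r u \<noteq> 0}" for U
      using that
    proof (induction U rule: finite_induct)
      case empty
      show ?case using additive_subgroup.zero_closed[OF ideal.axioms(1)[OF I.is_ideal]] by simp
    next
      case (insert u U)
      then have u: "std u" "u \<noteq> []" using r by (auto simp: J_def cf_std)
      then have "gm u \<in> A (length u)" "length u \<in> {1..}"
        by (auto simp: gm_A Suc_le_eq)
      then have "gm u \<in> irrelevant_ideal R A"
        unfolding irrelevant_ideal_def
        by (intro set_mp[OF ring.genideal_self[OF cring.axioms(1)[OF cring_R]]]) (auto simp: A_C)
      then have "\<iota> (cf r u) * gm u \<in> irrelevant_ideal R A"
        using I.I_l_closed[of "gm u" "\<iota> (cf r u)"] C_scalar by simp
      then show ?case using insert additive_subgroup.a_closed[OF ideal.axioms(1)[OF I.is_ideal]] by simp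
    qed
    from this[OF cf_finite[OF rC] order_refl] show "r \<in> irrelevant_ideal R A"
      using expand[OF rC] by simp
  qed
qed

lemma A_zero: "0 \<in> A d"
  by (simp add: A_iff C_zero)

lemma A_add: "r \<in> A d \<Longrightarrow> s \<in> A d \<Longrightarrow> r + s \<in> A d"
  by (auto simp: A_iff C_add cf_add) (metis add_0)

lemma A_sum: "(\<And>i. i \<in> I \<Longrightarrow> f i \<in> A d) \<Longrightarrow> sum f I \<in> A d"
  by (induction I rule: infinite_finite_induct) (simp_all add: A_zero A_add)

lemma A_mult:
  assumes r: "r \<in> A d" and s: "s \<in> A e"
  shows "r * s \<in> A (d + e)"
proof -
  have "r * s = (\<Sum>u | cf r u \<noteq> 0. \<iota> (cf r u) * (gm u * s))"
    by (subst expand[OF A_C[OF r]]) (simp add: sum_distrib_right mult.assoc)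
  also have "\<dots> \<in> Sp (\<lambda>v. length v = d + e)"
  proof (intro Sp_sum Sp_scale)
    fix u assume "u \<in> {u. cf r u \<noteq> 0}"
    then have u: "set u \<subseteq> L" "length u = d" using cf_std[OF A_C[OF r]] r by (auto simp: std_def A_iff)
    have "s \<in> Sp (\<lambda>v. length v = e)" using s by (auto simp: Sp_def A_iff)
    then show "gm u * s \<in> Sp (\<lambda>v. length v = d + e)"
      using u by (elim gm_mult_Sp) (auto dest: less_length)
  qed
  finally show ?thesis by (auto simp: A_iff Sp_def)
qed

text \<open>Linearity of the resolution: all words in the boundary of \<open>b\<close> have length
  \<open>Suc i\<close>, and \<open>i\<close> of the letters are taken by \<open>c\<close>.\<close>

lemma D_A:
  assumes b: "b \<in> W (Suc i)"
  shows "D i b c \<in> A 1"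
proof (cases "c \<in> W i")
  case True
  let ?d = "D i b c - E [hd b] (tl b) c"
  have "length b = Suc i" using b by (simp add: W_def)
  moreover have "hd b \<in> L" by (rule W_SucE[OF b]) simp
  ultimately have bl: "length b = Suc i" "hd b \<in> L" .
  have dC: "?d \<in> C" using Vec_C[OF VSp_Vec[OF D_spec(2)[OF good b]], of c] by simp
  have "length v = 1" if "cf ?d v \<noteq> 0" for v
  proof -
    have "v @ c \<sqsubset> b" using D_spec(2)[OF good b] True that by (simp add: VSp_def)
    then show ?thesis using bl True by (auto simp: W_def dest: less_length)
  qed
  then have d: "?d \<in> A 1" using dC by (simp add: A_iff)
  have "std [hd b]" using bl by (simp add: std_def)
  then have "E [hd b] (tl b) c \<in> A 1" using gm_A[of "[hd b]"] by (auto simp: E_def A_zero)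
  then show ?thesis using A_add[OF d, of "E [hd b] (tl b) c"] by simp
next
  case False
  then show ?thesis using Vec_out[OF Z_Vec[OF good D_spec(1)[OF good b]]] by (simp add: A_zero)
qed

section \<open>Generators indexed by natural numbers\<close>

context
  fixes enc :: "'a list \<Rightarrow> nat"
  assumes enc: "inj enc"
begin

definition B :: "nat \<Rightarrow> nat set" where "B i = enc ` W i"

lemma enc_B [simp]: "enc b \<in> B i \<longleftrightarrow> b \<in> W i"
  using enc by (auto simp: B_def inj_eq)

lemma inv_enc [simp]: "inv_into UNIV enc (enc b) = b"
  using enc by simp

lemma BE: "m \<in> B i \<Longrightarrow> (\<And>b. b \<in> W i \<Longrightarrow> m = enc b \<Longrightarrow> P) \<Longrightarrow> P"
  by (auto simp: B_def)

text \<open>Elements of \<open>free_module\<close> are extensional, hence \<open>undefined\<close>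
  off the index set, whereas \<open>Vec\<close> extends by 0. \<open>to_vec\<close> and
  \<open>of_vec\<close> translate between the two conventions.\<close>

definition to_vec :: "nat \<Rightarrow> (nat \<Rightarrow> 'r) \<Rightarrow> 'a list \<Rightarrow> 'r"
  where "to_vec i u = (\<lambda>b. if b \<in> W i then u (enc b) else 0)"

definition of_vec :: "nat \<Rightarrow> ('a list \<Rightarrow> 'r) \<Rightarrow> nat \<Rightarrow> 'r"
  where "of_vec i x = (\<lambda>m\<in>B i. x (inv_into UNIV enc m))"

definition diff :: "nat \<Rightarrow> (nat \<Rightarrow> 'r) \<Rightarrow> nat \<Rightarrow> 'r"
  where "diff i u = of_vec i (\<delta> i (D i) (to_vec (Suc i) u))"

definition augment :: "(nat \<Rightarrow> 'r) \<Rightarrow> 'r set"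
  where "augment u = J +>\<^bsub>R\<^esub> u (enc [])"

abbreviation F where "F i \<equiv> free_module R (B i)"

lemma F_carrier: "carrier (F i) = B i \<rightarrow>\<^sub>E C"
  using finite_W[of i] by (auto simp: free_module_def B_def)

lemma F_simps:
  "\<zero>\<^bsub>F i\<^esub> = (\<lambda>b\<in>B i. 0)" "u \<oplus>\<^bsub>F i\<^esub> v = (\<lambda>b\<in>B i. u b + v b)" "r \<odot>\<^bsub>F i\<^esub> u = (\<lambda>b\<in>B i. r * u b)"
  by (simp_all add: free_module_def)

lemma to_vec_Vec:
  assumes "u \<in> carrier (F i)"
  shows "to_vec i u \<in> Vec i"
proof -
  have "u \<in> B i \<rightarrow>\<^sub>E C" using assms by (simp add: F_carrier)
  then show ?thesis by (auto simp: to_vec_def Vec_def)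
qed

lemma of_vec_carrier: "x \<in> Vec i \<Longrightarrow> of_vec i x \<in> carrier (F i)"
  using Vec_C[of x i] by (auto simp: of_vec_def F_carrier)

lemma of_to_vec:
  assumes "u \<in> carrier (F i)"
  shows "of_vec i (to_vec i u) = u"
proof
  fix m
  have "u \<in> B i \<rightarrow>\<^sub>E C" using assms by (simp add: F_carrier)
  then show "of_vec i (to_vec i u) m = u m"
    by (cases "m \<in> B i") (auto simp: of_vec_def to_vec_def elim: BE)
qed

lemma to_of_vec: "x \<in> Vec i \<Longrightarrow> to_vec i (of_vec i x) = x"
  by (rule ext) (simp add: of_vec_def to_vec_def Vec_def)

lemma to_vec_simps:
  "to_vec i (\<zero>\<^bsub>F i\<^esub>) = (\<lambda>_. 0)"
  "to_vec i (u \<oplus>\<^bsub>F i\<^esub> v) = (\<lambda>b. to_vec i u b + to_vec i v b)"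
  "to_vec i (r \<odot>\<^bsub>F i\<^esub> u) = (\<lambda>b. r * to_vec i u b)"
  by (auto simp: to_vec_def F_simps)

lemma of_vec_simps:
  "of_vec i (\<lambda>_. 0) = \<zero>\<^bsub>F i\<^esub>"
  "of_vec i (\<lambda>b. x b + y b) = of_vec i x \<oplus>\<^bsub>F i\<^esub> of_vec i y"
  "of_vec i (\<lambda>b. r * x b) = r \<odot>\<^bsub>F i\<^esub> of_vec i x"
  by (auto simp: of_vec_def F_simps fun_eq_iff restrict_def)

lemma \<delta>_Vec: "x \<in> Vec (Suc i) \<Longrightarrow> \<delta> i (D i) x \<in> Vec i"
  using \<delta>_Z[OF good] Z_Vec[OF good] by blast

lemma diff_mod_hom: "diff i \<in> mod_hom R (F (Suc i)) (F i)"
  unfolding mod_hom_def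
proof (intro CollectI conjI ballI Pi_I)
  show "diff i u \<in> carrier (F i)" if "u \<in> carrier (F (Suc i))" for u
    unfolding diff_def using that by (intro of_vec_carrier \<delta>_Vec to_vec_Vec)
qed (simp_all add: diff_def to_vec_simps \<delta>_add \<delta>_scale of_vec_simps)

lemma diff_graded: "diff i ` free_grading R A (B (Suc i)) (Suc i) d \<subseteq> free_grading R A (B i) i d"
proof
  fix v assume "v \<in> diff i ` free_grading R A (B (Suc i)) (Suc i) d"
  then obtain u where u: "u \<in> carrier (F (Suc i))" and v: "v = diff i u"
    and deg: "\<And>b. b \<in> B (Suc i) \<Longrightarrow> u b \<in> (if Suc i \<le> d then A (d - Suc i) else {\<zero>\<^bsub>R\<^esub>})"
    unfolding free_grading_def by blast
  have "v b \<in> (if i \<le> d then A (d - i) else {\<zero>\<^bsub>R\<^esub>})" if "b \<in> B i" for b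
  proof -
    obtain c where c: "c \<in> W i" "b = enc c" using \<open>b \<in> B i\<close> by (rule BE)
    then have vb: "v b = (\<Sum>b\<in>W (Suc i). u (enc b) * D i b c)"
      by (simp add: v diff_def of_vec_def \<delta>_def to_vec_def)
    show ?thesis
    proof (cases "Suc i \<le> d")
      case True
      have "u (enc b') * D i b' c \<in> A (d - Suc i + 1)" if "b' \<in> W (Suc i)" for b'
        using deg[of "enc b'"] that True by (intro A_mult D_A) simp_all
      then have "v b \<in> A (d - Suc i + 1)" unfolding vb by (intro A_sum)
      then show ?thesis using True by (simp add: Suc_diff_Suc Suc_le_eq)
    next
      case False
      then have "v b = 0" unfolding vb using deg by (intro sum.neutral) auto
      then show ?thesis by (simp add: A_zero)
    qed
  qed
  moreover have "v \<in> carrier (F i)"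
    using diff_mod_hom[of i] u unfolding mod_hom_def v by blast
  ultimately show "v \<in> free_grading R A (B i) i d"
    unfolding free_grading_def by blast
qed

lemma diff_image: "diff i ` carrier (F (Suc i)) = of_vec i ` Z i"
proof
  show "diff i ` carrier (F (Suc i)) \<subseteq> of_vec i ` Z i"
  proof
    fix v assume "v \<in> diff i ` carrier (F (Suc i))"
    then obtain u where u: "u \<in> carrier (F (Suc i))" and v: "v = diff i u" by blast
    then show "v \<in> of_vec i ` Z i"
      using imageI[OF \<delta>_Z[OF good to_vec_Vec[OF u]]] by (simp only: v diff_def)
  qed
  show "of_vec i ` Z i \<subseteq> diff i ` carrier (F (Suc i))"
  proof
    fix u assume "u \<in> of_vec i ` Z i"
    then obtain y where y: "y \<in> Z i" "u = of_vec i y" by blast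
    have "y \<in> \<delta> i (D i) ` Vec (Suc i)"
      using y(1) by (rule equalityD1[OF exact[OF good], THEN subsetD])
    then obtain x where x: "x \<in> Vec (Suc i)" "u = of_vec i (\<delta> i (D i) x)" using y(2) by blast
    then have "u = diff i (of_vec (Suc i) x)" by (simp add: diff_def to_of_vec)
    then show "u \<in> diff i ` carrier (F (Suc i))" using of_vec_carrier[OF x(1)] by blast
  qed
qed

lemma diff_kernel: "a_kernel (F (Suc i)) (F i) (diff i) = of_vec (Suc i) ` Z (Suc i)"
proof (intro equalityI subsetI)
  fix u assume "u \<in> a_kernel (F (Suc i)) (F i) (diff i)"
  then have u: "u \<in> carrier (F (Suc i))" and "diff i u = \<zero>\<^bsub>F i\<^esub>" by (auto simp: a_kernel_def')
  then have "to_vec i (diff i u) = (\<lambda>_. 0)" by (simp add: to_vec_simps)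
  then have "\<delta> i (D i) (to_vec (Suc i) u) = (\<lambda>_. 0)"
    using u by (simp add: diff_def to_of_vec \<delta>_Vec to_vec_Vec)
  then have "to_vec (Suc i) u \<in> Z (Suc i)" using u by (simp add: to_vec_Vec)
  then show "u \<in> of_vec (Suc i) ` Z (Suc i)" using of_to_vec[OF u] by (metis imageI)
next
  fix u assume "u \<in> of_vec (Suc i) ` Z (Suc i)"
  then obtain x where "x \<in> Vec (Suc i)" "\<delta> i (D i) x = (\<lambda>_. 0)" "u = of_vec (Suc i) x" by auto
  then show "u \<in> a_kernel (F (Suc i)) (F i) (diff i)"
    by (simp add: a_kernel_def' of_vec_carrier diff_def to_of_vec of_vec_simps)
qed

abbreviation K where "K \<equiv> residue_module R A"

lemma K_simps:
  "carrier K = a_rcosets\<^bsub>R\<^esub> J" "\<zero>\<^bsub>K\<^esub> = J" "U \<oplus>\<^bsub>K\<^esub> V = U <+>\<^bsub>R\<^esub> V"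
  "r \<odot>\<^bsub>K\<^esub> U = rcoset_mult R J (J +>\<^bsub>R\<^esub> r) U"
  by (simp_all add: residue_module_def irrelevant_ideal_eq FactRing_def Let_def)

lemma enc_Nil: "enc [] \<in> B 0"
  by (simp add: W_zero)

lemma augment_mod_hom: "augment \<in> mod_hom R (F 0) K"
proof -
  interpret J: ideal J R by (rule ideal_J)
  show ?thesis
    unfolding mod_hom_def
  proof (intro CollectI conjI ballI Pi_I)
    fix u assume u: "u \<in> carrier (F 0)"
    then have uC: "u (enc []) \<in> C" using enc_Nil by (auto simp: F_carrier)
    then show "augment u \<in> carrier K"
      using J.a_rcosetsI[of J] J.a_subset by (simp add: augment_def K_simps)
    show "augment (u \<oplus>\<^bsub>F 0\<^esub> v) = augment u \<oplus>\<^bsub>K\<^esub> augment v" if v: "v \<in> carrier (F 0)" for v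
    proof -
      have "v (enc []) \<in> C" using v enc_Nil by (auto simp: F_carrier)
      then show ?thesis
        using J.a_rcos_sum[of "u (enc [])" "v (enc [])"] uC enc_Nil
        by (simp add: augment_def F_simps K_simps)
    qed
    show "augment (r \<odot>\<^bsub>F 0\<^esub> u) = r \<odot>\<^bsub>K\<^esub> augment u" if "r \<in> carrier R" for r
      using J.rcoset_mult_add[of r "u (enc [])"] uC that enc_Nil
      by (simp add: augment_def F_simps K_simps)
  qed
qed

lemma augment_eq_zero:
  assumes "u \<in> carrier (F 0)"
  shows "augment u = J \<longleftrightarrow> u (enc []) \<in> J"
proof -
  interpret J: ideal J R by (rule ideal_J)
  have uC: "u (enc []) \<in> C" using assms enc_Nil by (auto simp: F_carrier)
  show ?thesis
    using J.a_rcos_self[of "u (enc [])"] J.a_rcos_const[of "u (enc [])"] uC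
    by (auto simp: augment_def)
qed

lemma linear_free_resolution_B: "linear_free_resolution R A B diff augment"
  unfolding linear_free_resolution_def Let_def
proof (intro conjI allI)
  show "diff i \<in> graded_hom R (F (Suc i)) (free_grading R A (B (Suc i)) (Suc i)) (F i)
      (free_grading R A (B i) i)" for i
    using diff_mod_hom diff_graded by (simp add: graded_hom_def)
  have "augment ` free_grading R A (B 0) 0 d \<subseteq> residue_grading R A d" for d
  proof (cases "d = 0")
    case True
    then show ?thesis
      using augment_mod_hom by (auto simp: residue_grading_def free_grading_def mod_hom_def)
  next
    case False
    have "augment u = J" if "u \<in> free_grading R A (B 0) 0 d" for u
    proof -
      have "u \<in> carrier (F 0)" "u (enc []) \<in> A d"
        using that enc_Nil by (auto simp: free_grading_def)
      then have "u (enc []) \<in> J" using False by (auto simp: J_def A_iff)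
      then show ?thesis using augment_eq_zero \<open>u \<in> carrier (F 0)\<close> by blast
    qed
    then show ?thesis using False by (auto simp: residue_grading_def K_simps)
  qed
  then show "augment \<in> graded_hom R (F 0) (free_grading R A (B 0) 0) K (residue_grading R A)"
    using augment_mod_hom by (simp add: graded_hom_def)
  show "augment ` carrier (F 0) = carrier K"
  proof
    show "augment ` carrier (F 0) \<subseteq> carrier K" using augment_mod_hom by (auto simp: mod_hom_def)
    show "carrier K \<subseteq> augment ` carrier (F 0)"
    proof
      fix U assume "U \<in> carrier K"
      then obtain r where r: "r \<in> C" "U = J +>\<^bsub>R\<^esub> r" by (auto simp: K_simps A_RCOSETS_def')
      let ?u = "\<lambda>b\<in>B 0. r"
      have "?u \<in> carrier (F 0)" "augment ?u = U" using r enc_Nil by (auto simp: F_carrier augment_def)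
      then show "U \<in> augment ` carrier (F 0)" by blast
    qed
  qed
  have "a_kernel (F 0) K augment = of_vec 0 ` Z 0"
  proof (intro equalityI subsetI)
    fix u assume "u \<in> a_kernel (F 0) K augment"
    then have u: "u \<in> carrier (F 0)" "u (enc []) \<in> J"
      using augment_eq_zero by (auto simp: a_kernel_def' K_simps)
    then have "to_vec 0 u \<in> Vec 0" "to_vec 0 u [] = u (enc [])"
      by (simp_all only: to_vec_Vec) (simp add: to_vec_def W_zero)
    then have "to_vec 0 u \<in> Z 0" using u by (simp add: J_def)
    then show "u \<in> of_vec 0 ` Z 0" using of_to_vec[OF u(1)] by (metis imageI)
  next
    fix u assume "u \<in> of_vec 0 ` Z 0"
    then obtain x where x: "x \<in> Vec 0" "cf (x []) [] = 0" "u = of_vec 0 x" by auto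
    then have "u (enc []) = x []" by (simp add: of_vec_def W_zero)
    then show "u \<in> a_kernel (F 0) K augment"
      using x of_vec_carrier augment_eq_zero[of u] Vec_C[of x 0 "[]"]
      by (simp add: a_kernel_def' K_simps J_def)
  qed
  then show "diff 0 ` carrier (F 1) = a_kernel (F 0) K augment"
    using diff_image[of 0] by simp
  show "diff (Suc i) ` carrier (F (Suc (Suc i))) = a_kernel (F (Suc i)) (F i) (diff i)" for i
    using diff_image[of "Suc i"] diff_kernel[of i] by simp
qed

end

end


section \<open>The connected grading\<close>

context pbw_algebra
begin

lemma finsum_R: "finite S \<Longrightarrow> f \<in> S \<rightarrow> C \<Longrightarrow> finsum R f S = sum f S"
proof (induction S rule: finite_induct)
  case empty
  show ?case using abelian_monoid.finsum_empty[of R] cring_R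
    by (simp add: cring.axioms(1) ring.is_abelian_group abelian_group.axioms(1))
next
  case (insert x S)
  have "abelian_monoid R"
    using cring_R by (simp add: cring.axioms(1) ring.is_abelian_group abelian_group.axioms(1))
  from abelian_monoid.finsum_insert[OF this insert.hyps, of f] insert show ?case by auto
qed

lemma cf_one_scalar: "cf (\<iota> c) u = (if u = [] then c else 0)"
  using cf_scale[OF C_one, of c u] cf_gm[of "[]" u] by (simp add: gm_def std_def)

lemma bij_scalars: "bij_betw \<iota> UNIV (A 0)"
  unfolding bij_betw_def
proof
  show "inj \<iota>" by (rule injI) (metis cf_one_scalar)
  show "range \<iota> = A 0"
  proof (intro equalityI subsetI)
    fix r assume r: "r \<in> A 0"
    then have rC: "r \<in> C" by (rule A_C)
    have "cf (r - \<iota> (cf r [])) u = 0" for u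
      using r by (auto simp: cf_diff rC C_scalar cf_one_scalar A_iff)
    then have "r = \<iota> (cf r [])" using cf_eqI[of "r - \<iota> (cf r [])"] by (simp add: C_diff rC C_scalar)
    then show "r \<in> range \<iota>" by blast
  qed (auto simp: A_iff C_scalar cf_one_scalar split: if_splits)
qed

lemma A_uminus: "r \<in> A d \<Longrightarrow> - r \<in> A d"
  by (simp add: A_iff C_uminus cf_uminus)

text \<open>Existence groups the expansion by word length. For uniqueness, the coefficient of
  \<open>u\<close> in a component can only be that of \<open>a\<close> when the degree is
  \<open>length u\<close>, and 0 otherwise.\<close>

lemma unique_decomposition:
  assumes a: "a \<in> C"
  shows "\<exists>!f. (\<forall>d. f d \<in> A d) \<and> finite {d. f d \<noteq> 0} \<and> a = finsum R f {d. f d \<noteq> 0}"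
proof (rule ex_ex1I)
  let ?U = "{u. cf a u \<noteq> 0}"
  define f where "f d = (\<Sum>u\<in>{u \<in> ?U. length u = d}. \<iota> (cf a u) * gm u)" for d
  have fin: "finite ?U" by (rule cf_finite[OF a])
  have fA: "f d \<in> A d" for d
    unfolding f_def
  proof (rule A_sum)
    fix u assume "u \<in> {u \<in> ?U. length u = d}"
    then have "gm u \<in> A d" using gm_A[of u] cf_std[OF a] by auto
    then show "\<iota> (cf a u) * gm u \<in> A d" by (auto simp: A_iff C_mult C_scalar cf_scale)
  qed
  have sub: "{d. f d \<noteq> 0} \<subseteq> length ` ?U"
  proof
    fix d assume "d \<in> {d. f d \<noteq> 0}"
    then have "{u \<in> ?U. length u = d} \<noteq> {}" unfolding f_def by (intro notI) (simp only: mem_Collect_eq sum.empty simp_thms)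
    then show "d \<in> length ` ?U" by blast
  qed
  have finS: "finite {d. f d \<noteq> 0}" using finite_subset[OF sub] fin by simp
  have "a = (\<Sum>u\<in>?U. \<iota> (cf a u) * gm u)" by (rule expand[OF a])
  also have "\<dots> = (\<Sum>d\<in>length ` ?U. f d)" unfolding f_def by (rule sum.image_gen[OF fin])
  also have "\<dots> = (\<Sum>d\<in>{d. f d \<noteq> 0}. f d)" using sub fin by (intro sum.mono_neutral_right) auto
  also have "\<dots> = finsum R f {d. f d \<noteq> 0}" using finS fA A_C by (intro finsum_R[symmetric]) auto
  finally show "\<exists>f. (\<forall>d. f d \<in> A d) \<and> finite {d. f d \<noteq> 0} \<and> a = finsum R f {d. f d \<noteq> 0}"
    using fA finS by blast
next
  have cf_f: "cf (f d) u = (if length u = d then cf a u else 0)"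
    if f: "(\<forall>d. f d \<in> A d) \<and> finite {d. f d \<noteq> 0} \<and> a = finsum R f {d. f d \<noteq> 0}" for f d u
  proof -
    have fC: "f e \<in> C" for e using f A_C by blast
    have "a = (\<Sum>e\<in>{e. f e \<noteq> 0}. f e)" using f fC finsum_R[of "{d. f d \<noteq> 0}" f] by simp
    then have "cf a u = (\<Sum>e\<in>{e. f e \<noteq> 0}. cf (f e) u)" using fC cf_sum by metis
    also have "\<dots> = (\<Sum>e\<in>{e. f e \<noteq> 0}. if e = length u then cf (f (length u)) u else 0)"
      using f by (intro sum.cong) (auto simp: A_iff)
    also have "\<dots> = cf (f (length u)) u" using f by auto
    finally show ?thesis using f by (auto simp: A_iff)
  qed
  fix f f' assume f: "(\<forall>d. f d \<in> A d) \<and> finite {d. f d \<noteq> 0} \<and> a = finsum R f {d. f d \<noteq> 0}"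
    and f': "(\<forall>d. f' d \<in> A d) \<and> finite {d. f' d \<noteq> 0} \<and> a = finsum R f' {d. f' d \<noteq> 0}"
  show "f = f'"
  proof
    fix d
    have C: "f d \<in> C" "f' d \<in> C" using f f' A_C by blast+
    have "cf (f d - f' d) u = 0" for u
      using C by (simp add: cf_diff cf_f[OF f] cf_f[OF f'])
    then show "f d = f' d" using cf_eqI[of "f d - f' d"] C by (simp add: C_diff)
  qed
qed

lemma connected_graded_algebra_R: "connected_graded_algebra \<iota> R A"
  unfolding connected_graded_algebra_def
proof (intro conjI allI ballI)
  show "cring R" by (rule cring_R)
  show "\<iota> \<in> ring_hom ring_of_type_algebra R"
    by (rule ring_hom_memI) (simp_all add: C_scalar \<iota>_add \<iota>_mult \<iota>_one)
  show "bij_betw \<iota> UNIV (A 0)" by (rule bij_scalars)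
  show "additive_subgroup (A d) R" for d
    by (rule additive_subgroup_of_type_algebra[OF cring.axioms(1)[OF cring_R]])
      (auto simp: A_zero A_add A_uminus dest: A_C)
  show "a \<otimes>\<^bsub>R\<^esub> b \<in> A (d + e)" if "a \<in> A d" "b \<in> A e" for a b d e
    using A_mult[OF that] by simp
  show "\<exists>!f. (\<forall>d. f d \<in> A d) \<and> finite {d. f d \<noteq> \<zero>\<^bsub>R\<^esub>} \<and> a = finsum R f {d. f d \<noteq> \<zero>\<^bsub>R\<^esub>}"
    if "a \<in> carrier R" for a
    using unique_decomposition[of a] that by simp
qed

theorem koszul:
  fixes enc :: "'a list \<Rightarrow> nat"
  assumes "inj enc"
  shows "koszul \<iota> R A"
  unfolding koszul_def using connected_graded_algebra_R linear_free_resolution_B[OF assms] by blast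

end


section \<open>Chains in the fence order\<close>

text \<open>Evens are minimal and odds maximal. Translations by even integers and reflections t ->
  2c - t are automorphisms; \<open>part_shift\<close> and \<open>part_reflect\<close> are the
  corresponding symmetries of chains.\<close>

definition fence :: "int \<Rightarrow> int \<Rightarrow> bool"
  where "fence s t \<longleftrightarrow> s = t \<or> odd t \<and> (t = s + 1 \<or> s = t + 1)"

lemma fence_refl: "fence t t"
  by (simp add: fence_def)

lemma fence_trans: "fence s t \<Longrightarrow> fence t u \<Longrightarrow> fence s u"
  by (auto simp: fence_def)

text \<open>The \<open>d\<close> values \<open>part d j s\<close> form the unique chain of length \<open>d\<close> with sum \<open>s\<close>.\<close>

definition part :: "nat \<Rightarrow> nat \<Rightarrow> int \<Rightarrow> int"
  where "part d j s = (s + int d + int j) div (2 * int d) + (s + int d - 1 - int j) div (2 * int d)"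

lemma part_mono: "s \<le> t \<Longrightarrow> part d j s \<le> part d j t"
  unfolding part_def by (cases "d = 0") (auto intro!: add_mono zdiv_mono1)

lemma part_shift:
  assumes "0 < d"
  shows "part d j (s + int d * (2 * c)) = part d j s + 2 * c"
proof -
  have "(s + int d * (2 * c) + x) div (2 * int d) = (s + x) div (2 * int d) + c" for x
    using div_mult_self1[of "2 * int d" "s + x" c] assms by (simp add: algebra_simps)
  from this[of "int d + int j"] this[of "int d - 1 - int j"] show ?thesis
    by (simp add: part_def algebra_simps)
qed

lemma uminus_div_int:
  fixes x m :: int
  assumes "0 < m"
  shows "(- x) div m = - ((x + m - 1) div m)"
proof -
  have "(x + m - 1) div m * m + (x + m - 1) mod m = x + m - 1" by simp
  moreover have "0 \<le> (x + m - 1) mod m" "(x + m - 1) mod m < m" using assms by simp_all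
  ultimately show ?thesis
    by (intro int_div_pos_eq[of "- x" m _ "m - 1 - (x + m - 1) mod m"]) (simp_all add: algebra_simps)
qed

text \<open>Negation turns a floor into a ceiling, and thereby exchanges the two floors in
  \<open>part\<close>, whose offsets \<open>d + j\<close> and \<open>d - 1 - j\<close> add up to
  \<open>2 * d - 1\<close>.\<close>

lemma part_reflect:
  assumes "0 < d"
  shows "part d j (2 * c * int d - s) = 2 * c - part d j s"
proof -
  have "(2 * c * int d - s + x) div (2 * int d) = c - (s - x + 2 * int d - 1) div (2 * int d)" for x
  proof -
    have "2 * c * int d - s + x = - (s - x) + c * (2 * int d)" by (simp add: algebra_simps)
    then have "(2 * c * int d - s + x) div (2 * int d) = c + (- (s - x)) div (2 * int d)"
      using assms by (metis div_mult_self3 mult_zero_right of_nat_0_less_iff zero_less_mult_iff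
          less_irrefl zero_less_numeral add.commute div_mult_self1 mult.commute)
    then show ?thesis using uminus_div_int[of "2 * int d" "s - x"] assms by simp
  qed
  from this[of "int d + int j"] this[of "int d - 1 - int j"] show ?thesis
    by (simp add: part_def algebra_simps)
qed

text \<open>Hermite's identity. Raising \<open>s\<close> by 1 shifts the summands by one place and
  trades the lowest for itself plus 1; the identity holds at 0.\<close>

lemma hermite_sum:
  assumes "0 < m"
  shows "(\<Sum>k<m. (s + int k) div int m) = s"
proof -
  define f where "f s = (\<Sum>k<m. (s + int k) div int m)" for s
  have step: "f (s + 1) = f s + 1" for s
  proof -
    have "f (s + 1) + s div int m = (\<Sum>k<Suc m. (s + int k) div int m)"
      unfolding f_def by (subst sum.lessThan_Suc_shift) (simp add: add_ac)
    also have "\<dots> = f s + (s + int m) div int m" by (simp add: f_def)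
    also have "(s + int m) div int m = s div int m + 1" using assms by simp
    finally show ?thesis by simp
  qed
  have "f 0 = 0" unfolding f_def by (rule sum.neutral) simp
  have "f s = s"
  proof (induction s rule: int_induct[of _ 0])
    case (step2 i)
    then show ?case using step[of "i - 1"] by simp
  qed (simp_all add: \<open>f 0 = 0\<close> step)
  then show ?thesis by (simp add: f_def)
qed

lemma sum_lessThan_add:
  fixes g :: "nat \<Rightarrow> 'a::comm_monoid_add"
  shows "(\<Sum>k<m + l. g k) = (\<Sum>k<m. g k) + (\<Sum>k<l. g (m + k))"
  by (induction l) (simp_all add: add.assoc)

text \<open>The values \<open>part d j s\<close> are the \<open>2 * d\<close> summands of Hermite's
  identity for modulus \<open>2 * d\<close>, taken in the pairs with offsets
  \<open>d - 1 - j\<close> and \<open>d + j\<close>.\<close>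

lemma sum_part:
  assumes "0 < d"
  shows "(\<Sum>j<d. part d j s) = s"
proof -
  let ?g = "\<lambda>k. (s + int k) div int (2 * d)"
  have "(\<Sum>j<d. (s + int d - 1 - int j) div (2 * int d)) = (\<Sum>j<d. ?g (d - Suc j))"
    by (intro sum.cong) (auto simp: of_nat_diff algebra_simps)
  also have "\<dots> = (\<Sum>k<d. ?g k)" by (rule sum.nat_diff_reindex)
  finally have "(\<Sum>j<d. part d j s) = (\<Sum>k<d. ?g k) + (\<Sum>j<d. ?g (d + j))"
    by (simp add: part_def sum.distrib add.assoc)
  also have "\<dots> = (\<Sum>k<d + d. ?g k)" by (rule sum_lessThan_add[symmetric])
  also have "\<dots> = s" unfolding mult_2 by (rule hermite_sum) (use assms in simp)
  finally show ?thesis .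
qed

text \<open>With quotient q and remainder r modulo \<open>2 * d\<close>: for r at most d the values
  are 2q followed by r copies of 2q + 1; for larger r they are r - d copies of 2q + 2 followed by
  copies of 2q + 1. The even values always come first.\<close>

lemma part_eq:
  assumes "j < d"
  shows "part d j s = 2 * (s div (2 * int d)) + of_bool (int d - int j \<le> s mod (2 * int d))
    + of_bool (int d + 1 + int j \<le> s mod (2 * int d))"
proof -
  define q r where "q = s div (2 * int d)" and "r = s mod (2 * int d)"
  have s: "s = q * (2 * int d) + r" unfolding q_def r_def by (rule div_mult_mod_eq[symmetric])
  have r: "0 \<le> r" "r < 2 * int d" using assms by (simp_all add: r_def)
  have "(s + int d + int j) div (2 * int d) = q + of_bool (int d - int j \<le> r)"
    by (rule int_div_pos_eq[of _ _ _ "if int d - int j \<le> r then r + int j - int d else r + int d + int j"])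
      (use r assms in \<open>auto simp: s algebra_simps\<close>)
  moreover have "(s + int d - 1 - int j) div (2 * int d) = q + of_bool (int d + 1 + int j \<le> r)"
    by (rule int_div_pos_eq[of _ _ _
          "if int d + 1 + int j \<le> r then r - int d - 1 - int j else r + int d - 1 - int j"])
      (use r assms in \<open>auto simp: s algebra_simps\<close>)
  ultimately show ?thesis by (simp add: part_def q_def r_def)
qed

lemma part_fence: "j \<le> j' \<Longrightarrow> j' < d \<Longrightarrow> fence (part d j s) (part d j' s)"
  by (auto simp: part_eq fence_def)

text \<open>A strict step leads from an even to an adjacent odd number, so a chain has at most
  one.\<close>

lemma fence_chainE:
  assumes "sorted_wrt fence xs" "xs \<noteq> []"
  obtains a e k t where "xs = replicate a e @ replicate k t" "even e" "t = e + 1 \<or> t = e - 1"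
proof -
  have "\<exists>a e k t. xs = replicate a e @ replicate k t \<and> even e \<and> (t = e + 1 \<or> t = e - 1)"
    using assms
  proof (induction xs)
    case (Cons x xs)
    show ?case
    proof (cases "xs = []")
      case True
      show ?thesis
      proof (cases "even x")
        case e: True
        then show ?thesis using True by (intro exI[of _ 1] exI[of _ x] exI[of _ 0] exI[of _ "x + 1"]) simp
      next
        case False
        then show ?thesis using True by (intro exI[of _ 0] exI[of _ "x - 1"] exI[of _ 1] exI[of _ x]) simp
      qed
    next
      case False
      then obtain a e k t where xs: "xs = replicate a e @ replicate k t" "even e" "t = e + 1 \<or> t = e - 1"
        using Cons by auto
      show ?thesis
      proof (cases "x = t \<or> x = e")
        case True
        show ?thesis
        proof (cases "a = 0 \<and> x = t")
          case True
          then show ?thesis using xs by (intro exI[of _ 0] exI[of _ e] exI[of _ "Suc k"] exI[of _ t]) simp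
        next
          case False
          then have "x = e" using True Cons.prems xs by (cases a) (auto simp: fence_def)
          then show ?thesis using xs by (intro exI[of _ "Suc a"] exI[of _ e] exI[of _ k] exI[of _ t]) simp
        qed
      next
        case False
        then have "a = 0" using Cons.prems xs by (cases a) (auto simp: fence_def)
        moreover have "k \<noteq> 0" using \<open>a = 0\<close> xs \<open>xs \<noteq> []\<close> by auto
        moreover have "fence x t" using Cons.prems xs \<open>k \<noteq> 0\<close> by auto
        ultimately show ?thesis using xs False
          by (intro exI[of _ 1] exI[of _ x] exI[of _ k] exI[of _ t]) (auto simp: fence_def)
      qed
    qed
  qed simp
  then show ?thesis using that by blast
qed

text \<open>Translating the even value \<open>e\<close> to 0, and reflecting if the odd value is
  \<open>e - 1\<close>, reduces the chain to zeros followed by \<open>k\<close> ones, which are the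
  parts of \<open>k\<close>.\<close>

lemma fence_chain_eq_part:
  assumes xs: "sorted_wrt fence xs" and j: "j < length xs"
  shows "xs ! j = part (length xs) j (sum_list xs)"
proof -
  define d where "d = length xs"
  have "xs \<noteq> []" using j by auto
  obtain a e k t where eq: "xs = replicate a e @ replicate k t" and "even e"
    and t: "t = e + 1 \<or> t = e - 1"
    using fence_chainE[OF xs \<open>xs \<noteq> []\<close>] by blast
  obtain c where e: "e = 2 * c" using \<open>even e\<close> by (elim evenE)
  have d: "d = a + k" "j < d" "0 < d" using eq j by (auto simp: d_def)
  have k: "part d j (int k) = of_bool (a \<le> j)"
    using d by (auto simp: part_eq)
  have sum: "sum_list xs = int a * e + int k * t" by (simp add: eq sum_list_replicate)
  have nth: "xs ! j = (if a \<le> j then t else e)"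
    using d by (auto simp: eq nth_append)
  from t have "xs ! j = part d j (sum_list xs)"
  proof
    assume t: "t = e + 1"
    then have "sum_list xs = int k + int d * (2 * c)" by (simp add: sum e d algebra_simps)
    then show ?thesis using part_shift[OF d(3), of j "int k" c] k t nth by (simp add: e)
  next
    assume t: "t = e - 1"
    then have "sum_list xs = 2 * c * int d - int k"
      unfolding sum t e d by (simp add: algebra_simps)
    then show ?thesis using part_reflect[OF d(3), of j c "int k"] k t nth by (simp add: e)
  qed
  then show ?thesis by (simp add: d_def)
qed


section \<open>Tableaux as lattice paths\<close>

text \<open>\<open>T m\<close> is the number of entries at most \<open>m\<close> in the top row of a tableau of content \<open>d w\<close>.\<close>

definition path :: "nat \<Rightarrow> (nat \<Rightarrow> nat) \<Rightarrow> nat \<Rightarrow> (nat \<Rightarrow> int) \<Rightarrow> bool"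
  where "path n w d T \<longleftrightarrow> T 0 = 0 \<and> 2 * T n = int (d * weight n w) \<and>
    (\<forall>m<n. T m \<le> T (Suc m) \<and> T (Suc m) \<le> T m + int (d * w (Suc m)) \<and>
      int (d * weight (Suc m) w) \<le> T m + T (Suc m))"

lemma pathD:
  assumes "path n w d T" "m < n"
  shows "T m \<le> T (Suc m)" "T (Suc m) \<le> T m + int d * int (w (Suc m))"
    "int d * int (weight (Suc m) w) \<le> T m + T (Suc m)"
  using assms by (simp_all add: path_def)

lemma path_add: "path n w d T \<Longrightarrow> path n w e T' \<Longrightarrow> path n w (d + e) (\<lambda>m. T m + T' m)"
  by (fastforce simp: path_def distrib_left distrib_right)

lemma even_weight:
  assumes "\<forall>i\<in>{1..n}. even (w i)" "m \<le> n"
  shows "even (weight m w)"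
  unfolding weight_def using assms by (intro dvd_sum) auto

text \<open>Every condition on a path bounds one value by another, by a translate of it or by a
  reflection of it. \<open>part d j\<close> is monotone and compatible with those translations and
  reflections because the weights and their partial sums are even.\<close>

lemma path_part:
  assumes "path n w d T" "\<forall>i\<in>{1..n}. even (w i)" and j: "j < d"
  shows "path n w 1 (\<lambda>m. part d j (T m))"
proof -
  have d: "0 < d" using j by simp
  have zero: "part d j 0 = 0" using part_eq[OF j, of 0] j by simp
  have even: "\<exists>c. int x = 2 * c" if "even x" for x :: nat
    using that by (metis dvd_def even_of_nat)
  obtain e where e: "int (weight n w) = 2 * e" using even even_weight[of n w n] assms by auto
  have Tn: "T n = int d * e" using assms(1) e by (simp add: path_def)
  \<comment> \<open>The end value is fixed by a reflection, so all its parts equal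
    \<open>e\<close>.\<close>
  have "2 * e * int d - T n = T n" by (simp add: Tn algebra_simps)
  then have "2 * part d j (T n) = 2 * e" using part_reflect[OF d, of j e "T n"] by presburger
  moreover have "part d j (T (Suc m)) \<le> part d j (T m) + int (w (Suc m))"
    and "int (weight (Suc m) w) \<le> part d j (T m) + part d j (T (Suc m))" if m: "m < n" for m
  proof -
    obtain c where c: "int (w (Suc m)) = 2 * c" using even assms(2) m by fastforce
    have "T (Suc m) \<le> T m + int d * (2 * c)" using pathD(2)[OF assms(1) m] c by simp
    from part_mono[OF this, of d j] show "part d j (T (Suc m)) \<le> part d j (T m) + int (w (Suc m))"
      using part_shift[OF d] c by simp
    obtain f where f: "int (weight (Suc m) w) = 2 * f" using even even_weight[OF assms(2), of "Suc m"] m by auto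
    have "2 * f * int d - T m \<le> T (Suc m)"
      using pathD(3)[OF assms(1) m] by (simp add: f mult_ac)
    from part_mono[OF this, of d j] show "int (weight (Suc m) w) \<le> part d j (T m) + part d j (T (Suc m))"
      using part_reflect[OF d] f by simp
  qed
  ultimately show ?thesis
    using assms(1) e zero part_mono[of _ _ d j] by (simp add: path_def)
qed

section \<open>The correspondence between tableaux and paths\<close>

definition top_count :: "tableau \<Rightarrow> nat \<Rightarrow> int"
  where "top_count \<tau> m = int (length (filter (\<lambda>x. x \<le> m) (fst \<tau>)))"

lemma length_filter_le_Suc:
  "length (filter (\<lambda>x. x \<le> Suc m) xs) = length (filter (\<lambda>x. x \<le> m) xs) + count_list xs (Suc m)"
  by (induction xs) auto

text \<open>Translates comparisons of entries in a column into comparisons of the counts that make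
  up a path.\<close>

lemma sorted_nth_le_iff:
  fixes xs :: "nat list"
  assumes "sorted xs" "l < length xs"
  shows "xs ! l \<le> m \<longleftrightarrow> l < length (filter (\<lambda>x. x \<le> m) xs)"
  using assms
proof (induction xs arbitrary: l)
  case (Cons x xs)
  show ?case
  proof (cases "x \<le> m")
    case True
    then show ?thesis using Cons by (cases l) auto
  next
    case False
    then have "\<forall>y\<in>set (x # xs). \<not> y \<le> m" using Cons.prems by auto
    then have "filter (\<lambda>x. x \<le> m) (x # xs) = []" "\<not> (x # xs) ! l \<le> m"
      using Cons.prems(2) nth_mem[of l "x # xs"] by (auto simp: filter_empty_conv simp del: nth_Cons)
    then show ?thesis by simp
  qed
qed simp

lemma tableaux_length_filter:
  assumes "(is, js) \<in> tableaux n w" "m \<le> n"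
  shows "length (filter (\<lambda>x. x \<le> m) is) + length (filter (\<lambda>x. x \<le> m) js) = weight m w"
  using assms(2)
proof (induction m)
  case 0
  have "\<forall>x\<in>set is \<union> set js. \<not> x \<le> 0" using assms(1) by (auto simp: tableaux_def semistandard_def)
  then have "filter (\<lambda>x. x \<le> 0) is = []" "filter (\<lambda>x. x \<le> 0) js = []" by (auto simp: filter_empty_conv)
  then show ?case by (simp add: weight_def)
next
  case (Suc m)
  then have "count_list is (Suc m) + count_list js (Suc m) = w (Suc m)"
    using assms(1) by (auto simp: tableaux_def tableau_content_def)
  then show ?case using Suc by (simp add: length_filter_le_Suc weight_def)
qed

lemma top_count_path:
  assumes w: "\<forall>i\<in>{1..n}. even (w i)" and \<tau>: "\<tau> \<in> tableaux n w"
  shows "path n w 1 (top_count \<tau>)"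
proof -
  obtain "is" js where ij: "\<tau> = (is, js)" by (cases \<tau>)
  note len = tableaux_length_filter[OF \<tau>[unfolded ij]]
  have ss: "length is = weight n w div 2" "length js = weight n w div 2" "set is \<subseteq> {1..n}"
    "sorted is" "sorted js" "\<And>l. l < weight n w div 2 \<Longrightarrow> is ! l < js ! l"
    using \<tau> by (auto simp: ij tableaux_def semistandard_def)
  have "filter (\<lambda>x. x \<le> n) is = is" "filter (\<lambda>x. x \<le> 0) is = []"
    using ss(3) by (auto simp: filter_id_conv filter_empty_conv)
  then have "top_count \<tau> 0 = 0" "2 * top_count \<tau> n = int (weight n w)"
    using ss(1) even_weight[OF w, of n] by (auto simp: top_count_def ij)
  moreover have "top_count \<tau> m \<le> top_count \<tau> (Suc m)"
      "top_count \<tau> (Suc m) \<le> top_count \<tau> m + int (w (Suc m))"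
      "int (weight (Suc m) w) \<le> top_count \<tau> m + top_count \<tau> (Suc m)" if m: "m < n" for m
  proof -
    have "count_list is (Suc m) + count_list js (Suc m) = w (Suc m)"
      using \<tau> m by (auto simp: ij tableaux_def tableau_content_def)
    then show "top_count \<tau> m \<le> top_count \<tau> (Suc m)"
        "top_count \<tau> (Suc m) \<le> top_count \<tau> m + int (w (Suc m))"
      by (simp_all add: top_count_def ij length_filter_le_Suc)
    \<comment> \<open>A bottom entry at most \<open>Suc m\<close> has a top entry at most
      \<open>m\<close> above it, by strictness of columns. Applied to the last such column, of index
      \<open>q - 1\<close>, this bounds \<open>q\<close> by the count of the top row at
      \<open>m\<close>.\<close>
    define q where "q = length (filter (\<lambda>x. x \<le> Suc m) js)"
    have "q \<le> length (filter (\<lambda>x. x \<le> m) is)"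
    proof (cases q)
      case (Suc l)
      then have l: "l < length js" using length_filter_le[of "\<lambda>x. x \<le> Suc m" js] by (simp add: q_def)
      then have "js ! l \<le> Suc m" using sorted_nth_le_iff[OF ss(5) l, of "Suc m"] Suc q_def by simp
      then have "is ! l \<le> m" using ss(6)[of l] l ss(2) by simp
      then show ?thesis using sorted_nth_le_iff[OF ss(4), of l m] l ss Suc by simp
    qed simp
    then show "int (weight (Suc m) w) \<le> top_count \<tau> m + top_count \<tau> (Suc m)"
      using len[of "Suc m"] m by (simp add: top_count_def ij q_def)
  qed
  ultimately show ?thesis by (simp add: path_def)
qed

definition row :: "(nat \<Rightarrow> nat) \<Rightarrow> nat \<Rightarrow> nat list"
  where "row f n = concat (map (\<lambda>i. replicate (f i) i) [1..<Suc n])"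

lemma count_list_replicate_eq: "count_list (replicate k x) y = (if x = y then k else 0)"
  by (induction k) auto

lemma row_simps: "row f 0 = []" "row f (Suc n) = row f n @ replicate (f (Suc n)) (Suc n)"
  by (simp_all add: row_def)

lemma set_row: "set (row f n) \<subseteq> {1..n}"
  by (induction n) (auto simp: row_simps)

lemma sorted_row: "sorted (row f n)"
  using set_row by (induction n) (fastforce simp: row_simps sorted_append)+

lemma count_row: "count_list (row f n) i = (if i \<in> {1..n} then f i else 0)"
  by (induction n) (auto simp: row_simps count_list_replicate_eq le_Suc_eq)

lemma length_filter_row: "m \<le> n \<Longrightarrow> length (filter (\<lambda>x. x \<le> m) (row f n)) = (\<Sum>i\<in>{1..m}. f i)"
proof (induction m)
  case 0
  have "\<forall>x\<in>set (row f n). \<not> x \<le> 0" using set_row[of f n] by auto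
  then have "filter (\<lambda>x. x \<le> 0) (row f n) = []" by (auto simp: filter_empty_conv)
  then show ?case by simp
qed (simp add: length_filter_le_Suc count_row)

text \<open>The increments of \<open>T\<close> prescribe the top row and the rest of the content the
  bottom row. The inequality for \<open>T m + T (Suc m)\<close> says that there are at most
  \<open>T m\<close> bottom entries up to \<open>Suc m\<close>, which makes the columns
  strict.\<close>

lemma path_tableau:
  assumes T: "path n w 1 T"
  obtains \<tau> where "\<tau> \<in> tableaux n w" "\<And>m. m \<le> n \<Longrightarrow> top_count \<tau> m = T m"
proof -
  define f g where "f i = nat (T i - T (i - 1))" and "g i = w i - f i" for i
  have fw: "f i \<le> w i" if i: "i \<in> {1..n}" for i
  proof -
    obtain m where m: "i = Suc m" "m < n" using i by (cases i) auto
    then show ?thesis using pathD(2)[OF T m(2)] by (simp add: f_def)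
  qed
  have sf: "int (\<Sum>i\<in>{1..m}. f i) = T m" if "m \<le> n" for m
    using that
  proof (induction m)
    case (Suc m)
    then have "T m \<le> T (Suc m)" using T by (simp add: path_def)
    then show ?case using Suc by (simp add: f_def)
  qed (use T in \<open>simp add: path_def\<close>)
  have sg: "int (\<Sum>i\<in>{1..m}. g i) = int (weight m w) - T m" if "m \<le> n" for m
  proof -
    have "(\<Sum>i\<in>{1..m}. g i) + (\<Sum>i\<in>{1..m}. f i) = weight m w"
      unfolding weight_def sum.distrib[symmetric] using fw that by (intro sum.cong) (auto simp: g_def)
    then show ?thesis using sf[OF that] by linarith
  qed
  let ?is = "row f n" and ?js = "row g n"
  have filter_n: "filter (\<lambda>x. x \<le> n) (row h n) = row h n" for h
    using set_row[of h n] by (auto simp: filter_id_conv)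
  have len: "length (row h n) = (\<Sum>i\<in>{1..n}. h i)" for h
    using length_filter_row[of n n h] filter_n[of h] by simp
  have "2 * T n = int (weight n w)" using T by (simp add: path_def)
  then have length: "length ?is = weight n w div 2" "length ?js = weight n w div 2"
    using sf[of n] sg[of n] len[of f] len[of g] by linarith+
  have "?is ! l < ?js ! l" if l: "l < weight n w div 2" for l
  proof -
    have "?js ! l \<in> {1..n}" using l length set_row[of g n] nth_mem[of l ?js] by (metis subsetD)
    then obtain m where m: "?js ! l = Suc m" "m < n" by (cases "?js ! l") auto
    have "l < length (filter (\<lambda>x. x \<le> Suc m) ?js)"
      using sorted_nth_le_iff[OF sorted_row, of l g n "Suc m"] l length m by simp
    moreover have "length (filter (\<lambda>x. x \<le> Suc m) ?js) = (\<Sum>i\<in>{1..Suc m}. g i)"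
      by (rule length_filter_row) (use m in simp)
    ultimately have "int l < int (\<Sum>i\<in>{1..Suc m}. g i)" by (simp only: of_nat_less_iff)
    also have "\<dots> = int (weight (Suc m) w) - T (Suc m)" using sg[of "Suc m"] m by simp
    also have "\<dots> \<le> T m" using pathD(3)[OF T m(2)] by simp
    also have "\<dots> = int (length (filter (\<lambda>x. x \<le> m) ?is))"
      using length_filter_row[of m n f] sf[of m] m by simp
    finally have "?is ! l \<le> m"
      using sorted_nth_le_iff[OF sorted_row, of l f n m] l length by simp
    then show ?thesis using m by simp
  qed
  then have "(?is, ?js) \<in> tableaux n w"
    using length sorted_row set_row[of f n] set_row[of g n] fw
    by (auto simp: tableaux_def semistandard_def tableau_content_def count_row g_def)
  moreover have "top_count (?is, ?js) m = T m" if "m \<le> n" for m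
    using length_filter_row[OF that, of f] sf[OF that] by (simp add: top_count_def)
  ultimately show ?thesis by (rule that)
qed

lemma tableaux_counts:
  assumes "(is, js) \<in> tableaux n w" "i \<in> {1..n}"
  shows "int (count_list is i) = top_count (is, js) i - top_count (is, js) (i - 1)"
    and "int (count_list js i) = int (w i) - (top_count (is, js) i - top_count (is, js) (i - 1))"
proof -
  obtain m where m: "i = Suc m" using assms(2) by (cases i) auto
  show *: "int (count_list is i) = top_count (is, js) i - top_count (is, js) (i - 1)"
    by (simp add: m top_count_def length_filter_le_Suc)
  have "count_list is i + count_list js i = w i"
    using assms by (auto simp: tableaux_def tableau_content_def)
  then show "int (count_list js i) = int (w i) - (top_count (is, js) i - top_count (is, js) (i - 1))"
    using * by linarith
qed

lemma sorted_eqI_count_list: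
  fixes xs ys :: "nat list"
  assumes "sorted xs" "sorted ys" "\<And>i. count_list xs i = count_list ys i"
  shows "xs = ys"
proof -
  have "mset xs = mset ys" using assms(3) by (intro multiset_eqI) (simp add: count_mset)
  then show ?thesis using assms(1,2) by (metis properties_for_sort)
qed

lemma top_count_inj:
  assumes "\<tau> \<in> tableaux n w" "\<tau>' \<in> tableaux n w" "\<And>m. m \<le> n \<Longrightarrow> top_count \<tau> m = top_count \<tau>' m"
  shows "\<tau> = \<tau>'"
proof -
  obtain "is" js is' js' where \<tau>: "\<tau> = (is, js)" "\<tau>' = (is', js')" by (cases \<tau>, cases \<tau>')
  have eq: "count_list is i = count_list is' i \<and> count_list js i = count_list js' i" for i
  proof (cases "i \<in> {1..n}")
    case True
    then have "top_count \<tau> i = top_count \<tau>' i" "top_count \<tau> (i - 1) = top_count \<tau>' (i - 1)"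
      using assms(3) by auto
    then show ?thesis
      using tableaux_counts[OF assms(1)[unfolded \<tau>] True] tableaux_counts[OF assms(2)[unfolded \<tau>] True]
      by (simp add: \<tau>)
  next
    case False
    then have "i \<notin> set is \<union> set js \<union> set is' \<union> set js'"
      using assms(1,2) by (auto simp: \<tau> tableaux_def semistandard_def)
    then show ?thesis by (simp add: count_list_0_iff)
  qed
  have "sorted is" "sorted js" "sorted is'" "sorted js'"
    using assms(1,2) by (auto simp: \<tau> tableaux_def semistandard_def)
  then show ?thesis using eq \<tau> by (auto intro!: sorted_eqI_count_list)
qed

lemma finite_tableaux: "finite (tableaux n w)"
proof -
  let ?k = "weight n w div 2"
  let ?X = "{xs. set xs \<subseteq> {1..n} \<and> length xs = ?k}"
  have "tableaux n w \<subseteq> ?X \<times> ?X" by (auto simp: tableaux_def semistandard_def)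
  then show ?thesis by (rule finite_subset) (simp add: finite_lists_length_eq)
qed


section \<open>Leading monomials of invariants\<close>

lemma sum_coords: "(\<Sum>v\<in>coords n. F v) = (\<Sum>i\<in>{1..n}. F (Xc i)) + (\<Sum>i\<in>{1..n}. F (Yc i))"
  unfolding coords_def by (subst sum.union_disjoint) (auto simp: sum.reindex inj_on_def)

lemma finite_coords: "finite (coords n)"
  by (simp add: coords_def)

lemma coords_iff [simp]: "Xc i \<in> coords n \<longleftrightarrow> i \<in> {1..n}" "Yc i \<in> coords n \<longleftrightarrow> i \<in> {1..n}"
  by (auto simp: coords_def)

text \<open>Specialises the generic matrix: an invariant is fixed by every determinant-one matrix
  over any monoid algebra, evaluated at any point. Enough matrices are thus available even over a
  finite field.\<close>

lemma SL2_invariantD: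
  fixes f :: "(coord, 'k::comm_ring_1) mpoly" and h :: "coord \<Rightarrow> ('e::comm_monoid_add \<Rightarrow>\<^sub>0 'k)"
  assumes "SL2_invariant f" and det: "a * d - b * c = 1"
  shows "evaluate (\<lambda>v. case v of Xc i \<Rightarrow> a * h (Xc i) + b * h (Yc i)
    | Yc i \<Rightarrow> c * h (Xc i) + d * h (Yc i)) f = evaluate h f"
proof -
  define \<Phi> where "\<Phi> v = (case v of Inl u \<Rightarrow> h u
    | Inr t \<Rightarrow> (case t of G11 \<Rightarrow> a | G12 \<Rightarrow> b | G21 \<Rightarrow> c | G22 \<Rightarrow> d))" for v
  obtain q where q: "poly_subst generic_act f - poly_subst (\<lambda>v. Var (Inl v)) f = (generic_det - 1) * q"
    using assms(1) by (auto simp: SL2_invariant_def dvd_def)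
  have "evaluate \<Phi> (generic_det - 1) = 0"
    using det by (simp add: generic_det_def evaluate_diff evaluate_mult \<Phi>_def)
  then have "evaluate \<Phi> (poly_subst generic_act f - poly_subst (\<lambda>v. Var (Inl v)) f) = 0"
    by (simp add: q evaluate_mult)
  then have "evaluate (\<lambda>v. evaluate \<Phi> (generic_act v)) f = evaluate (\<lambda>v. \<Phi> (Inl v)) f"
    by (simp add: poly_subst_eq_evaluate evaluate_diff evaluate_evaluate)
  moreover have "(\<lambda>v. evaluate \<Phi> (generic_act v)) = (\<lambda>v. case v of Xc i \<Rightarrow> a * h (Xc i) + b * h (Yc i)
    | Yc i \<Rightarrow> c * h (Xc i) + d * h (Yc i))"
    by (rule ext) (simp add: evaluate_add evaluate_mult \<Phi>_def split: coord.split)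
  moreover have "(\<lambda>v. \<Phi> (Inl v)) = h" by (simp add: \<Phi>_def)
  ultimately show ?thesis by simp
qed

lemma single_power: "single e (1 :: 'k::comm_ring_1) ^ k = single (\<Sum>i<k. e) 1"
  by (induction k) (simp_all add: mult_single add.commute)

lemma prod_single: "(\<Prod>i\<in>I. single (e i) (1 :: 'k::comm_ring_1)) = single (\<Sum>i\<in>I. e i) 1"
  by (induction I rule: infinite_finite_induct) (simp_all add: mult_single)

lemma mon_eval_single_one:
  "mon_eval (\<lambda>v. single (e v) (1 :: 'k::comm_ring_1)) m = single (\<Sum>v\<in>keys m. \<Sum>i<lookup m v. e v) 1"
  by (simp add: mon_eval_def single_power prod_single)

lemma sum_keys_single: "(\<Sum>v\<in>keys m. \<Sum>i<lookup m v. single v 1) = (m :: 'v monomial)"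
  by (rule poly_mapping_eqI)
    (simp add: lookup_sum lookup_single when_def in_keys_iff if_distrib cong: if_cong)

text \<open>Invariance under the torus element diag(t, 1/t) forces each monomial to have weight 0 in
  t.\<close>

lemma torus_weight:
  fixes f :: "(coord, 'k::comm_ring_1) mpoly"
  assumes f: "f \<in> polys (coords n)" and inv: "SL2_invariant f" and m: "m \<in> keys f"
  shows "(\<Sum>i\<in>{1..n}. lookup m (Xc i)) = (\<Sum>i\<in>{1..n}. lookup m (Yc i))"
proof -
  define s where "s v = (case v of Xc i \<Rightarrow> 1 | Yc i \<Rightarrow> (- 1 :: int))" for v
  define wt where "wt m = (\<Sum>v\<in>keys m. int (lookup m v) * s v)" for m
  define h where "h v = single (single v (1::nat), 0 :: int) (1 :: 'k)" for v :: coord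
  define h' where "h' v = single (single v (1::nat), s v) (1 :: 'k)" for v
  \<comment> \<open>The second component of an exponent is the power of a Laurent variable t;
    \<open>?a\<close> is t and \<open>?d\<close> is its inverse.\<close>
  let ?a = "single (0 :: coord monomial, 1 :: int) (1 :: 'k)"
    and ?d = "single (0 :: coord monomial, - 1 :: int) (1 :: 'k)"
  have "?a * ?d - 0 * 0 = 1" by (simp add: mult_single flip: zero_prod_def)
  note D = SL2_invariantD[OF inv this, of h]
  have "(\<lambda>v. case v of Xc i \<Rightarrow> ?a * h (Xc i) + 0 * h (Yc i) | Yc i \<Rightarrow> 0 * h (Xc i) + ?d * h (Yc i)) = h'"
    by (rule ext) (simp add: h_def h'_def s_def mult_single split: coord.split)
  with D have eq: "evaluate h' f = evaluate h f" by simp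
  have pair: "(\<Sum>v\<in>keys m. \<Sum>i<lookup m v. (single v (1::nat), t v)) = (m, \<Sum>v\<in>keys m. int (lookup m v) * t v)"
    for m :: "coord monomial" and t :: "coord \<Rightarrow> int"
  proof (rule prod_eqI)
    show "fst (\<Sum>v\<in>keys m. \<Sum>i<lookup m v. (single v (1::nat), t v)) = fst (m, \<Sum>v\<in>keys m. int (lookup m v) * t v)"
      using sum_keys_single[of m] by (simp only: fst_sum fst_conv)
    show "snd (\<Sum>v\<in>keys m. \<Sum>i<lookup m v. (single v (1::nat), t v)) = snd (m, \<Sum>v\<in>keys m. int (lookup m v) * t v)"
      unfolding snd_sum snd_conv by simp
  qed
  have h: "mon_eval h m = single (m, 0) 1" for m
    unfolding h_def mon_eval_single_one pair[where t = "\<lambda>_. 0"] by simp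
  have h': "mon_eval h' m = single (m, wt m) 1" for m
    unfolding h'_def mon_eval_single_one pair wt_def by simp
  have "lookup (evaluate h' f) (m, wt m) = (\<Sum>m'\<in>keys f. if m' = m then lookup f m else 0)"
    unfolding lookup_evaluate h' by (intro sum.cong) (auto simp: lookup_single when_def)
  moreover have "lookup (evaluate h f) (m, wt m) =
      (\<Sum>m'\<in>keys f. if m' = m then if wt m = 0 then lookup f m else 0 else 0)"
    unfolding lookup_evaluate h by (intro sum.cong) (auto simp: lookup_single when_def)
  ultimately have "wt m = 0" using m eq by (simp add: in_keys_iff split: if_splits)
  moreover have "wt m = (\<Sum>v\<in>coords n. int (lookup m v) * s v)"
    unfolding wt_def using f m
    by (intro sum.mono_neutral_left) (auto simp: finite_coords in_keys_iff polys_def monomials_def)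
  ultimately have "int (\<Sum>i\<in>{1..n}. lookup m (Xc i)) = int (\<Sum>i\<in>{1..n}. lookup m (Yc i))"
    by (simp add: sum_coords s_def sum_negf)
  then show ?thesis by (simp only: of_nat_eq_iff)
qed

text \<open>Within one multidegree the exponents of the y-variables are determined by those of the
  x-variables, so they are left out of the comparison.\<close>

definition xless :: "nat \<Rightarrow> coord monomial \<Rightarrow> coord monomial \<Rightarrow> bool"
  where "xless n = key_less (\<lambda>j m. int (lookup m (Xc (Suc j)))) n"

interpretation xless: additive_order "xless n" for n
  unfolding xless_def by (rule key_less_additive_order) (simp add: lookup_add)

lemma xlessI:
  assumes "i \<in> {1..n}" "lookup a (Xc i) < lookup b (Xc i)"
    "\<And>j. j \<in> {1..<i} \<Longrightarrow> lookup a (Xc j) = lookup b (Xc j)"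
  shows "xless n a b"
  unfolding xless_def key_less_def using assms
  by (intro exI[of _ "i - 1"]) (auto simp: Suc_diff_le)

text \<open>At the first index before \<open>p\<close> where \<open>m\<close> exceeded
  \<open>l\<close>, the monomial \<open>m\<close> would be larger. So they agree before
  \<open>p\<close>, and the same argument applies at \<open>p\<close>.\<close>

lemma xless_maximalD:
  assumes max: "\<not> xless n l m" and "p \<le> Suc n"
    and le: "\<And>i. i \<in> {1..<p} \<Longrightarrow> lookup l (Xc i) \<le> lookup m (Xc i)"
  shows "i \<in> {1..<p} \<Longrightarrow> lookup m (Xc i) = lookup l (Xc i)"
    and "p \<in> {1..n} \<Longrightarrow> lookup m (Xc p) \<le> lookup l (Xc p)"
proof -
  have eq: "i \<in> {1..<p} \<Longrightarrow> lookup m (Xc i) = lookup l (Xc i)" for i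
  proof (induction i rule: less_induct)
    case (less i)
    then have "\<not> lookup l (Xc i) < lookup m (Xc i)"
      using xlessI[of i n l m] max \<open>p \<le> Suc n\<close> by fastforce
    then show ?case using le[OF less.prems] by simp
  qed
  then show "i \<in> {1..<p} \<Longrightarrow> lookup m (Xc i) = lookup l (Xc i)" .
  show "lookup m (Xc p) \<le> lookup l (Xc p)" if "p \<in> {1..n}"
    using xlessI[OF that, of l m] max eq by fastforce
qed

lemma keys_Var: "keys (Var v :: ('v, 'k::comm_ring_1) mpoly) = {single v 1}"
  by (simp add: Var_def)

lemma keys_one_add_Var: "keys (1 + Var v :: ('v, 'k::comm_ring_1) mpoly) \<subseteq> {0, single v 1}"
  using Poly_Mapping.keys_add[of 1 "Var v"] keys_Var[of v] by auto

lemma keys_Var_diff_one: "keys (Var v - 1 :: ('v, 'k::comm_ring_1) mpoly) \<subseteq> {0, single v 1}"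
  using keys_diff[of "Var v" 1] keys_Var[of v] by auto

text \<open>The unipotent substitution \<open>x \<mapsto> x - y\<close> is applied at the points \<open>(X\<^sub>i, 1)\<close> for \<open>i < p\<close>,
  \<open>(1, 1)\<close> for \<open>i = p\<close> and \<open>(1, 1 + Y\<^sub>i)\<close> for \<open>i > p\<close>; the coefficients of the monomial \<open>e\<close> below
  are then compared.\<close>

lemma invariant_ballot:
  fixes f :: "(coord, 'k::comm_ring_1) mpoly"
  assumes f: "f \<in> multigraded_piece n r" and inv: "SL2_invariant f"
    and l: "l \<in> keys f" and max: "\<And>m. m \<in> keys f \<Longrightarrow> \<not> xless n l m" and p: "p \<in> {1..n}"
  shows "(\<Sum>i\<in>{1..p}. lookup l (Yc i)) \<le> (\<Sum>i\<in>{1..<p}. lookup l (Xc i))"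
proof -
  define h :: "coord \<Rightarrow> (coord, 'k) mpoly" where "h v = (case v of
      Xc i \<Rightarrow> if i < p then Var (Xc i) else 1 | Yc i \<Rightarrow> if i \<le> p then 1 else 1 + Var (Yc i))" for v
  define h' where "h' v = (case v of Xc i \<Rightarrow> 1 * h (Xc i) + (- 1) * h (Yc i)
      | Yc i \<Rightarrow> 0 * h (Xc i) + 1 * h (Yc i))" for v
  have eval: "evaluate h' f = evaluate h f"
    unfolding h'_def by (rule SL2_invariantD[OF inv]) simp
  \<comment> \<open>\<open>E v\<close> is the top exponent of \<open>h v\<close>, so
    \<open>e\<close> is the top exponent of the image of \<open>l\<close>: it records the
    x-exponents of \<open>l\<close> before \<open>p\<close> and its y-exponents after
    \<open>p\<close>.\<close>
  define E where "E v = (case v of Xc i \<Rightarrow> if i < p then single (Xc i) 1 else 0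
      | Yc i \<Rightarrow> if i \<le> p then 0 else single (Yc i) (1::nat))" for v
  define e where "e = (\<Sum>v\<in>keys l. \<Sum>i<lookup l v. E v)"
  have keys_f: "keys m \<subseteq> coords n" if "m \<in> keys f" for m
    using f that by (auto simp: multigraded_piece_def polys_def monomials_def)
  have r: "lookup m (Xc i) + lookup m (Yc i) = r i" if "m \<in> keys f" "i \<in> {1..n}" for m i
    using f that by (auto simp: multigraded_piece_def)
  have lookup_e: "lookup e u = lookup l u * lookup (E u) u" for u
  proof -
    have "lookup e u = (\<Sum>v\<in>keys l. lookup l v * lookup (E v) u)"
      by (simp add: e_def lookup_sum)
    also have "\<dots> = (\<Sum>v\<in>keys l. if v = u then lookup l u * lookup (E u) u else 0)"
      by (intro sum.cong) (auto simp: E_def lookup_single when_def split: coord.splits if_splits)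
    also have "\<dots> = lookup l u * lookup (E u) u" by (simp add: in_keys_iff)
    finally show ?thesis .
  qed
  have e_X: "lookup e (Xc i) = (if i < p then lookup l (Xc i) else 0)"
    and e_Y: "lookup e (Yc i) = (if i \<le> p then 0 else lookup l (Yc i))" for i
    by (simp_all add: lookup_e E_def)
  have h'_X: "h' (Xc i) = (if i < p then Var (Xc i) - 1 else if i = p then 0 else - Var (Yc i))"
    and h'_Y: "h' (Yc i) = h (Yc i)" for i
    by (auto simp: h'_def h_def)
  have keys_h: "u = 0 \<or> u = single v 1" if u: "u \<in> keys (h v)" for u v
  proof (cases v)
    case (Xc i)
    then show ?thesis using u by (auto simp: h_def keys_Var split: if_splits)
  next
    case (Yc i)
    then show ?thesis using u keys_one_add_Var[of "Yc i"] by (auto simp: h_def split: if_splits)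
  qed
  have keys_h': "u = 0 \<or> u = single v 1 \<or> (\<exists>i>p. u = single (Yc i) 1)" if u: "u \<in> keys (h' v)" for u v
  proof (cases v)
    case (Xc i)
    then show ?thesis using u keys_Var_diff_one[of "Xc i"]
      by (cases i p rule: linorder_cases) (auto simp: h'_X keys_Var)
  next
    case (Yc i)
    then show ?thesis using u keys_h[of u v] by (auto simp: h'_Y)
  qed
  have X_le: "lookup l (Xc i) \<le> lookup m (Xc i)"
    if m: "m \<in> keys f" and e: "e \<in> keys (mon_eval h m) \<or> e \<in> keys (mon_eval h' m)"
      and i: "i \<in> {1..<p}" for m i
  proof -
    let ?\<mu> = "\<lambda>u. int (lookup u (Xc i))" and ?B = "\<lambda>v. if v = Xc i then 1 else 0 :: int"
    have B: "?\<mu> u \<le> ?B v" if "u \<in> keys (h v) \<or> u \<in> keys (h' v)" for u v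
      using keys_h[of u v] keys_h'[of u v] that by (auto simp: lookup_single when_def)
    from e have "?\<mu> e \<le> (\<Sum>v\<in>coords n. int (lookup m v) * ?B v)"
    proof
      assume "e \<in> keys (mon_eval h m)"
      then show ?thesis
        by (rule keys_mon_eval_bounded[where \<mu> = ?\<mu>, rotated 2])
          (simp_all only: B finite_coords keys_f[OF m] lookup_add of_nat_add simp_thms)
    next
      assume "e \<in> keys (mon_eval h' m)"
      then show ?thesis
        by (rule keys_mon_eval_bounded[where \<mu> = ?\<mu>, rotated 2])
          (simp_all only: B finite_coords keys_f[OF m] lookup_add of_nat_add simp_thms)
    qed
    also have "\<dots> = int (lookup m (Xc i))"
      using i p by (subst sum.mono_neutral_right[of _ "{Xc i}"]) (auto simp: finite_coords)
    finally show ?thesis using i by (simp add: e_X)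
  qed
  \<comment> \<open>A monomial \<open>m\<close> whose image under either substitution contains
    \<open>e\<close> has x-exponents before \<open>p\<close> at least those of \<open>l\<close>.
    Maximality of \<open>l\<close> turns this into equality.\<close>
  have X_eq: "lookup m (Xc i) = lookup l (Xc i)"
    if m: "m \<in> keys f" and e: "e \<in> keys (mon_eval h m) \<or> e \<in> keys (mon_eval h' m)"
      and i: "i \<in> {1..<p}" for m i
    using xless_maximalD[OF max[OF m], of p] X_le[OF m e] p i by auto
  have X_p: "lookup m (Xc p) \<le> lookup l (Xc p)"
    if m: "m \<in> keys f" and e: "e \<in> keys (mon_eval h m) \<or> e \<in> keys (mon_eval h' m)" for m
    using xless_maximalD(2)[OF max[OF m], of p] X_le[OF m e] p by auto
  define D where "D = (\<Sum>i\<in>{1..n}. lookup l (Xc i))"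
  have D: "(\<Sum>i\<in>{1..n}. lookup m (Xc i)) = D" "(\<Sum>i\<in>{1..n}. lookup m (Yc i)) = D"
    if m: "m \<in> keys f" for m
  proof -
    have "(\<Sum>i\<in>{1..n}. lookup m (Xc i)) = (\<Sum>i\<in>{1..n}. lookup m (Yc i))" if "m \<in> keys f" for m
      using f that by (intro torus_weight[OF _ inv]) (auto simp: multigraded_piece_def)
    moreover have "(\<Sum>i\<in>{1..n}. lookup m (Xc i)) + (\<Sum>i\<in>{1..n}. lookup m (Yc i)) = (\<Sum>i\<in>{1..n}. r i)"
      if "m \<in> keys f" for m
      unfolding sum.distrib[symmetric] using r[OF that] by (intro sum.cong) auto
    ultimately show "(\<Sum>i\<in>{1..n}. lookup m (Xc i)) = D" "(\<Sum>i\<in>{1..n}. lookup m (Yc i)) = D"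
      using m l unfolding D_def by (metis add_self_div_2)+
  qed
  have split: "(\<Sum>i\<in>{1..n}. F i) = (\<Sum>i\<in>{1..<p}. F i) + F p + (\<Sum>i\<in>{p<..n}. F i)" for F :: "nat \<Rightarrow> nat"
  proof -
    have "{1..n} = {1..<p} \<union> {p} \<union> {p<..n}" using p by auto
    then have "(\<Sum>i\<in>{1..n}. F i) = (\<Sum>i\<in>{1..<p} \<union> {p} \<union> {p<..n}. F i)" by simp
    also have "\<dots> = (\<Sum>i\<in>{1..<p} \<union> {p}. F i) + (\<Sum>i\<in>{p<..n}. F i)"
      by (rule sum.union_disjoint) auto
    also have "(\<Sum>i\<in>{1..<p} \<union> {p}. F i) = (\<Sum>i\<in>{1..<p}. F i) + F p"
      by (subst sum.union_disjoint) auto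
    finally show ?thesis .
  qed
  \<comment> \<open>If the image of \<open>m\<close> under \<open>h\<close> contains
    \<open>e\<close>, its y-exponents after \<open>p\<close> are at least those of \<open>l\<close>,
    and so is the one at \<open>p\<close>, since the x-exponent there is at most that of
    \<open>l\<close>. The common total \<open>D\<close> forces equality.\<close>
  have other: "lookup (mon_eval h m) e = 0" if m: "m \<in> keys f" and "m \<noteq> l" for m
  proof (rule ccontr)
    assume "lookup (mon_eval h m) e \<noteq> 0"
    then have e: "e \<in> keys (mon_eval h m)" by (simp add: in_keys_iff)
    have Y_le: "lookup l (Yc i) \<le> lookup m (Yc i)" if i: "i \<in> {p<..n}" for i
    proof -
      let ?\<mu> = "\<lambda>u. int (lookup u (Yc i))" and ?B = "\<lambda>v. if v = Yc i then 1 else 0 :: int"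
      have B: "?\<mu> u \<le> ?B v" if "u \<in> keys (h v)" for u v
        using keys_h[OF that] by (auto simp: lookup_single when_def)
      from e have "?\<mu> e \<le> (\<Sum>v\<in>coords n. int (lookup m v) * ?B v)"
        by (rule keys_mon_eval_bounded[where \<mu> = ?\<mu>, rotated 2])
          (simp_all only: B finite_coords keys_f[OF m] lookup_add of_nat_add)
      also have "\<dots> = int (lookup m (Yc i))"
        using i p by (subst sum.mono_neutral_right[of _ "{Yc i}"]) (auto simp: finite_coords)
      finally show ?thesis using i by (simp add: e_Y)
    qed
    have eq1: "lookup m (Xc i) = lookup l (Xc i)" "lookup m (Yc i) = lookup l (Yc i)"
      if i: "i \<in> {1..<p}" for i
      using X_eq[OF m _ i] e r[OF m, of i] r[OF l, of i] p i by auto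
    have Yp: "lookup l (Yc p) \<le> lookup m (Yc p)"
      using X_p[OF m] e r[OF m p] r[OF l p] by auto
    have "(\<Sum>i\<in>{1..<p}. lookup m (Yc i)) = (\<Sum>i\<in>{1..<p}. lookup l (Yc i))"
      using eq1 by (intro sum.cong) auto
    then have "lookup m (Yc p) + (\<Sum>i\<in>{p<..n}. lookup m (Yc i)) =
        lookup l (Yc p) + (\<Sum>i\<in>{p<..n}. lookup l (Yc i))"
      using D(2)[OF m] D(2)[OF l] split[of "\<lambda>i. lookup m (Yc i)"] split[of "\<lambda>i. lookup l (Yc i)"]
      by linarith
    moreover have "(\<Sum>i\<in>{p<..n}. lookup l (Yc i)) \<le> (\<Sum>i\<in>{p<..n}. lookup m (Yc i))"
      using Y_le by (intro sum_mono)
    ultimately have Yp_eq: "lookup m (Yc p) = lookup l (Yc p)"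
      and sum_eq: "(\<Sum>i\<in>{p<..n}. lookup l (Yc i)) = (\<Sum>i\<in>{p<..n}. lookup m (Yc i))"
      using Yp by linarith+
    have eq2: "lookup l (Yc i) = lookup m (Yc i)" if "i \<in> {p<..n}" for i
      using sum_mono_inv[OF sum_eq Y_le that] by simp
    have "lookup m (Yc i) = lookup l (Yc i)" if "i \<in> {1..n}" for i
      using eq1(2)[of i] Yp_eq eq2[of i] that by (cases i p rule: linorder_cases) auto
    then have "lookup m v = lookup l v" if "v \<in> coords n" for v
      using r[OF m] r[OF l] that by (auto simp: coords_def) (metis add_right_cancel atLeastAtMost_iff)
    then have "m = l"
      using keys_f[OF m] keys_f[OF l]
      by (intro poly_mapping_eqI) (metis in_keys_iff subsetD)
    then show False using \<open>m \<noteq> l\<close> by simp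
  qed
  have "lookup (mon_eval h l) e = 1"
  proof -
    interpret yless: additive_order "key_less (\<lambda>j u. int (lookup u (Yc (Suc j)))) n"
      by (rule key_less_additive_order) (simp add: lookup_add)
    have "yless.monic_at (h v) (E v)" if "v \<in> keys l" for v
    proof (cases "\<exists>i>p. v = Yc i")
      case True
      then obtain i where i: "v = Yc i" "i > p" by blast
      then have "i \<in> {1..n}" using keys_f[OF l] that by (auto simp: coords_def)
      then have "key_less (\<lambda>j u. int (lookup u (Yc (Suc j)))) n 0 (single (Yc i) 1)"
        unfolding key_less_def by (intro exI[of _ "i - 1"]) (auto simp: lookup_single when_def)
      moreover have "single (Yc i) (1::nat) \<noteq> 0" by (metis lookup_single_eq lookup_zero one_neq_zero)
      then have "lookup (1 + Var (Yc i) :: (coord, 'k) mpoly) (single (Yc i) 1) = 1"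
        by (simp add: lookup_add Var_def lookup_one)
      ultimately show ?thesis
        using i keys_h[of _ v] by (auto simp: yless.monic_at_def h_def E_def)
    next
      case False
      then show ?thesis
        using yless.monic_at_one yless.monic_at_single
        by (auto simp: h_def E_def Var_def split: coord.split)
    qed
    from yless.monic_at_mon_eval[of l h E, OF this] show ?thesis
      by (simp add: yless.monic_at_def e_def)
  qed
  then have "lookup (evaluate h f) e = (\<Sum>m\<in>keys f. if m = l then lookup f l else 0)"
    unfolding lookup_evaluate using other by (intro sum.cong) auto
  also have "\<dots> \<noteq> 0" using l by (simp add: in_keys_iff)
  \<comment> \<open>There is no cancellation at \<open>e\<close> before the unipotent substitution,
    so by invariance some monomial \<open>m\<close> must produce \<open>e\<close> after it.\<close>
  finally have "e \<in> keys (evaluate h' f)" by (simp add: eval in_keys_iff)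
  then obtain m where m: "m \<in> keys f" and e: "e \<in> keys (mon_eval h' m)"
    using keys_evaluate by blast
  \<comment> \<open>The point (1, 1) at index \<open>p\<close> was chosen so that x - y vanishes
    there; hence \<open>m\<close> cannot involve x_p.\<close>
  have "h' (Xc p) = 0" by (simp add: h'_def h_def)
  have "lookup m (Xc p) = 0"
  proof (rule ccontr)
    assume "lookup m (Xc p) \<noteq> 0"
    then have "\<exists>v\<in>keys m. h' v ^ lookup m v = 0"
      using \<open>h' (Xc p) = 0\<close> by (intro bexI[of _ "Xc p"]) (auto simp: in_keys_iff power_0_left)
    then have "mon_eval h' m = 0" unfolding mon_eval_def by (intro prod_zero finite_keys)
    then show False using e by simp
  qed
  \<comment> \<open>After \<open>p\<close> the coordinate x_i is sent to -Y_i, so each x-factor of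
    \<open>m\<close> there costs one of the Y-factors of \<open>e\<close>. The weight is negated to
    obtain this lower bound.\<close>
  moreover have "(\<Sum>i\<in>{p<..n}. lookup m (Xc i)) \<le> (\<Sum>i\<in>{p<..n}. lookup l (Yc i))"
  proof -
    let ?\<mu> = "\<lambda>u. - (\<Sum>i\<in>{p<..n}. int (lookup u (Yc i)))"
    let ?B = "\<lambda>v. case v of Xc i \<Rightarrow> if p < i then - 1 else 0 | Yc i \<Rightarrow> (0 :: int)"
    have B: "?\<mu> u \<le> ?B v" if v: "v \<in> coords n" and u: "u \<in> keys (h' v)" for u v
    proof (cases "\<exists>i>p. v = Xc i")
      case True
      then obtain i where i: "v = Xc i" "i > p" by blast
      have "h' v = - Var (Yc i)" using i by (simp add: h'_X)
      then have "u = single (Yc i) 1" using u by (simp add: keys_Var)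
      then have "(\<Sum>i\<in>{p<..n}. int (lookup u (Yc i))) = (\<Sum>j\<in>{p<..n}. if j = i then 1 else 0)"
        by (intro sum.cong) (auto simp: lookup_single when_def)
      then show ?thesis using v i by simp
    next
      case False
      then have "?B v = 0" by (auto split: coord.split)
      then show ?thesis by (simp add: sum_nonneg)
    qed
    from e have "?\<mu> e \<le> (\<Sum>v\<in>coords n. int (lookup m v) * ?B v)"
    proof (rule keys_mon_eval_bounded[where \<mu> = ?\<mu>, rotated 2])
      show "?\<mu> (a + b) = ?\<mu> a + ?\<mu> b" for a b by (simp add: lookup_add sum.distrib)
      show "?\<mu> u \<le> ?B v" if "v \<in> keys m" "u \<in> keys (h' v)" for u v
        using that keys_f[OF m] by (intro B) auto
    qed (rule finite_coords, rule keys_f[OF m])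
    also have "\<dots> = (\<Sum>i\<in>{1..n}. if p < i then - int (lookup m (Xc i)) else 0)"
      by (simp add: sum_coords) (intro sum.cong, auto)
    also have "\<dots> = - (\<Sum>i\<in>{p<..n}. int (lookup m (Xc i)))"
      using p by (subst sum.inter_filter[symmetric]) (auto simp: sum_negf intro!: sum.cong)
    finally have "(\<Sum>i\<in>{p<..n}. int (lookup m (Xc i))) \<le> (\<Sum>i\<in>{p<..n}. int (lookup e (Yc i)))" by simp
    also have "\<dots> = (\<Sum>i\<in>{p<..n}. int (lookup l (Yc i)))" by (intro sum.cong) (auto simp: e_Y)
    finally show ?thesis by (simp flip: of_nat_sum)
  qed
  moreover have "(\<Sum>i\<in>{1..<p}. lookup m (Xc i)) = (\<Sum>i\<in>{1..<p}. lookup l (Xc i))"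
    using X_eq[OF m] e by (intro sum.cong) auto
  moreover have "(\<Sum>i\<in>{1..p}. lookup l (Yc i)) = (\<Sum>i\<in>{1..<p}. lookup l (Yc i)) + lookup l (Yc p)"
    using p by (simp add: atLeastLessThanSuc_atLeastAtMost[symmetric])
  \<comment> \<open>The total x-degree \<open>D\<close> of \<open>m\<close> is at most the x-degree
    of \<open>l\<close> before \<open>p\<close> plus the y-degree of \<open>l\<close> after
    \<open>p\<close>; subtracting the latter from the total y-degree \<open>D\<close> of
    \<open>l\<close> leaves the claim.\<close>
  ultimately show ?thesis
    using D[OF m] D[OF l] split[of "\<lambda>i. lookup m (Xc i)"] split[of "\<lambda>i. lookup l (Yc i)"]
    by linarith
qed

text \<open>The ballot inequality becomes the remaining path inequality once the y-exponents are
  eliminated by means of the multidegree.\<close>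

lemma lead_path:
  fixes f :: "(coord, 'k::field) mpoly"
  assumes f: "f \<in> Rw_piece n w d" and l: "l \<in> keys f"
    and max: "\<And>m. m \<in> keys f \<Longrightarrow> \<not> xless n l m"
  shows "path n w d (\<lambda>m. int (\<Sum>i\<in>{1..m}. lookup l (Xc i)))"
proof -
  have fp: "f \<in> multigraded_piece n (\<lambda>i. d * w i)" and inv: "SL2_invariant f"
    using f by (auto simp: Rw_piece_def)
  have r: "lookup l (Xc i) + lookup l (Yc i) = d * w i" if "i \<in> {1..n}" for i
    using fp l that by (auto simp: multigraded_piece_def)
  have XY: "(\<Sum>i\<in>{1..m}. lookup l (Xc i)) + (\<Sum>i\<in>{1..m}. lookup l (Yc i)) = d * weight m w"
    if "m \<le> n" for m
    unfolding weight_def sum_distrib_left sum.distrib[symmetric] using r that by (intro sum.cong) auto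
  have "(\<Sum>i\<in>{1..n}. lookup l (Xc i)) = (\<Sum>i\<in>{1..n}. lookup l (Yc i))"
    using fp by (intro torus_weight[OF _ inv l]) (auto simp: multigraded_piece_def)
  then have "2 * (\<Sum>i\<in>{1..n}. lookup l (Xc i)) = d * weight n w" using XY[of n] by simp
  moreover have "d * weight (Suc m) w \<le> (\<Sum>i\<in>{1..m}. lookup l (Xc i)) + (\<Sum>i\<in>{1..Suc m}. lookup l (Xc i))"
    and "lookup l (Xc (Suc m)) \<le> d * w (Suc m)" if m: "m < n" for m
  proof -
    have "(\<Sum>i\<in>{1..Suc m}. lookup l (Yc i)) \<le> (\<Sum>i\<in>{1..<Suc m}. lookup l (Xc i))"
      using m by (intro invariant_ballot[OF fp inv l max]) auto
    then show "d * weight (Suc m) w \<le> (\<Sum>i\<in>{1..m}. lookup l (Xc i)) + (\<Sum>i\<in>{1..Suc m}. lookup l (Xc i))"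
      using XY[of "Suc m"] m by (simp add: atLeastLessThanSuc_atLeastAtMost)
    show "lookup l (Xc (Suc m)) \<le> d * w (Suc m)" using r[of "Suc m"] m by simp
  qed
  ultimately have *: "2 * (\<Sum>i\<in>{1..n}. lookup l (Xc i)) = d * weight n w"
    "\<And>m. m < n \<Longrightarrow> d * weight (Suc m) w \<le> (\<Sum>i\<in>{1..m}. lookup l (Xc i)) + (\<Sum>i\<in>{1..Suc m}. lookup l (Xc i))"
    "\<And>m. m < n \<Longrightarrow> (\<Sum>i\<in>{1..Suc m}. lookup l (Xc i)) \<le> (\<Sum>i\<in>{1..m}. lookup l (Xc i)) + d * w (Suc m)"
    by simp_all
  have "int 2 * int (\<Sum>i\<in>{1..n}. lookup l (Xc i)) = int (d * weight n w)"
    unfolding of_nat_mult[symmetric] *(1) ..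
  moreover have "int (\<Sum>i\<in>{1..m}. lookup l (Xc i)) \<le> int (\<Sum>i\<in>{1..Suc m}. lookup l (Xc i))"
      "int (\<Sum>i\<in>{1..Suc m}. lookup l (Xc i)) \<le> int (\<Sum>i\<in>{1..m}. lookup l (Xc i)) + int (d * w (Suc m))"
      "int (d * weight (Suc m) w) \<le> int (\<Sum>i\<in>{1..m}. lookup l (Xc i)) + int (\<Sum>i\<in>{1..Suc m}. lookup l (Xc i))"
    if "m < n" for m
    using *(2,3)[OF that] unfolding of_nat_add[symmetric] of_nat_le_iff by simp_all
  ultimately show ?thesis by (simp add: path_def del: of_nat_sum)
qed


section \<open>Sections attached to tableaux\<close>

lemma SL2_invariant_mult:
  assumes "SL2_invariant f" "SL2_invariant g"
  shows "SL2_invariant (f * g)"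
proof -
  let ?a = "\<lambda>f. poly_subst generic_act f" and ?b = "\<lambda>f. poly_subst (\<lambda>v. Var (Inl v)) f"
  have "?a (f * g) - ?b (f * g) = (?a f - ?b f) * ?a g + ?b f * (?a g - ?b g)"
    by (simp add: poly_subst_eq_evaluate evaluate_mult algebra_simps)
  moreover have "generic_det - 1 dvd (?a f - ?b f) * ?a g" "generic_det - 1 dvd ?b f * (?a g - ?b g)"
    using assms unfolding SL2_invariant_def by (auto intro: dvd_mult dvd_mult2)
  ultimately show ?thesis unfolding SL2_invariant_def by (metis dvd_add)
qed

lemma SL2_invariant_add: "SL2_invariant f \<Longrightarrow> SL2_invariant g \<Longrightarrow> SL2_invariant (f + g)"
  unfolding SL2_invariant_def poly_subst_eq_evaluate evaluate_add add_diff_add by (rule dvd_add)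

lemma Const_one: "Const 1 = 1"
  by (simp add: Const_def)

lemma SL2_invariant_Const: "SL2_invariant (Const c)"
  by (simp add: SL2_invariant_def poly_subst_eq_evaluate evaluate_Const)

lemma det_mult_2:
  fixes a b c d x y x' y' :: "'r::comm_ring_1"
  shows "(a * x + b * y) * (c * x' + d * y') - (a * x' + b * y') * (c * x + d * y) =
    (a * d - b * c) * (x * y' - x' * y)"
  by (simp add: algebra_simps)

lemma SL2_invariant_pluecker: "SL2_invariant (pluecker i j)"
proof -
  let ?b = "poly_subst (\<lambda>v. Var (Inl v)) (pluecker i j) :: (coord + entry, 'a) mpoly"
  have "poly_subst generic_act (pluecker i j) = generic_det * ?b"
    unfolding pluecker_def poly_subst_eq_evaluate evaluate_diff evaluate_mult evaluate_Var
      generic_act.simps generic_det_def by (rule det_mult_2)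
  then have *: "poly_subst generic_act (pluecker i j) - ?b = (generic_det - 1) * ?b"
    by (simp only: left_diff_distrib mult_1_left)
  show ?thesis unfolding SL2_invariant_def * by (rule dvd_triv_left)
qed

lemma multigraded_piece_add:
  "f \<in> multigraded_piece n r \<Longrightarrow> g \<in> multigraded_piece n r \<Longrightarrow> f + g \<in> multigraded_piece n r"
  using Poly_Mapping.keys_add[of f g] unfolding multigraded_piece_def polys_def by blast

lemma multigraded_piece_mult:
  assumes "f \<in> multigraded_piece n r" "g \<in> multigraded_piece n s"
  shows "f * g \<in> multigraded_piece n (\<lambda>i. r i + s i)"
proof -
  have "m \<in> monomials (coords n) \<and> (\<forall>i\<in>{1..n}. lookup m (Xc i) + lookup m (Yc i) = r i + s i)"
    if "m \<in> keys (f * g)" for m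
  proof -
    obtain a b where ab: "a \<in> keys f" "b \<in> keys g" "m = a + b" using \<open>m \<in> keys (f * g)\<close> by (rule keys_multE)
    then have "keys a \<subseteq> coords n" "keys b \<subseteq> coords n"
      "\<And>i. i \<in> {1..n} \<Longrightarrow> lookup a (Xc i) + lookup a (Yc i) = r i"
      "\<And>i. i \<in> {1..n} \<Longrightarrow> lookup b (Xc i) + lookup b (Yc i) = s i"
      using assms by (auto simp: multigraded_piece_def polys_def monomials_def)
    moreover from this have "keys m \<subseteq> coords n" using Poly_Mapping.keys_add[of a b] ab by blast
    ultimately show ?thesis by (simp add: ab(3) monomials_def lookup_add algebra_simps)
  qed
  then show ?thesis by (auto simp: multigraded_piece_def polys_def)
qed

lemma multigraded_piece_Const: "Const c \<in> multigraded_piece n (\<lambda>i. 0)"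
  by (auto simp: multigraded_piece_def polys_def monomials_def Const_def)

lemma multigraded_piece_cong:
  "(\<And>i. i \<in> {1..n} \<Longrightarrow> r i = s i) \<Longrightarrow> multigraded_piece n r = multigraded_piece n s"
  by (auto simp: multigraded_piece_def)

lemma multigraded_piece_pluecker:
  assumes "i \<in> {1..n}" "j \<in> {1..n}"
  shows "pluecker i j \<in> multigraded_piece n (\<lambda>k. of_bool (k = i) + of_bool (k = j))"
proof -
  let ?a = "single (Xc i) (1::nat) + single (Yc j) 1" and ?b = "single (Xc j) (1::nat) + single (Yc i) 1"
  have pl: "pluecker i j = single ?a 1 - single ?b 1" by (simp add: pluecker_def Var_def mult_single)
  have "keys (pluecker i j :: (coord, 'a) mpoly) \<subseteq> {?a, ?b}"
    using keys_diff[of "single ?a 1" "single ?b (1 :: 'a)"] unfolding pl by auto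
  moreover have "keys (single (Xc k) (1::nat) + single (Yc k') 1) \<subseteq> coords n"
    if "k \<in> {1..n}" "k' \<in> {1..n}" for k k'
    using that Poly_Mapping.keys_add[of "single (Xc k) (1::nat)" "single (Yc k') 1"] by auto
  ultimately have "keys m \<subseteq> coords n" "m = ?a \<or> m = ?b" if "m \<in> keys (pluecker i j :: (coord, 'a) mpoly)" for m
    using assms that by blast+
  moreover have "lookup m (Xc k) + lookup m (Yc k) = of_bool (k = i) + of_bool (k = j)"
    if "m = ?a \<or> m = ?b" for m k
    using that by (auto simp: lookup_add lookup_single when_def)
  ultimately show ?thesis by (simp add: multigraded_piece_def polys_def monomials_def subset_iff)
qed

text \<open>The leading exponent of the section: a factor p_ij with i < j leads with x_i
  y_j.\<close>

definition expo :: "tableau \<Rightarrow> coord monomial"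
  where "expo = (\<lambda>(is, js). (\<Sum>i\<leftarrow>is. single (Xc i) 1) + (\<Sum>j\<leftarrow>js. single (Yc j) 1))"

lemma lookup_expo: "lookup (expo (is, js)) (Xc i) = count_list is i" "lookup (expo (is, js)) (Yc i) = count_list js i"
proof -
  have "lookup (\<Sum>i\<leftarrow>is. single (Xc i) (1::nat)) (Xc i) = count_list is i"
    "lookup (\<Sum>i\<leftarrow>is. single (Xc i) (1::nat)) (Yc i) = 0" for "is"
    by (induction "is") (auto simp: lookup_add lookup_single when_def)
  moreover have "lookup (\<Sum>j\<leftarrow>js. single (Yc j) (1::nat)) (Yc i) = count_list js i"
    "lookup (\<Sum>j\<leftarrow>js. single (Yc j) (1::nat)) (Xc i) = 0" for js
    by (induction js) (auto simp: lookup_add lookup_single when_def)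
  ultimately show "lookup (expo (is, js)) (Xc i) = count_list is i" "lookup (expo (is, js)) (Yc i) = count_list js i"
    by (simp_all add: expo_def lookup_add)
qed

lemma monic_pluecker:
  assumes "i < j" "i \<in> {1..n}"
  shows "xless.monic_at n (pluecker i j) (single (Xc i) 1 + single (Yc j) 1)"
proof -
  let ?a = "single (Xc i) (1::nat) + single (Yc j) 1" and ?b = "single (Xc j) (1::nat) + single (Yc i) 1"
  have less: "xless n ?b ?a"
    using assms by (intro xlessI[of i]) (auto simp: lookup_add lookup_single when_def)
  then have "?b \<noteq> ?a" using xless.irrefl by metis
  have pl: "pluecker i j = single ?a 1 - single ?b 1" by (simp add: pluecker_def Var_def mult_single)
  have "keys (pluecker i j) \<subseteq> {?a, ?b}"
    using keys_diff[of "single ?a 1" "single ?b 1"] unfolding pl by auto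
  moreover have "lookup (pluecker i j) ?a = 1"
    using \<open>?b \<noteq> ?a\<close> unfolding pl by (simp add: lookup_minus lookup_single when_def)
  ultimately show ?thesis using less by (auto simp: xless.monic_at_def)
qed

lemma tableau_section_props:
  fixes n :: nat
  defines "ts \<equiv> tableau_section :: tableau \<Rightarrow> (coord, 'k::comm_ring_1) mpoly"
  assumes "length is = length js" "set is \<union> set js \<subseteq> {1..n}" "\<forall>l<length is. is ! l < js ! l"
  shows "xless.monic_at n (ts (is, js)) (expo (is, js))"
    and "ts (is, js) \<in> multigraded_piece n (tableau_content (is, js))"
    and "SL2_invariant (ts (is, js))"
proof -
  have "xless.monic_at n (ts (is, js)) (expo (is, js)) \<and>
    ts (is, js) \<in> multigraded_piece n (tableau_content (is, js)) \<and>
    SL2_invariant (ts (is, js))"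
    using assms(2-)
  proof (induction "is" js rule: list_induct2)
    case Nil
    show ?case
      by (simp add: ts_def tableau_section_def expo_def tableau_content_def xless.monic_at_one
          multigraded_piece_Const[of 1, unfolded Const_one] SL2_invariant_Const[of 1, unfolded Const_one])
  next
    case (Cons i "is" j js)
    let ?t = "ts (is, js)"
    have "\<forall>l<length is. is ! l < js ! l" using Cons.prems(2) by (auto simp: nth_Cons split: nat.splits)
    moreover have "set is \<union> set js \<subseteq> {1..n}" using Cons.prems(1) by auto
    ultimately have IH: "xless.monic_at n ?t (expo (is, js))"
      "?t \<in> multigraded_piece n (tableau_content (is, js))" "SL2_invariant ?t"
      using Cons.IH by blast+
    have ij: "i < j" "i \<in> {1..n}" "j \<in> {1..n}" using Cons.prems by auto
    have ts: "ts (i # is, j # js) = pluecker i j * ?t" by (simp add: ts_def tableau_section_def)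
    have ex: "expo (i # is, j # js) = (single (Xc i) 1 + single (Yc j) 1) + expo (is, js)"
      by (simp add: expo_def add_ac)
    have tc: "tableau_content (i # is, j # js) =
        (\<lambda>k. (of_bool (k = i) + of_bool (k = j)) + tableau_content (is, js) k)"
      by (auto simp: tableau_content_def)
    show ?case
      unfolding ts ex tc
      by (intro conjI xless.monic_at_mult monic_pluecker multigraded_piece_mult
          multigraded_piece_pluecker SL2_invariant_mult SL2_invariant_pluecker IH ij)
  qed
  then show "xless.monic_at n (ts (is, js)) (expo (is, js))"
    "ts (is, js) \<in> multigraded_piece n (tableau_content (is, js))"
    "SL2_invariant (ts (is, js))" by auto
qed


section \<open>Words and monomials\<close>

text \<open>The additive extension of \<open>F\<close> from variables to monomials. The inner sum of
  a constant is the multiple of \<open>F v\<close> in a monoid without scalar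
  multiplication.\<close>

definition mon_sum :: "('v \<Rightarrow> 'b::comm_monoid_add) \<Rightarrow> 'v monomial \<Rightarrow> 'b"
  where "mon_sum F m = (\<Sum>v\<in>keys m. \<Sum>i<lookup m v. F v)"

lemma mon_sum_superset:
  assumes "finite A" "keys m \<subseteq> A"
  shows "mon_sum F m = (\<Sum>v\<in>A. \<Sum>i<lookup m v. F v)"
  unfolding mon_sum_def using assms
  by (intro sum.mono_neutral_left) (auto simp: in_keys_iff simp del: sum_constant)

lemma sum_lessThan_add_const:
  fixes k l :: nat and c :: "'b::comm_monoid_add"
  shows "(\<Sum>i<k + l. c) = (\<Sum>i<k. c) + (\<Sum>i<l. c)"
  using sum_lessThan_add[of "\<lambda>_. c" k l] by simp

lemma mon_sum_zero [simp]: "mon_sum F 0 = 0"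
  by (simp add: mon_sum_def)

lemma mon_sum_add: "mon_sum F (m + m') = mon_sum F m + mon_sum F m'"
proof -
  let ?A = "keys m \<union> keys m'"
  have "keys (m + m') \<subseteq> ?A" by (rule Poly_Mapping.keys_add)
  then have "mon_sum F (m + m') = (\<Sum>v\<in>?A. \<Sum>i<lookup (m + m') v. F v)"
    by (intro mon_sum_superset) auto
  also have "\<dots> = mon_sum F m + mon_sum F m'"
    unfolding lookup_add sum_lessThan_add_const sum.distrib
    by (intro arg_cong2[where f = "(+)"] mon_sum_superset[symmetric]) auto
  finally show ?thesis .
qed

lemma mon_sum_single [simp]: "mon_sum F (single v 1) = F v"
  by (simp add: mon_sum_def del: sum_constant)

definition word_mon :: "'v list \<Rightarrow> 'v monomial"
  where "word_mon u = (\<Sum>v\<leftarrow>u. single v 1)"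

lemma word_mon_simps [simp]: "word_mon [] = 0" "word_mon (v # u) = single v 1 + word_mon u"
  by (simp_all add: word_mon_def)

lemma word_mon_append: "word_mon (u @ v) = word_mon u + word_mon v"
  by (simp add: word_mon_def)

lemma mon_sum_word_mon: "mon_sum F (word_mon u) = (\<Sum>v\<leftarrow>u. F v)"
  by (induction u) (simp_all add: mon_sum_add del: One_nat_def)

lemma word_mon_mset: "mset u = mset v \<Longrightarrow> word_mon u = word_mon v"
  unfolding word_mon_def by (metis mset_map sum_mset_sum_list)

lemma lookup_word_mon: "lookup (word_mon u) v = count_list u v"
  by (induction u) (auto simp: lookup_add lookup_single when_def)

lemma keys_word_mon: "keys (word_mon u) = set u"
  by (auto simp: in_keys_iff lookup_word_mon count_list_0_iff)

lemma word_mon_replicate: "word_mon (replicate k v) = single v k"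
  by (induction k) (simp_all add: single_add[symmetric])

lemma monomial_word:
  obtains u where "m = word_mon u" "set u = keys m"
proof -
  have "\<exists>u. word_mon u = (\<Sum>v\<in>A. single v (lookup m v))" if "finite A" for A
    using that
  proof (induction A rule: finite_induct)
    case empty
    show ?case by (intro exI[of _ "[]"]) simp
  next
    case (insert v A)
    then obtain u where "word_mon u = (\<Sum>v\<in>A. single v (lookup m v))" by blast
    then show ?case using insert.hyps
      by (intro exI[of _ "replicate (lookup m v) v @ u"]) (simp add: word_mon_append word_mon_replicate)
  qed
  then obtain u where "word_mon u = (\<Sum>v\<in>keys m. single v (lookup m v))" using finite_keys by blast
  then have "m = word_mon u" using poly_mapping_sum_single[of "keys m" m] by simp
  then show ?thesis using that keys_word_mon by metis
qed

lemma total_degree_eq: "total_degree m = mon_sum (\<lambda>_. 1) m"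
  by (simp add: total_degree_def mon_sum_def)

lemma coord_monomial_eqI:
  fixes a b :: "coord monomial"
  assumes keys: "keys a \<subseteq> coords n" "keys b \<subseteq> coords n"
    and XY: "\<And>i. i \<in> {1..n} \<Longrightarrow> lookup a (Xc i) + lookup a (Yc i) = lookup b (Xc i) + lookup b (Yc i)"
    and eq: "\<And>k. k \<le> n \<Longrightarrow> (\<Sum>i\<in>{1..k}. int (lookup a (Xc i))) = (\<Sum>i\<in>{1..k}. int (lookup b (Xc i)))"
  shows "a = b"
proof (rule poly_mapping_eqI)
  have X: "lookup a (Xc i) = lookup b (Xc i)" if "i \<in> {1..n}" for i
  proof -
    obtain k where "i = Suc k" using \<open>i \<in> {1..n}\<close> by (cases i) auto
    then show ?thesis using eq[of k] eq[of i] \<open>i \<in> {1..n}\<close> by simp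
  qed
  then have Y: "lookup a (Yc i) = lookup b (Yc i)" if "i \<in> {1..n}" for i
    using XY[OF that] that by simp
  show "lookup a z = lookup b z" for z
  proof (cases "z \<in> coords n")
    case True
    then show ?thesis using X Y by (auto simp: coords_def)
  next
    case False
    then have "z \<notin> keys a" "z \<notin> keys b" using keys by blast+
    then show ?thesis by (simp add: in_keys_iff)
  qed
qed

lemma finite_bounded_monomials:
  assumes "finite A"
  shows "finite {m :: 'v monomial. keys m \<subseteq> A \<and> (\<forall>v. lookup m v \<le> b)}"
proof -
  have "finite {f. \<forall>x. (x \<in> A \<longrightarrow> f x \<in> {..b}) \<and> (x \<notin> A \<longrightarrow> f x = (0::nat))}"
    using assms by (intro finite_set_of_finite_funs) auto
  moreover have "lookup ` {m. keys m \<subseteq> A \<and> (\<forall>v. lookup m v \<le> b)} \<subseteq>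
      {f. \<forall>x. (x \<in> A \<longrightarrow> f x \<in> {..b}) \<and> (x \<notin> A \<longrightarrow> f x = 0)}"
    by (auto simp: in_keys_iff)
  ultimately have "finite (lookup ` {m :: 'v monomial. keys m \<subseteq> A \<and> (\<forall>v. lookup m v \<le> b)})"
    by (rule finite_subset[rotated])
  then show ?thesis
    by (rule finite_imageD) (auto intro!: inj_onI poly_mapping_eqI)
qed

lemma lookup_le_total_degree: "lookup m v \<le> total_degree m"
proof (cases "v \<in> keys m")
  case True
  then show ?thesis unfolding total_degree_def by (intro member_le_sum) auto
qed (simp add: in_keys_iff)

section \<open>Closure properties of the graded pieces\<close>

lemma Rw_piece_mult: "f \<in> Rw_piece n w d \<Longrightarrow> g \<in> Rw_piece n w e \<Longrightarrow> f * g \<in> Rw_piece n w (d + e)"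
  using multigraded_piece_mult[of f n "\<lambda>i. d * w i" g "\<lambda>i. e * w i"]
  by (auto simp: Rw_piece_def SL2_invariant_mult distrib_right)

lemma Rw_piece_add: "f \<in> Rw_piece n w d \<Longrightarrow> g \<in> Rw_piece n w d \<Longrightarrow> f + g \<in> Rw_piece n w d"
  by (auto simp: Rw_piece_def SL2_invariant_add multigraded_piece_add)

lemma Rw_piece_Const: "Const c \<in> Rw_piece n w 0"
  by (simp add: Rw_piece_def SL2_invariant_Const multigraded_piece_Const)

lemma Rw_piece_scale: "f \<in> Rw_piece n w d \<Longrightarrow> Const c * f \<in> Rw_piece n w d"
  using Rw_piece_mult[OF Rw_piece_Const, of f n w d c] by simp

lemma Const_minus_one: "Const (- 1) = - 1"
  by (simp add: Const_def single_uminus)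

lemma Rw_piece_uminus: "f \<in> Rw_piece n w d \<Longrightarrow> - f \<in> Rw_piece n w d"
  using Rw_piece_scale[of f n w d "- 1"] by (simp add: Const_minus_one)

lemma Rw_piece_diff: "f \<in> Rw_piece n w d \<Longrightarrow> g \<in> Rw_piece n w d \<Longrightarrow> f - g \<in> Rw_piece n w d"
  using Rw_piece_add[OF _ Rw_piece_uminus, of f n w d g] by simp

lemma Rw_piece_zero: "0 \<in> Rw_piece n w d"
  by (auto simp: Rw_piece_def multigraded_piece_def polys_def SL2_invariant_def poly_subst_eq_evaluate)

lemma Rw_piece_sum: "(\<And>i. i \<in> I \<Longrightarrow> f i \<in> Rw_piece n w d) \<Longrightarrow> sum f I \<in> Rw_piece n w d"
  by (induction I rule: infinite_finite_induct) (simp_all add: Rw_piece_zero Rw_piece_add)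


section \<open>Standard monomials\<close>

locale weighted_points =
  fixes n :: nat and w :: "nat \<Rightarrow> nat"
  assumes n_pos: "1 \<le> n" and w_pos_even: "\<forall>i\<in>{1..n}. 0 < w i \<and> even (w i)"
begin

abbreviation V :: "tableau set" where "V \<equiv> tableaux n w"

lemma w_even: "\<forall>i\<in>{1..n}. even (w i)"
  using w_pos_even by blast

definition below :: "tableau \<Rightarrow> tableau \<Rightarrow> bool"
  where "below \<sigma> \<tau> \<longleftrightarrow> (\<forall>k\<le>n. fence (top_count \<sigma> k) (top_count \<tau> k))"

definition std :: "tableau list \<Rightarrow> bool"
  where "std u \<longleftrightarrow> set u \<subseteq> V \<and> successively below u"

definition sec :: "tableau list \<Rightarrow> (coord, 'k::field) mpoly"
  where "sec u = prod_list (map tableau_section u)"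

definition wexpo :: "tableau list \<Rightarrow> coord monomial"
  where "wexpo u = (\<Sum>\<tau>\<leftarrow>u. expo \<tau>)"

definition profile :: "tableau list \<Rightarrow> nat \<Rightarrow> int"
  where "profile u k = (\<Sum>\<tau>\<leftarrow>u. top_count \<tau> k)"

lemma below_refl: "below \<tau> \<tau>"
  by (simp add: below_def fence_refl)

lemma below_trans: "below \<rho> \<sigma> \<Longrightarrow> below \<sigma> \<tau> \<Longrightarrow> below \<rho> \<tau>"
  unfolding below_def using fence_trans by blast

lemma std_sorted: "std u \<longleftrightarrow> set u \<subseteq> V \<and> sorted_wrt below u"
  unfolding std_def using below_trans by (subst successively_conv_sorted_wrt) (auto intro: transpI)

lemma expo_top_count:
  assumes "\<tau> \<in> V" "k \<le> n"
  shows "(\<Sum>i\<in>{1..k}. int (lookup (expo \<tau>) (Xc i))) = top_count \<tau> k"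
  using assms(2)
proof (induction k)
  case 0
  then show ?case using top_count_path[OF w_even assms(1)] by (simp add: path_def)
next
  case (Suc k)
  obtain "is" js where \<tau>: "\<tau> = (is, js)" by (cases \<tau>)
  show ?case using Suc tableaux_counts(1)[OF assms(1)[unfolded \<tau>], of "Suc k"]
    by (simp add: \<tau> lookup_expo)
qed

lemma expo_Y:
  assumes "\<tau> \<in> V" "i \<in> {1..n}"
  shows "lookup (expo \<tau>) (Xc i) + lookup (expo \<tau>) (Yc i) = w i"
  using assms by (cases \<tau>) (auto simp: lookup_expo tableaux_def tableau_content_def)

lemma expo_keys:
  assumes "\<tau> \<in> V"
  shows "keys (expo \<tau>) \<subseteq> coords n"
proof
  fix v assume v: "v \<in> keys (expo \<tau>)"
  obtain "is" js where \<tau>: "\<tau> = (is, js)" by (cases \<tau>)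
  have "set is \<subseteq> {1..n}" "set js \<subseteq> {1..n}" using assms by (auto simp: \<tau> tableaux_def semistandard_def)
  then show "v \<in> coords n"
    using v by (cases v) (auto simp: in_keys_iff \<tau> lookup_expo count_list_0_iff coords_def)
qed

lemma wexpo_simps [simp]: "wexpo [] = 0" "wexpo (\<tau> # u) = expo \<tau> + wexpo u"
  by (simp_all add: wexpo_def)

lemma wexpo_profile:
  "set u \<subseteq> V \<Longrightarrow> k \<le> n \<Longrightarrow> (\<Sum>i\<in>{1..k}. int (lookup (wexpo u) (Xc i))) = profile u k"
  by (induction u) (simp_all add: profile_def lookup_add sum.distrib expo_top_count del: One_nat_def)

lemma wexpo_Y:
  "set u \<subseteq> V \<Longrightarrow> i \<in> {1..n} \<Longrightarrow> lookup (wexpo u) (Xc i) + lookup (wexpo u) (Yc i) = length u * w i"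
proof (induction u)
  case (Cons \<tau> u)
  then show ?case using expo_Y[of \<tau> i] by (simp add: lookup_add)
qed simp

lemma wexpo_keys: "set u \<subseteq> V \<Longrightarrow> keys (wexpo u) \<subseteq> coords n"
proof (induction u)
  case (Cons \<tau> u)
  then show ?case using Poly_Mapping.keys_add[of "expo \<tau>" "wexpo u"] expo_keys[of \<tau>] by auto
qed simp

lemma wexpo_length:
  assumes "set u \<subseteq> V" "set v \<subseteq> V" "wexpo u = wexpo v"
  shows "length u = length v"
proof -
  have "1 \<in> {1..n}" "w 1 \<noteq> 0" using w_pos_even n_pos by auto
  then show ?thesis using wexpo_Y[OF assms(1), of 1] wexpo_Y[OF assms(2), of 1] assms(3) by simp
qed

text \<open>For each \<open>k\<close> the values at \<open>k\<close> along a standard word form a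
  fence chain, which is determined by its length and its sum.\<close>

lemma std_nth:
  assumes "std u" "j < length u" "k \<le> n"
  shows "top_count (u ! j) k = part (length u) j (profile u k)"
proof -
  have "sorted_wrt fence (map (\<lambda>\<tau>. top_count \<tau> k) u)"
    using assms(1,3) by (auto simp: std_sorted sorted_wrt_map below_def elim!: sorted_wrt_mono_rel[rotated])
  from fence_chain_eq_part[OF this, of j] show ?thesis
    using assms(2) by (simp add: profile_def)
qed

text \<open>The leading exponent determines the length and all partial sums of x-exponents, hence
  every letter. Products of different standard words therefore have different leading
  exponents.\<close>

lemma std_unique:
  assumes u: "std u" and v: "std v" and eq: "wexpo u = wexpo v"
  shows "u = v"
proof (rule nth_equalityI)
  have uv: "set u \<subseteq> V" "set v \<subseteq> V" using u v by (auto simp: std_def)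
  then show len: "length u = length v" using eq by (intro wexpo_length)
  fix j assume j: "j < length u"
  have "profile u k = profile v k" if "k \<le> n" for k
    using wexpo_profile[OF uv(1) that] wexpo_profile[OF uv(2) that] eq by simp
  then have "top_count (u ! j) k = top_count (v ! j) k" if "k \<le> n" for k
    using std_nth[OF u j that] std_nth[OF v _ that, of j] j len that by simp
  moreover have "u ! j \<in> V" "v ! j \<in> V" using uv j len by auto
  ultimately show "u ! j = v ! j" using top_count_inj by blast
qed

text \<open>The \<open>j\<close>-th letter is the tableau of the \<open>j\<close>-th parts of
  \<open>T\<close>; consecutive parts form chains in every coordinate.\<close>

lemma path_word:
  assumes T: "path n w d T"
  obtains u where "std u" "length u = d" "\<And>k. k \<le> n \<Longrightarrow> profile u k = T k"
proof -
  have "\<exists>\<tau>. \<tau> \<in> V \<and> (\<forall>k\<le>n. top_count \<tau> k = part d j (T k))" if "j < d" for j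
    using path_tableau[OF path_part[OF T w_even that]] by metis
  then obtain t where t: "\<And>j. j < d \<Longrightarrow> t j \<in> V"
    "\<And>j k. j < d \<Longrightarrow> k \<le> n \<Longrightarrow> top_count (t j) k = part d j (T k)" by metis
  define u where "u = map t [0..<d]"
  have "sorted_wrt below u"
    unfolding u_def by (auto simp: sorted_wrt_map sorted_wrt_iff_nth_less below_def t part_fence)
  then have "std u" using t(1) by (auto simp: std_sorted u_def)
  moreover have "profile u k = T k" if k: "k \<le> n" for k
  \<comment> \<open>\<open>sum_part\<close> needs a nonempty chain. In degree 0 the inequalities
    force \<open>T\<close> to vanish.\<close>
  proof (cases "d = 0")
    case True
    have "T k = 0" using k
    proof (induction k)
      case (Suc k)
      then show ?case using pathD(1,2)[OF T, of k] True by simp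
    qed (use T in \<open>simp add: path_def\<close>)
    then show ?thesis using True by (simp add: u_def profile_def)
  next
    case False
    have "profile u k = (\<Sum>j<d. top_count (t j) k)"
      by (simp add: profile_def u_def sum_list_distinct_conv_sum_set lessThan_atLeast0 comp_def)
    also have "\<dots> = (\<Sum>j<d. part d j (T k))" using k by (intro sum.cong) (simp_all add: t)
    finally show ?thesis using sum_part False by simp
  qed
  ultimately show ?thesis using that[of u] by (simp add: u_def)
qed

section \<open>Products of sections along words\<close>

lemma sec_simps [simp]: "sec [] = 1" "sec (\<tau> # u) = tableau_section \<tau> * sec u"
  by (simp_all add: sec_def)

lemma sec_eq_mon_eval: "sec u = mon_eval tableau_section (word_mon u)"
  by (induction u) (simp_all add: mon_eval_add del: One_nat_def)

lemma tableau_section_V: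
  assumes "\<tau> \<in> V"
  shows "xless.monic_at n (tableau_section \<tau> :: (coord, 'k::field) mpoly) (expo \<tau>)"
    and "(tableau_section \<tau> :: (coord, 'k) mpoly) \<in> Rw_piece n w 1"
proof -
  obtain "is" js where \<tau>: "\<tau> = (is, js)" by (cases \<tau>)
  have *: "length is = length js" "set is \<union> set js \<subseteq> {1..n}" "\<forall>l<length is. is ! l < js ! l"
    using assms by (auto simp: \<tau> tableaux_def semistandard_def)
  have "multigraded_piece n (tableau_content (is, js)) = multigraded_piece n (\<lambda>i. 1 * w i)"
    using assms by (intro multigraded_piece_cong) (auto simp: \<tau> tableaux_def)
  then show "xless.monic_at n (tableau_section \<tau> :: (coord, 'k) mpoly) (expo \<tau>)"
    "(tableau_section \<tau> :: (coord, 'k) mpoly) \<in> Rw_piece n w 1"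
    using tableau_section_props[OF *, where 'k = 'k] by (auto simp: \<tau> Rw_piece_def)
qed

lemma sec_monic: "set u \<subseteq> V \<Longrightarrow> xless.monic_at n (sec u :: (coord, 'k::field) mpoly) (wexpo u)"
  by (induction u) (simp_all add: xless.monic_at_one xless.monic_at_mult tableau_section_V)

lemma sec_Rw_piece: "set u \<subseteq> V \<Longrightarrow> (sec u :: (coord, 'k::field) mpoly) \<in> Rw_piece n w (length u)"
proof (induction u)
  case Nil
  show ?case using Rw_piece_Const[of 1 n w] by (simp add: Const_one)
next
  case (Cons \<tau> u)
  then show ?case using Rw_piece_mult[OF tableau_section_V(2), of \<tau> "sec u" "length u"] by simp
qed

text \<open>The sections of tableaux behave like a SAGBI basis: leading exponents of invariants are
  already leading exponents of standard products.\<close>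

lemma lead_word:
  fixes f :: "(coord, 'k::field) mpoly"
  assumes f: "f \<in> Rw_piece n w d" and l: "l \<in> keys f" and max: "\<And>m. m \<in> keys f \<Longrightarrow> \<not> xless n l m"
  obtains u where "std u" "length u = d" "wexpo u = l"
proof -
  obtain u where u: "std u" "length u = d"
    and prof: "\<And>k. k \<le> n \<Longrightarrow> profile u k = int (\<Sum>i\<in>{1..k}. lookup l (Xc i))"
    using path_word[OF lead_path[OF f l max]] by blast
  have uV: "set u \<subseteq> V" using u by (simp add: std_def)
  have l': "keys l \<subseteq> coords n" "\<And>i. i \<in> {1..n} \<Longrightarrow> lookup l (Xc i) + lookup l (Yc i) = d * w i"
    using f l by (auto simp: Rw_piece_def multigraded_piece_def polys_def monomials_def)
  have "wexpo u = l"
  proof (rule coord_monomial_eqI[OF wexpo_keys[OF uV] l'(1)])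
    show "lookup (wexpo u) (Xc i) + lookup (wexpo u) (Yc i) = lookup l (Xc i) + lookup l (Yc i)"
      if "i \<in> {1..n}" for i
      using wexpo_Y[OF uV that] l'(2)[OF that] u by simp
    show "(\<Sum>i\<in>{1..k}. int (lookup (wexpo u) (Xc i))) = (\<Sum>i\<in>{1..k}. int (lookup l (Xc i)))"
      if "k \<le> n" for k
      using wexpo_profile[OF uV that] prof[OF that] by simp
  qed
  then show ?thesis using u that by blast
qed

lemma finite_multidegree:
  "finite {m :: coord monomial. keys m \<subseteq> coords n \<and>
    (\<forall>i\<in>{1..n}. lookup m (Xc i) + lookup m (Yc i) = d * w i)}" (is "finite ?M")
proof -
  let ?b = "\<Sum>i\<in>{1..n}. d * w i"
  have "lookup m v \<le> ?b" if m: "m \<in> ?M" for m v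
  proof (cases "v \<in> coords n")
    case True
    then obtain i where i: "i \<in> {1..n}" "v = Xc i \<or> v = Yc i" by (auto simp: coords_def)
    have "lookup m v \<le> lookup m (Xc i) + lookup m (Yc i)" using i by auto
    also have "\<dots> = d * w i" using m i by blast
    also have "d * w i \<le> ?b" using i by (intro member_le_sum) auto
    finally show ?thesis .
  next
    case False
    then have "v \<notin> keys m" using m by blast
    then show ?thesis by (simp add: in_keys_iff)
  qed
  then have "?M \<subseteq> {m. keys m \<subseteq> coords n \<and> (\<forall>v. lookup m v \<le> ?b)}" by blast
  then show ?thesis by (rule finite_subset) (rule finite_bounded_monomials[OF finite_coords])
qed

text \<open>Subduction: a standard product with the same leading exponent is subtracted until
  nothing is left. The final clause records that no larger leading exponents are introduced, as the
  Groebner basis requires.\<close>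

lemma spanning:
  fixes f :: "(coord, 'k::field) mpoly"
  assumes "f \<in> Rw_piece n w d"
  shows "\<exists>p. evaluate tableau_section p = f \<and> (\<forall>m\<in>keys p. \<exists>u. m = word_mon u \<and> std u \<and> length u = d \<and>
    (\<exists>l\<in>keys f. wexpo u = l \<or> xless n (wexpo u) l))"
proof -
  define M where "M = {m :: coord monomial. keys m \<subseteq> coords n \<and>
    (\<forall>i\<in>{1..n}. lookup m (Xc i) + lookup m (Yc i) = d * w i)}"
  \<comment> \<open>The exponents of the given multidegree at or below some exponent of
    \<open>f\<close>: a finite set, from which each subtraction removes the leading
    exponent.\<close>
  define L where "L f = {m\<in>M. \<exists>l\<in>keys f. m = l \<or> xless n m l}" for f :: "(coord, 'k) mpoly"
  have finL: "finite (L f)" for f unfolding L_def M_def by (rule finite_subset[OF _ finite_multidegree[of d]]) blast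
  show ?thesis
    using assms
  proof (induction "card (L f)" arbitrary: f rule: less_induct)
    case less
    show ?case
    proof (cases "f = 0")
      case True
      then show ?thesis by (intro exI[of _ 0]) simp
    next
      case False
      then have "finite (keys f)" "keys f \<noteq> {}" by simp_all
      then obtain l where l: "l \<in> keys f" and max: "\<And>m. m \<in> keys f \<Longrightarrow> \<not> xless n l m"
        using xless.maximal_key[where n = n] by metis
      obtain u where u: "std u" "length u = d" "wexpo u = l" using lead_word[OF less.prems l max] by blast
      have uV: "set u \<subseteq> V" using u by (simp add: std_def)
      define c where "c = lookup f l"
      define f' where "f' = f - Const c * sec u"
      have "sec u \<in> Rw_piece n w d" using sec_Rw_piece[OF uV] u by simp
      then have f': "f' \<in> Rw_piece n w d"
        unfolding f'_def by (intro Rw_piece_diff Rw_piece_scale less.prems)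
      have sec: "lookup (sec u :: (coord, 'k) mpoly) l = 1"
        "\<And>m. m \<in> keys (sec u :: (coord, 'k) mpoly) \<Longrightarrow> m = l \<or> xless n m l"
        using sec_monic[OF uV, where 'k = 'k] u by (auto simp: xless.monic_at_def)
      have lookup_f': "lookup f' m = lookup f m - c * lookup (sec u) m" for m
        by (simp add: f'_def lookup_minus Const_def lookup_single_zero_mult)
      have keys_f': "m \<noteq> l \<and> (m \<in> keys f \<or> xless n m l)" if m: "m \<in> keys f'" for m
      proof -
        have "m \<noteq> l" using m sec(1) lookup_f'[of l] by (auto simp: in_keys_iff c_def)
        moreover have "m \<in> keys f \<or> m \<in> keys (sec u :: (coord, 'k) mpoly)"
          using m lookup_f'[of m] by (auto simp: in_keys_iff)
        ultimately show ?thesis using sec(2) by blast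
      qed
      have dom: "\<exists>l'\<in>keys f. m = l' \<or> xless n m l'" if "m' \<in> keys f'" "m = m' \<or> xless n m m'" for m m'
        using keys_f'[OF that(1)] that(2) l xless.trans by blast
      have "l \<in> L f"
        using less.prems l by (auto simp: L_def M_def Rw_piece_def multigraded_piece_def polys_def monomials_def)
      moreover have "l \<notin> L f'"
      proof
        assume "l \<in> L f'"
        then obtain m where m: "m \<in> keys f'" "l = m \<or> xless n l m" by (auto simp: L_def)
        then show False using keys_f'[OF m(1)] max xless.trans[of n l m l] xless.irrefl by blast
      qed
      moreover have "L f' \<subseteq> L f" using dom by (fastforce simp: L_def)
      ultimately have "card (L f') < card (L f)" using finL by (intro psubset_card_mono) auto
      from less.hyps[OF this f'] obtain p where p: "evaluate tableau_section p = f'"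
        and keys_p: "\<And>m. m \<in> keys p \<Longrightarrow> \<exists>u. m = word_mon u \<and> std u \<and> length u = d \<and>
          (\<exists>l\<in>keys f'. wexpo u = l \<or> xless n (wexpo u) l)" by blast
      let ?p = "p + single (word_mon u) c"
      have "evaluate tableau_section ?p = f"
        by (simp add: evaluate_add p evaluate_single f'_def sec_eq_mon_eval Const_def)
      moreover have "\<exists>v. m = word_mon v \<and> std v \<and> length v = d \<and>
          (\<exists>l\<in>keys f. wexpo v = l \<or> xless n (wexpo v) l)" if m: "m \<in> keys ?p" for m
      proof -
        have "m \<in> keys p \<or> m = word_mon u"
          using m Poly_Mapping.keys_add[of p "single (word_mon u) c"] by (auto split: if_splits)
        then show ?thesis
        proof
          assume "m \<in> keys p"
          then show ?thesis using keys_p[of m] dom by blast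
        qed (use u l in blast)
      qed
      ultimately show ?thesis by blast
    qed
  qed
qed

definition standard :: "tableau monomial \<Rightarrow> bool"
  where "standard m \<longleftrightarrow> (\<exists>u. std u \<and> m = word_mon u)"

lemma standard_unique: "std u \<Longrightarrow> std v \<Longrightarrow> word_mon u = word_mon v \<Longrightarrow> u = v"
  using mon_sum_word_mon[of expo u] mon_sum_word_mon[of expo v] by (intro std_unique) (simp_all add: wexpo_def)

text \<open>At a maximal leading exponent only one monomial contributes, because different standard
  monomials have different leading exponents, and it contributes with coefficient 1.\<close>

lemma linear_independence:
  fixes p :: "(tableau, 'k::field) mpoly"
  assumes std: "\<And>m. m \<in> keys p \<Longrightarrow> standard m" and zero: "evaluate tableau_section p = 0"
  shows "p = 0"
proof (rule ccontr)
  assume "p \<noteq> 0"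
  then have "finite (mon_sum expo ` keys p)" "mon_sum expo ` keys p \<noteq> {}" by simp_all
  then obtain l where l: "l \<in> mon_sum expo ` keys p"
    and max: "\<And>l'. l' \<in> mon_sum expo ` keys p \<Longrightarrow> \<not> xless n l l'"
    using xless.maximal_key[where n = n] by metis
  then obtain m where m: "m \<in> keys p" "l = mon_sum expo m" by blast
  have "lookup (mon_eval tableau_section m' :: (coord, 'k) mpoly) l = (if m' = m then 1 else 0)"
    if m': "m' \<in> keys p" for m'
  proof -
    obtain u v where uv: "std u" "m = word_mon u" "std v" "m' = word_mon v"
      using std[OF m(1)] std[OF m'] by (auto simp: standard_def)
    have l: "l = wexpo u" "mon_sum expo m' = wexpo v"
      using m uv by (simp_all add: mon_sum_word_mon wexpo_def)
    have monic: "xless.monic_at n (mon_eval tableau_section m' :: (coord, 'k) mpoly) (wexpo v)"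
      using sec_monic[of v] uv by (simp add: sec_eq_mon_eval std_def)
    show ?thesis
    proof (cases "m' = m")
      case True
      then show ?thesis using monic l m by (simp add: xless.monic_at_def)
    next
      case False
      then have "l \<noteq> wexpo v" using std_unique uv l by blast
      moreover have "\<not> xless n l (wexpo v)" using max[of "wexpo v"] m' l by (metis imageI)
      ultimately have "l \<notin> keys (mon_eval tableau_section m' :: (coord, 'k) mpoly)"
        using monic by (auto simp: xless.monic_at_def)
      then show ?thesis using False by (simp add: in_keys_iff)
    qed
  qed
  then have "lookup (evaluate tableau_section p) l = (\<Sum>m'\<in>keys p. if m' = m then lookup p m else 0)"
    unfolding lookup_evaluate by (intro sum.cong) auto
  also have "\<dots> \<noteq> 0" using m by (simp add: in_keys_iff)
  finally show False using zero by simp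
qed

end


section \<open>The monomial order\<close>

text \<open>For a fixed sum, the sum of squares increases with the distance of the two numbers, and
  elements of a chain are at distance at most 1.\<close>

lemma fence_sum_squares:
  assumes "fence x y" "x + y = a + b"
  shows "x\<^sup>2 + y\<^sup>2 \<le> a\<^sup>2 + b\<^sup>2" and "x\<^sup>2 + y\<^sup>2 = a\<^sup>2 + b\<^sup>2 \<Longrightarrow> \<bar>a - b\<bar> \<le> 1"
proof -
  have eq: "2 * (a\<^sup>2 + b\<^sup>2) - 2 * (x\<^sup>2 + y\<^sup>2) = (a - b)\<^sup>2 - (x - y)\<^sup>2"
  proof -
    have "2 * (a\<^sup>2 + b\<^sup>2) = (a + b)\<^sup>2 + (a - b)\<^sup>2" "2 * (x\<^sup>2 + y\<^sup>2) = (x + y)\<^sup>2 + (x - y)\<^sup>2"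
      by (simp_all add: power2_eq_square algebra_simps)
    then show ?thesis using assms(2) by simp
  qed
  have xy: "\<bar>x - y\<bar> \<le> 1" using assms(1) by (auto simp: fence_def)
  have less: "(x - y)\<^sup>2 < (a - b)\<^sup>2" if "\<not> \<bar>a - b\<bar> \<le> 1"
    using abs_le_square_iff[of "a - b" "x - y"] xy that by linarith
  show "x\<^sup>2 + y\<^sup>2 = a\<^sup>2 + b\<^sup>2 \<Longrightarrow> \<bar>a - b\<bar> \<le> 1" using less eq by force
  show "x\<^sup>2 + y\<^sup>2 \<le> a\<^sup>2 + b\<^sup>2"
  proof (cases "\<bar>a - b\<bar> \<le> 1")
    case True
    then have "a - b = x - y \<or> a - b = y - x" using xy assms(2) by presburger
    then have "(a - b)\<^sup>2 = (x - y)\<^sup>2" by (metis power2_commute)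
    then show ?thesis using eq by simp
  next
    case False
    then show ?thesis using less eq by simp
  qed
qed

text \<open>With equal sums and both distances at most 1, the pairs \<open>x, y\<close> and
  \<open>a, b\<close> agree up to order, and the fence order puts an odd entry last.\<close>

lemma fence_parity:
  assumes "fence x y" "x + y = a + b" "\<bar>a - b\<bar> \<le> 1"
  shows "odd y \<longleftrightarrow> odd a \<or> odd b" "odd x \<longleftrightarrow> odd a \<and> odd b"
proof -
  have "a = b \<or> a = b + 1 \<or> b = a + 1" using assms(3) by linarith
  moreover have "x = y \<or> odd y \<and> y = x + 1 \<or> odd y \<and> x = y + 1"
    using assms(1) by (auto simp: fence_def)
  ultimately have "(odd y \<longleftrightarrow> odd a \<or> odd b) \<and> (odd x \<longleftrightarrow> odd a \<and> odd b)"
    using assms(2) by (elim disjE) presburger+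
  then show "odd y \<longleftrightarrow> odd a \<or> odd b" "odd x \<longleftrightarrow> odd a \<and> odd b" by blast+
qed

lemma fence_if_odd: "\<bar>a - b\<bar> \<le> 1 \<Longrightarrow> (odd a \<Longrightarrow> odd b) \<Longrightarrow> fence a b"
  unfolding fence_def by presburger

text \<open>Applied to the sizes \<open>s\<close> and \<open>t\<close> of the union and the
  intersection of two sets of sizes \<open>p\<close> and \<open>q\<close>. The gain is 2 (s - p) (s
  - q).\<close>

lemma sum_squares_union_inter:
  fixes p q s t :: int
  assumes "p + q = s + t" "p < s" "q < s"
  shows "p\<^sup>2 + q\<^sup>2 < s\<^sup>2 + t\<^sup>2"
proof -
  have t: "t = p + q - s" using assms by simp
  have "s\<^sup>2 + t\<^sup>2 - (p\<^sup>2 + q\<^sup>2) = 2 * ((s - p) * (s - q))"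
    unfolding t by (simp add: power2_eq_square algebra_simps)
  moreover have "0 < (s - p) * (s - q)" using assms by simp
  ultimately show ?thesis by linarith
qed

context weighted_points
begin

definition oddset :: "tableau \<Rightarrow> nat set"
  where "oddset \<tau> = {k\<in>{..n}. odd (top_count \<tau> k)}"

definition tabs :: "tableau list"
  where "tabs = (SOME xs. set xs = V)"

text \<open>Monomials are compared first by degree and by the leading exponents of their images. The
  remaining keys prefer balanced monomials, then those whose odd sets form a chain, and finally
  break ties arbitrarily.\<close>

definition mkey :: "nat \<Rightarrow> tableau monomial \<Rightarrow> int"
  where "mkey j m =
    (if j = 0 then mon_sum (\<lambda>_. 1) m
     else if j \<le> n then mon_sum (\<lambda>\<tau>. int (lookup (expo \<tau>) (Xc j))) m
     else if j = n + 1 then mon_sum (\<lambda>\<tau>. \<Sum>k\<le>n. (top_count \<tau> k)\<^sup>2) m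
     else if j = n + 2 then - mon_sum (\<lambda>\<tau>. (int (card (oddset \<tau>)))\<^sup>2) m
     else int (lookup m (tabs ! (j - n - 3))))"

definition mless :: "tableau monomial \<Rightarrow> tableau monomial \<Rightarrow> bool"
  where "mless = key_less mkey (n + 3 + length tabs)"

sublocale mless: additive_order mless
  unfolding mless_def
  by (rule key_less_additive_order) (simp add: mkey_def mon_sum_add lookup_add)

definition mord :: "tableau monomial rel"
  where "mord = {(a, b). a \<in> monomials V \<and> b \<in> monomials V \<and> (a = b \<or> mless a b)}"

lemma set_tabs: "set tabs = V"
  unfolding tabs_def using finite_list[OF finite_tableaux] by (rule someI_ex)

lemma mless_total:
  assumes "a \<in> monomials V" "b \<in> monomials V" "\<not> mless a b" "\<not> mless b a"
  shows "a = b"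
proof (rule poly_mapping_eqI)
  fix \<tau>
  show "lookup a \<tau> = lookup b \<tau>"
  proof (cases "\<tau> \<in> V")
    case True
    then obtain i where i: "i < length tabs" "\<tau> = tabs ! i" using set_tabs by (metis in_set_conv_nth)
    have "mkey (n + 3 + i) a = mkey (n + 3 + i) b"
      using key_less_total[OF assms(3,4)[unfolded mless_def], of "n + 3 + i"] i by simp
    then show ?thesis using i by (simp add: mkey_def)
  next
    case False
    then have "\<tau> \<notin> keys a" "\<tau> \<notin> keys b" using assms(1,2) by (auto simp: monomials_def)
    then show ?thesis by (simp add: in_keys_iff)
  qed
qed

lemma mless_degree:
  assumes "mless a b"
  shows "total_degree a \<le> total_degree b"
proof -
  have "mkey 0 a \<le> mkey 0 b"
    using assms unfolding mless_def key_less_def by (metis gr0I order.strict_implies_order order_refl)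
  moreover have "mkey 0 m = int (total_degree m)" for m by (simp add: mkey_def mon_sum_def total_degree_def)
  ultimately show ?thesis by simp
qed

text \<open>The degree is compared before all other keys, so the negative key causes no infinite
  descent. This makes \<open>mord\<close> a well-order.\<close>

lemma finite_mless: "finite {a \<in> monomials V. mless a b}"
proof (rule finite_subset)
  show "{a \<in> monomials V. mless a b} \<subseteq> {m. keys m \<subseteq> V \<and> (\<forall>v. lookup m v \<le> total_degree b)}"
    using mless_degree lookup_le_total_degree by (fastforce simp: monomials_def intro: order_trans)
qed (rule finite_bounded_monomials[OF finite_tableaux])

lemma wf_mless: "wf {(a, b). a \<in> monomials V \<and> b \<in> monomials V \<and> mless a b}"
proof (rule wf_subset[OF wf_measure[of "\<lambda>b. card {a \<in> monomials V. mless a b}"]])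
  show "{(a, b). a \<in> monomials V \<and> b \<in> monomials V \<and> mless a b} \<subseteq>
      measure (\<lambda>b. card {a \<in> monomials V. mless a b})"
  proof clarify
    fix a b assume ab: "a \<in> monomials V" "mless a b"
    have "{c \<in> monomials V. mless c a} \<subset> {c \<in> monomials V. mless c b}"
      using ab mless.irrefl[of a] mless.trans by blast
    then show "(a, b) \<in> measure (\<lambda>b. card {a \<in> monomials V. mless a b})"
      using psubset_card_mono[OF finite_mless] by simp
  qed
qed

lemma monomials_add: "a \<in> monomials U \<Longrightarrow> b \<in> monomials U \<Longrightarrow> a + b \<in> monomials U"
  using Poly_Mapping.keys_add[of a b] by (auto simp: monomials_def)

lemma monomial_order_mord: "monomial_order V mord"
  unfolding monomial_order_def
proof (intro conjI allI impI)
  have "wf (mord - Id)"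
    by (rule wf_subset[OF wf_mless]) (auto simp: mord_def)
  moreover have "refl_on (monomials V) mord" by (auto simp: refl_on_def mord_def)
  moreover have "trans mord" by (rule transI) (auto simp: mord_def intro: mless.trans)
  moreover have "antisym mord"
    by (rule antisymI) (use mless.trans mless.irrefl in \<open>auto simp: mord_def\<close>)
  moreover have "total_on (monomials V) mord"
    by (rule total_onI) (use mless_total in \<open>auto simp: mord_def\<close>)
  ultimately show "well_order_on (monomials V) mord"
    unfolding order_on_defs by (auto simp: mord_def)
  show "(a + c, b + c) \<in> mord" if "(a, b) \<in> mord" "c \<in> monomials V" for a b c
    using that by (auto simp: mord_def monomials_add intro: mless.add_right)
qed

lemma int_lookup_wexpo: "int (lookup (wexpo u) z) = (\<Sum>\<tau>\<leftarrow>u. int (lookup (expo \<tau>) z))"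
  by (induction u) (simp_all add: lookup_add)

lemma mkey_X: "j \<in> {1..n} \<Longrightarrow> mkey j (word_mon u) = int (lookup (wexpo u) (Xc j))"
  by (simp add: mkey_def mon_sum_word_mon int_lookup_wexpo)

lemma mkey_0: "mkey 0 (word_mon u) = int (length u)"
  by (simp add: mkey_def mon_sum_word_mon sum_list_triv)

lemma mless_if_xless:
  assumes "length u = length v" "xless n (wexpo u) (wexpo v)"
  shows "mless (word_mon u) (word_mon v)"
proof -
  obtain j where j: "j < n" "lookup (wexpo u) (Xc (Suc j)) < lookup (wexpo v) (Xc (Suc j))"
    "\<And>i. i < j \<Longrightarrow> lookup (wexpo u) (Xc (Suc i)) = lookup (wexpo v) (Xc (Suc i))"
    using assms(2) by (auto simp: xless_def key_less_def)
  have "mkey i (word_mon u) = mkey i (word_mon v)" if "i < Suc j" for i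
    using that j assms(1) by (cases i) (simp_all add: mkey_0 mkey_X)
  then show ?thesis
    unfolding mless_def key_less_def using j by (intro exI[of _ "Suc j"]) (simp add: mkey_X)
qed

lemma mless_tie_break:
  assumes u: "set u \<subseteq> V" and v: "set v \<subseteq> V" and eq: "wexpo u = wexpo v"
    and less: "mkey (n + 1) (word_mon u) < mkey (n + 1) (word_mon v) \<or>
      mkey (n + 1) (word_mon u) = mkey (n + 1) (word_mon v) \<and>
      mkey (n + 2) (word_mon u) < mkey (n + 2) (word_mon v)"
  shows "mless (word_mon u) (word_mon v)"
proof -
  have *: "mkey i (word_mon u) = mkey i (word_mon v)" if "i < n + 1" for i
    using wexpo_length[OF u v eq] eq that by (cases i) (simp_all add: mkey_0 mkey_X)
  from less show ?thesis
  proof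
    assume "mkey (n + 1) (word_mon u) < mkey (n + 1) (word_mon v)"
    then show ?thesis using * unfolding mless_def key_less_def by (intro exI[of _ "n + 1"]) simp
  next
    assume "mkey (n + 1) (word_mon u) = mkey (n + 1) (word_mon v) \<and>
      mkey (n + 2) (word_mon u) < mkey (n + 2) (word_mon v)"
    moreover from this have "mkey i (word_mon u) = mkey i (word_mon v)" if "i < n + 2" for i
      using * that by (cases "i = n + 1") simp_all
    ultimately show ?thesis unfolding mless_def key_less_def by (intro exI[of _ "n + 2"]) simp
  qed
qed

lemma profile_wexpo:
  assumes u: "set u \<subseteq> V" and v: "set v \<subseteq> V" and len: "length u = length v"
    and prof: "\<And>k. k \<le> n \<Longrightarrow> profile u k = profile v k"
  shows "wexpo u = wexpo v"
proof (rule coord_monomial_eqI[OF wexpo_keys[OF u] wexpo_keys[OF v]])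
  show "lookup (wexpo u) (Xc i) + lookup (wexpo u) (Yc i) = lookup (wexpo v) (Xc i) + lookup (wexpo v) (Yc i)"
    if "i \<in> {1..n}" for i
    using wexpo_Y[OF u that] wexpo_Y[OF v that] len by simp
  show "(\<Sum>i\<in>{1..k}. int (lookup (wexpo u) (Xc i))) = (\<Sum>i\<in>{1..k}. int (lookup (wexpo v) (Xc i)))"
    if "k \<le> n" for k
    using wexpo_profile[OF u that] wexpo_profile[OF v that] prof[OF that] by simp
qed

text \<open>The sum of the two paths splits into a chain \<open>c, d\<close> with the same leading
  exponent. Sums of squares drop unless \<open>a\<close> and \<open>b\<close> are balanced
  everywhere. In that case the odd sets of \<open>c\<close> and \<open>d\<close> are the
  intersection and the union of those of \<open>a\<close> and \<open>b\<close>; incomparability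
  excludes inclusions, so the next key drops.\<close>

lemma pair_replace:
  assumes ab: "a \<in> V" "b \<in> V" and inc: "\<not> below a b" "\<not> below b a"
  obtains c d where "c \<in> V" "d \<in> V" "wexpo [c, d] = wexpo [a, b]"
    "mless (word_mon [c, d]) (word_mon [a, b])"
proof -
  have "path n w (1 + 1) (\<lambda>k. top_count a k + top_count b k)"
    by (intro path_add top_count_path w_even ab)
  then obtain u where u: "std u" "length u = 1 + 1"
    and prof: "\<And>k. k \<le> n \<Longrightarrow> profile u k = top_count a k + top_count b k"
    using path_word by blast
  obtain c d where cd: "u = [c, d]" using u(2) by (auto simp: length_Suc_conv)
  have V: "c \<in> V" "d \<in> V" and "below c d" using u by (auto simp: std_def cd)
  then have fence: "fence (top_count c k) (top_count d k)" if "k \<le> n" for k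
    using that by (simp add: below_def)
  have sum: "top_count c k + top_count d k = top_count a k + top_count b k" if "k \<le> n" for k
    using prof[OF that] by (simp add: cd profile_def)
  have eq: "wexpo [c, d] = wexpo [a, b]"
    using V ab sum by (intro profile_wexpo) (auto simp: profile_def)
  let ?Q = "\<lambda>\<tau>. \<Sum>k\<le>n. (top_count \<tau> k)\<^sup>2"
  have Q: "mkey (n + 1) (word_mon [x, y]) = ?Q x + ?Q y" for x y
    unfolding mkey_def mon_sum_word_mon by simp
  have le: "(top_count c k)\<^sup>2 + (top_count d k)\<^sup>2 \<le> (top_count a k)\<^sup>2 + (top_count b k)\<^sup>2" if "k \<le> n" for k
    using fence_sum_squares(1)[OF fence sum] that by blast
  have Q_le: "?Q c + ?Q d \<le> ?Q a + ?Q b"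
    unfolding sum.distrib[symmetric] by (intro sum_mono le) simp
  have "mless (word_mon [c, d]) (word_mon [a, b])"
  proof (rule mless_tie_break)
    show "mkey (n + 1) (word_mon [c, d]) < mkey (n + 1) (word_mon [a, b]) \<or>
      mkey (n + 1) (word_mon [c, d]) = mkey (n + 1) (word_mon [a, b]) \<and>
      mkey (n + 2) (word_mon [c, d]) < mkey (n + 2) (word_mon [a, b])"
    proof (cases "?Q c + ?Q d < ?Q a + ?Q b")
      case True
      then show ?thesis by (simp only: Q simp_thms)
    next
      case False
      then have Q_eq: "?Q c + ?Q d = ?Q a + ?Q b" using Q_le by simp
      have "(top_count c k)\<^sup>2 + (top_count d k)\<^sup>2 = (top_count a k)\<^sup>2 + (top_count b k)\<^sup>2" if "k \<le> n" for k
        using sum_mono_inv[of "\<lambda>k. (top_count c k)\<^sup>2 + (top_count d k)\<^sup>2" "{..n}"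
            "\<lambda>k. (top_count a k)\<^sup>2 + (top_count b k)\<^sup>2" k] Q_eq le that
        by (simp add: sum.distrib)
      then have diff: "\<bar>top_count a k - top_count b k\<bar> \<le> 1" if "k \<le> n" for k
        using fence_sum_squares(2)[OF fence sum] that by blast
      have odd: "odd (top_count d k) \<longleftrightarrow> odd (top_count a k) \<or> odd (top_count b k)"
        "odd (top_count c k) \<longleftrightarrow> odd (top_count a k) \<and> odd (top_count b k)" if "k \<le> n" for k
        using fence_parity[OF fence[OF that] sum[OF that] diff[OF that]] .
      have na: "\<not> oddset a \<subseteq> oddset b"
      proof
        assume "oddset a \<subseteq> oddset b"
        then have "fence (top_count a k) (top_count b k)" if "k \<le> n" for k
          using that by (intro fence_if_odd diff) (auto simp: oddset_def)
        then show False using inc(1) by (simp add: below_def)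
      qed
      have nb: "\<not> oddset b \<subseteq> oddset a"
      proof
        assume "oddset b \<subseteq> oddset a"
        moreover have "\<bar>top_count b k - top_count a k\<bar> \<le> 1" if "k \<le> n" for k
          using diff[OF that] by linarith
        ultimately have "fence (top_count b k) (top_count a k)" if "k \<le> n" for k
          using that by (intro fence_if_odd) (auto simp: oddset_def)
        then show False using inc(2) by (simp add: below_def)
      qed
      have d: "oddset d = oddset a \<union> oddset b" and c: "oddset c = oddset a \<inter> oddset b"
        using odd by (auto simp: oddset_def)
      have fin: "finite (oddset a)" "finite (oddset b)" by (simp_all add: oddset_def)
      have "card (oddset a) < card (oddset d)" "card (oddset b) < card (oddset d)"
        unfolding d by (rule psubset_card_mono; use na nb fin in blast)+
      moreover have "card (oddset a) + card (oddset b) = card (oddset d) + card (oddset c)"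
        unfolding c d by (intro card_Un_Int fin)
      ultimately have "(int (card (oddset a)))\<^sup>2 + (int (card (oddset b)))\<^sup>2 <
          (int (card (oddset d)))\<^sup>2 + (int (card (oddset c)))\<^sup>2"
        by (intro sum_squares_union_inter) linarith+
      then have "mkey (n + 2) (word_mon [c, d]) < mkey (n + 2) (word_mon [a, b])"
        unfolding mkey_def mon_sum_word_mon by simp
      then show ?thesis using Q_eq by (simp only: Q simp_thms)
    qed
  qed (use V ab eq in auto)
  then show ?thesis using that V eq by blast
qed

text \<open>Strictly monotone along \<open>below\<close> on \<open>V\<close>; sorting by it arranges
  pairwise comparable letters into a chain.\<close>

definition rank :: "tableau \<Rightarrow> nat" where "rank \<tau> = card (oddset \<tau>)"

lemma below_oddset: "below \<sigma> \<tau> \<Longrightarrow> oddset \<sigma> \<subseteq> oddset \<tau>"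
  by (auto simp: below_def oddset_def fence_def)

lemma below_if_rank_le:
  assumes "\<sigma> \<in> V" "\<tau> \<in> V" "below \<sigma> \<tau> \<or> below \<tau> \<sigma>" "rank \<sigma> \<le> rank \<tau>"
  shows "below \<sigma> \<tau>"
proof (rule ccontr)
  assume "\<not> below \<sigma> \<tau>"
  then have b: "below \<tau> \<sigma>" using assms by blast
  have "finite (oddset \<sigma>)" by (simp add: oddset_def)
  then have "oddset \<tau> = oddset \<sigma>"
    using below_oddset[OF b] assms(4) unfolding rank_def by (intro card_seteq) auto
  then have odd: "odd (top_count \<tau> k) \<longleftrightarrow> odd (top_count \<sigma> k)" if "k \<le> n" for k
    using that by (auto simp: oddset_def set_eq_iff)
  have "top_count \<tau> k = top_count \<sigma> k" if "k \<le> n" for k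
  proof -
    have "fence (top_count \<tau> k) (top_count \<sigma> k)" using b that by (simp add: below_def)
    then show ?thesis using odd[OF that] by (auto simp: fence_def)
  qed
  then have "\<tau> = \<sigma>" using top_count_inj assms(1,2) by blast
  then show False using \<open>\<not> below \<sigma> \<tau>\<close> below_refl by simp
qed

lemma chain_std:
  assumes "set u \<subseteq> V" "\<And>a b. a \<in> set u \<Longrightarrow> b \<in> set u \<Longrightarrow> below a b \<or> below b a"
  shows "std (sort_key rank u)"
proof -
  have "sorted_wrt (\<lambda>a b. rank a \<le> rank b) (sort_key rank u)"
    using sorted_sort_key[of rank u] unfolding sorted_wrt_map .
  moreover have "below a b" if "a \<in> set u" "b \<in> set u" "rank a \<le> rank b" for a b
    using that assms below_if_rank_le[of a b] by blast
  ultimately have "sorted_wrt below (sort_key rank u)"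
    using sorted_wrt_mono_rel[of "sort_key rank u" "\<lambda>a b. rank a \<le> rank b" below] by simp
  then show ?thesis using assms(1) by (simp add: std_sorted)
qed

lemma std_comparable:
  assumes "std u" "a \<in> set u" "b \<in> set u"
  shows "below a b \<or> below b a"
proof -
  obtain i j where ij: "i < length u" "a = u ! i" "j < length u" "b = u ! j"
    using assms(2,3) by (metis in_set_conv_nth)
  have "sorted_wrt below u" using assms(1) by (simp add: std_sorted)
  then show ?thesis
    using ij by (cases i j rule: linorder_cases) (auto simp: below_refl sorted_wrt_iff_nth_less)
qed

lemma word_mon_V: "set u \<subseteq> V \<longleftrightarrow> word_mon u \<in> monomials V"
  by (simp add: monomials_def keys_word_mon)

lemma wexpo_mset: "mset u = mset v \<Longrightarrow> wexpo u = wexpo v"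
  unfolding wexpo_def by (metis mset_map sum_mset_sum_list)

text \<open>Pairwise comparable letters can be sorted into a standard word, so the failure is
  visible on two letters. This is why the initial ideal is generated by quadratic monomials.\<close>

lemma nonstandard_pair:
  assumes u: "set u \<subseteq> V" and "\<not> standard (word_mon u)"
  obtains a b v where "a \<in> V" "b \<in> V" "\<not> below a b" "\<not> below b a" "mset u = mset (a # b # v)" "set v \<subseteq> V"
proof -
  have "\<not> std (sort_key rank u)"
    using assms(2) word_mon_mset[of u "sort_key rank u"] by (auto simp: standard_def)
  then obtain a b where ab: "a \<in> set u" "b \<in> set u" "\<not> below a b" "\<not> below b a"
    using chain_std[OF u] by blast
  then have "a \<noteq> b" using below_refl by blast
  obtain u1 u2 where u12: "u = u1 @ a # u2" using split_list[OF ab(1)] by blast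
  then have "b \<in> set (u1 @ u2)" using ab(2) \<open>a \<noteq> b\<close> by auto
  then obtain v1 v2 where v12: "u1 @ u2 = v1 @ b # v2" using split_list by fast
  have "mset u = add_mset a (mset (u1 @ u2))" by (simp add: u12)
  also have "\<dots> = mset (a # b # v1 @ v2)" by (simp add: v12)
  finally have "mset u = mset (a # b # v1 @ v2)" .
  moreover have "set (v1 @ v2) \<subseteq> set (u1 @ u2)" by (auto simp: v12)
  then have "set (v1 @ v2) \<subseteq> V" using u u12 by auto
  ultimately show ?thesis using that[of a b "v1 @ v2"] ab u by blast
qed

text \<open>Replacing an incomparable pair keeps the leading exponent and lowers the monomial. The
  descent ends at a standard monomial, which uniqueness identifies with that of
  \<open>v\<close>.\<close>

lemma std_minimal:
  assumes v: "std v"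
  shows "set u \<subseteq> V \<Longrightarrow> wexpo u = wexpo v \<Longrightarrow> word_mon v = word_mon u \<or> mless (word_mon v) (word_mon u)"
proof (induction "word_mon u" arbitrary: u rule: wf_induct_rule[OF wf_mless])
  case 1
  note u = "1.prems"
  show ?case
  proof (cases "standard (word_mon u)")
    case True
    then obtain u' where u': "std u'" "word_mon u = word_mon u'" by (auto simp: standard_def)
    then have "wexpo u' = wexpo u" by (metis mon_sum_word_mon wexpo_def)
    then have "u' = v" using std_unique u' v u by simp
    then show ?thesis using u' by simp
  next
    case False
    obtain a b x where ab: "a \<in> V" "b \<in> V" "\<not> below a b" "\<not> below b a"
      and x: "mset u = mset (a # b # x)" "set x \<subseteq> V"
      using nonstandard_pair[OF u(1) False] by blast
    obtain c d where cd: "c \<in> V" "d \<in> V" "wexpo [c, d] = wexpo [a, b]"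
      "mless (word_mon [c, d]) (word_mon [a, b])"
      using pair_replace[OF ab] by blast
    let ?u = "[c, d] @ x"
    have uV: "set ?u \<subseteq> V" using cd x by simp
    have "wexpo ?u = wexpo u" using cd(3) wexpo_mset[OF x(1)] by (simp add: add.assoc[symmetric])
    then have eq: "wexpo ?u = wexpo v" using u(2) by simp
    have less: "mless (word_mon ?u) (word_mon u)"
    proof -
      have "word_mon u = word_mon ([a, b] @ x)" using word_mon_mset[OF x(1)] by simp
      then show ?thesis
        using mless.add_right[OF cd(4), of "word_mon x"] by (simp only: word_mon_append)
    qed
    have "(word_mon ?u, word_mon u) \<in> {(a, b). a \<in> monomials V \<and> b \<in> monomials V \<and> mless a b}"
      using uV u(1) less word_mon_V by blast
    from "1.hyps"[OF this uV eq] have "word_mon v = word_mon ?u \<or> mless (word_mon v) (word_mon ?u)" .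
    then show ?thesis using less mless.trans[of "word_mon v"] by auto
  qed
qed

text \<open>A standard word produced by subduction has a smaller leading exponent, which the early
  keys of \<open>mless\<close> see, or the same one, and then \<open>std_minimal\<close>
  applies.\<close>

lemma normal_form:
  assumes u: "set u \<subseteq> V"
  shows "\<exists>p. evaluate tableau_section p = (sec u :: (coord, 'k::field) mpoly) \<and>
    (\<forall>m\<in>keys p. \<exists>v. m = word_mon v \<and> std v \<and> length v = length u \<and> (m = word_mon u \<or> mless m (word_mon u)))"
proof -
  obtain p where p: "evaluate tableau_section p = (sec u :: (coord, 'k) mpoly)"
    and keys: "\<And>m. m \<in> keys p \<Longrightarrow> \<exists>v. m = word_mon v \<and> std v \<and> length v = length u \<and>
      (\<exists>l\<in>keys (sec u :: (coord, 'k) mpoly). wexpo v = l \<or> xless n (wexpo v) l)"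
    using spanning[OF sec_Rw_piece[OF u], where 'k = 'k] by blast
  have "\<exists>v. m = word_mon v \<and> std v \<and> length v = length u \<and> (m = word_mon u \<or> mless m (word_mon u))"
    if m: "m \<in> keys p" for m
  proof -
    obtain v l where v: "m = word_mon v" "std v" "length v = length u"
      and l: "l \<in> keys (sec u :: (coord, 'k) mpoly)" "wexpo v = l \<or> xless n (wexpo v) l"
      using keys[OF m] by blast
    have "l = wexpo u \<or> xless n l (wexpo u)"
      using sec_monic[OF u, where 'k = 'k] l(1) by (auto simp: xless.monic_at_def)
    then have "wexpo u = wexpo v \<or> xless n (wexpo v) (wexpo u)" using l(2) xless.trans[of n "wexpo v" l "wexpo u"] by auto
    then have "m = word_mon u \<or> mless m (word_mon u)"
      using std_minimal[OF v(2) u] mless_if_xless[OF v(3)] v(1) by blast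
    then show ?thesis using v by blast
  qed
  then show ?thesis using p by blast
qed


section \<open>The Groebner basis\<close>

lemma keys_sum_le: "m \<in> keys (sum f I) \<Longrightarrow> \<exists>i\<in>I. m \<in> keys (f i)"
  using Poly_Mapping.keys_sum[of f I] by blast

lemma lead_monomI:
  assumes "m \<in> keys f" "\<And>m'. m' \<in> keys f \<Longrightarrow> (m', m) \<in> mord"
  shows "lead_monom mord f = m"
  unfolding lead_monom_def
proof (rule the_equality)
  fix m' assume "m' \<in> keys f \<and> (\<forall>m''\<in>keys f. (m'', m') \<in> mord)"
  then have "(m, m') \<in> mord" "(m', m) \<in> mord" using assms by blast+
  then show "m' = m" using mless.trans[of m m' m] mless.irrefl by (auto simp: mord_def)
qed (use assms in blast)

lemma lead_monom_props:
  assumes "f \<in> polys V" "f \<noteq> 0"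
  shows "lead_monom mord f \<in> keys f" "m \<in> keys f \<Longrightarrow> (m, lead_monom mord f) \<in> mord"
proof -
  obtain l where l: "l \<in> keys f" "\<And>m. m \<in> keys f \<Longrightarrow> \<not> mless l m"
    using mless.maximal_key[of "keys f"] assms(2) by (metis finite_keys keys_eq_empty)
  have mon: "m \<in> monomials V" if "m \<in> keys f" for m using assms(1) that by (auto simp: polys_def)
  have "(m, l) \<in> mord" if "m \<in> keys f" for m
    using mless_total[OF mon[OF that] mon[OF l(1)]] l mon that by (auto simp: mord_def)
  then have "lead_monom mord f = l" using l(1) by (intro lead_monomI)
  then show "lead_monom mord f \<in> keys f" "m \<in> keys f \<Longrightarrow> (m, lead_monom mord f) \<in> mord"
    using l(1) \<open>\<And>m. m \<in> keys f \<Longrightarrow> (m, l) \<in> mord\<close> by simp_all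
qed

text \<open>Replacing every monomial of \<open>f\<close> by its normal form gives a standard
  combination in the kernel, hence 0. A standard leading monomial would survive: it is its own
  normal form, and the other monomials only produce smaller ones.\<close>

lemma lead_monom_nonstandard:
  fixes f :: "(tableau, 'k::field) mpoly"
  assumes f: "f \<in> polys V" "f \<noteq> 0" and zero: "evaluate tableau_section f = 0"
  shows "\<not> standard (lead_monom mord f)"
proof
  define l where "l = lead_monom mord f"
  assume "standard (lead_monom mord f)"
  then have l_std: "standard l" by (simp add: l_def)
  have "\<exists>p. evaluate tableau_section p = (mon_eval tableau_section m :: (coord, 'k) mpoly) \<and>
      (\<forall>m'\<in>keys p. standard m' \<and> (m' = m \<or> mless m' m))" if m: "m \<in> keys f" for m
  proof -
    obtain u where u: "m = word_mon u" by (rule monomial_word)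
    have "m \<in> monomials V" using f m by (auto simp: polys_def)
    then have uV: "set u \<subseteq> V" by (simp add: word_mon_V u)
    obtain p where "evaluate tableau_section p = (sec u :: (coord, 'k) mpoly)"
      "\<And>m'. m' \<in> keys p \<Longrightarrow> \<exists>v. m' = word_mon v \<and> std v \<and> length v = length u \<and>
        (m' = word_mon u \<or> mless m' (word_mon u))"
      using normal_form[OF uV, where 'k = 'k] by blast
    then show ?thesis unfolding u sec_eq_mon_eval standard_def by (intro exI[of _ p]) blast
  qed
  then obtain P where P: "\<And>m. m \<in> keys f \<Longrightarrow> evaluate tableau_section (P m) = (mon_eval tableau_section m :: (coord, 'k) mpoly)"
    "\<And>m m'. m \<in> keys f \<Longrightarrow> m' \<in> keys (P m) \<Longrightarrow> standard m' \<and> (m' = m \<or> mless m' m)" by metis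
  have l: "l \<in> keys f" using lead_monom_props(1)[OF f] by (simp add: l_def)
  define q where "q = (\<Sum>m\<in>keys f. single 0 (lookup f m) * P m)"
  have keys_scale: "keys (single 0 c * p) \<subseteq> keys p" for c and p :: "(tableau, 'k) mpoly"
    by (auto simp: in_keys_iff lookup_single_zero_mult)
  have "evaluate tableau_section q = 0"
    using zero P(1) unfolding q_def evaluate_sum evaluate_mult evaluate_single
    by (simp add: evaluate_def)
  moreover have "standard m" if "m \<in> keys q" for m
  proof -
    obtain m' where "m' \<in> keys f" "m \<in> keys (single 0 (lookup f m') * P m')"
      using \<open>m \<in> keys q\<close> keys_sum_le[of m "\<lambda>m. single 0 (lookup f m) * P m" "keys f"]
      by (auto simp: q_def)
    then show ?thesis using P(2)[of m' m] keys_scale by blast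
  qed
  ultimately have "q = 0" by (intro linear_independence)
  have "P l - single l 1 = 0"
  proof (rule linear_independence)
    show "standard m" if "m \<in> keys (P l - single l 1)" for m
      using that keys_diff[of "P l" "single l 1"] P(2)[OF l] l_std by auto
    show "evaluate tableau_section (P l - single l 1) = 0"
      by (simp add: evaluate_diff evaluate_single P(1)[OF l])
  qed
  then have Pl: "lookup (P l) l = 1" by simp
  have "lookup q l = (\<Sum>m\<in>keys f. lookup f m * lookup (P m) l)"
    by (simp add: q_def lookup_sum lookup_single_zero_mult)
  also have "\<dots> = (\<Sum>m\<in>keys f. if m = l then lookup f l else 0)"
  proof (intro sum.cong refl)
    fix m assume m: "m \<in> keys f"
    have "lookup (P m) l = 0" if "m \<noteq> l"
    proof (rule ccontr)
      assume "lookup (P m) l \<noteq> 0"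
      then have "mless l m" using P(2)[OF m, of l] that by (auto simp: in_keys_iff)
      moreover have "mless m l" using lead_monom_props(2)[OF f m] that by (auto simp: mord_def l_def)
      ultimately show False using mless.trans mless.irrefl by blast
    qed
    then show "lookup f m * lookup (P m) l = (if m = l then lookup f l else 0)" using Pl by simp
  qed
  also have "\<dots> \<noteq> 0" using l by (simp add: in_keys_iff)
  finally show False using \<open>q = 0\<close> by simp
qed

lemma polys_closed:
  "1 \<in> polys U" "p \<in> polys U \<Longrightarrow> q \<in> polys U \<Longrightarrow> p + q \<in> polys U"
  "p \<in> polys U \<Longrightarrow> q \<in> polys U \<Longrightarrow> p * q \<in> polys U" "p \<in> polys U \<Longrightarrow> - p \<in> polys U"
proof -
  show "1 \<in> polys U" by (simp add: polys_def monomials_def)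
  show "p + q \<in> polys U" if "p \<in> polys U" "q \<in> polys U"
    using that Poly_Mapping.keys_add[of p q] by (auto simp: polys_def)
  show "p * q \<in> polys U" if "p \<in> polys U" "q \<in> polys U"
    using that by (auto simp: polys_def elim!: keys_multE intro: monomials_add)
  show "p \<in> polys U \<Longrightarrow> - p \<in> polys U" by (simp add: polys_def)
qed

lemma polys_single: "m \<in> monomials U \<Longrightarrow> single m c \<in> polys U"
  by (simp add: polys_def)

lemma ring_mpoly: "ring (mpoly_ring U)"
  unfolding mpoly_ring_def
  by (intro cring.axioms(1) cring_of_type_algebra_carrier polys_closed)

lemma relation_ideal_iff:
  "f \<in> relation_ideal n w \<longleftrightarrow> f \<in> polys V \<and> evaluate tableau_section f = 0"
  by (simp add: relation_ideal_def a_kernel_def' mpoly_ring_def Rw_def poly_subst_eq_evaluate)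

definition normal :: "tableau list \<Rightarrow> (tableau, 'k::field) mpoly"
  where "normal u = (SOME p. evaluate tableau_section p = (sec u :: (coord, 'k) mpoly) \<and>
    (\<forall>m\<in>keys p. \<exists>v. m = word_mon v \<and> std v \<and> length v = length u \<and> (m = word_mon u \<or> mless m (word_mon u))))"

lemma normal_props:
  assumes "set u \<subseteq> V"
  shows "evaluate tableau_section (normal u) = (sec u :: (coord, 'k::field) mpoly)"
    and "m \<in> keys (normal u :: (tableau, 'k) mpoly) \<Longrightarrow>
      \<exists>v. m = word_mon v \<and> std v \<and> length v = length u \<and> (m = word_mon u \<or> mless m (word_mon u))"
  using someI_ex[OF normal_form[OF assms, where 'k = 'k], folded normal_def] by blast+

definition relation :: "tableau \<Rightarrow> tableau \<Rightarrow> (tableau, 'k::field) mpoly"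
  where "relation a b = single (word_mon [a, b]) 1 - normal [a, b]"

definition incomparable :: "(tableau \<times> tableau) set"
  where "incomparable = {(a, b). a \<in> V \<and> b \<in> V \<and> \<not> below a b \<and> \<not> below b a}"

lemma relation_props:
  assumes "(a, b) \<in> incomparable"
  shows "(relation a b :: (tableau, 'k::field) mpoly) \<in> relation_ideal n w"
    and "(relation a b :: (tableau, 'k) mpoly) \<noteq> 0"
    and "lead_monom mord (relation a b :: (tableau, 'k) mpoly) = word_mon [a, b]"
    and "quadratic (relation a b :: (tableau, 'k) mpoly)"
proof -
  let ?m = "word_mon [a, b]" and ?g = "relation a b :: (tableau, 'k) mpoly"
  have ab: "a \<in> V" "b \<in> V" "\<not> below a b" "\<not> below b a" using assms by (auto simp: incomparable_def)
  then have V: "set [a, b] \<subseteq> V" by simp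
  note NF = normal_props[OF V, where 'k = 'k]
  have m: "m = ?m \<or> (\<exists>v. m = word_mon v \<and> set v \<subseteq> V \<and> length v = 2 \<and> mless m ?m)"
    if "m \<in> keys ?g" for m
  proof -
    have "m \<in> keys (single ?m (1 :: 'k)) \<or> m \<in> keys (normal [a, b] :: (tableau, 'k) mpoly)"
      using that keys_diff[of "single ?m (1 :: 'k)" "normal [a, b]"] unfolding relation_def by blast
    then show ?thesis
    proof
      assume "m \<in> keys (normal [a, b] :: (tableau, 'k) mpoly)"
      from NF(2)[OF this] show ?thesis unfolding std_def by auto
    qed simp
  qed
  \<comment> \<open>Letters of a standard word are pairwise comparable, so the product of an
    incomparable pair cannot be a term of its own normal form and does not cancel.\<close>
  have "?m \<notin> keys (normal [a, b] :: (tableau, 'k) mpoly)"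
  proof
    assume "?m \<in> keys (normal [a, b] :: (tableau, 'k) mpoly)"
    then obtain v where v: "?m = word_mon v" "std v" using NF(2) by blast
    then have "set v = {a, b}" using keys_word_mon[of v] keys_word_mon[of "[a, b]"] by simp
    then show False using std_comparable[OF v(2), of a b] ab by simp
  qed
  then have "lookup ?g ?m = 1" by (simp add: relation_def lookup_minus in_keys_iff del: word_mon_simps)
  then have lead: "?m \<in> keys ?g" by (simp add: in_keys_iff del: word_mon_simps)
  then show "?g \<noteq> 0" by auto
  have mon: "m \<in> monomials V" if "m \<in> keys ?g" for m using m[OF that] V word_mon_V by blast
  then have "?g \<in> polys V" by (auto simp: polys_def)
  then show "?g \<in> relation_ideal n w"
    using NF(1) unfolding relation_ideal_iff
    by (simp add: relation_def evaluate_diff evaluate_single sec_eq_mon_eval del: word_mon_simps)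
  show "lead_monom mord ?g = ?m"
    using lead m mon by (intro lead_monomI) (auto simp: mord_def simp del: word_mon_simps)
  have "total_degree (word_mon v) = length v" for v :: "tableau list"
    by (simp add: total_degree_eq mon_sum_word_mon sum_list_triv)
  then show "quadratic ?g"
    using m \<open>?g \<noteq> 0\<close> unfolding quadratic_def by (metis length_Cons list.size(3) numeral_2_eq_2)
qed

theorem squarefree_quadratic_groebner_basis:
  fixes I :: "(tableau, 'k::field) mpoly set"
  defines "I \<equiv> relation_ideal n w"
  obtains G where "groebner_basis V mord I G"
    "\<And>g. g \<in> G \<Longrightarrow> quadratic g \<and> squarefree_monomial (lead_monom mord g)"
proof -
  define G where "G = (\<lambda>(a, b). relation a b :: (tableau, 'k) mpoly) ` incomparable"
  let ?R = "mpoly_ring V :: (tableau, 'k) mpoly ring"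
  let ?lead = "\<lambda>f. single (lead_monom mord f) (1 :: 'k)"
  interpret R: ring ?R by (rule ring_mpoly)
  have carrier: "carrier ?R = polys V" by (simp add: mpoly_ring_def)
  have "incomparable \<subseteq> V \<times> V" by (auto simp: incomparable_def)
  then have "finite incomparable"
    by (rule finite_subset) (intro finite_cartesian_product finite_tableaux)
  then have "finite G" by (simp add: G_def)
  have GE: "\<exists>a b. (a, b) \<in> incomparable \<and> g = relation a b" if "g \<in> G" for g
    using that by (auto simp: G_def)
  have GI: "G \<subseteq> I - {0}"
  proof
    fix g assume "g \<in> G"
    then obtain a b where "(a, b) \<in> incomparable" "g = relation a b" using GE by blast
    then show "g \<in> I - {0}" using relation_props(1,2)[of a b, where 'k = 'k] by (simp add: I_def)
  qed
  have lead_mon: "lead_monom mord f \<in> monomials V" if "f \<in> I - {0}" for f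
    using lead_monom_props(1)[of f] that by (auto simp: I_def relation_ideal_iff polys_def)
  then have sub: "?lead ` (I - {0}) \<subseteq> carrier ?R" by (auto simp: carrier intro!: polys_single)
  have "initial_ideal V mord G \<subseteq> initial_ideal V mord I"
    unfolding initial_ideal_def
  proof (rule R.genideal_minimal)
    show "ideal (Idl\<^bsub>?R\<^esub> ?lead ` (I - {0})) ?R" by (rule R.genideal_ideal[OF sub])
    show "?lead ` (G - {0}) \<subseteq> Idl\<^bsub>?R\<^esub> ?lead ` (I - {0})"
      using GI R.genideal_self[OF sub] by blast
  qed
  moreover have "initial_ideal V mord I \<subseteq> initial_ideal V mord G"
    unfolding initial_ideal_def
  proof (rule R.genideal_minimal)
    have subG: "?lead ` (G - {0}) \<subseteq> carrier ?R" using GI sub by blast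
    interpret J: ideal "Idl\<^bsub>?R\<^esub> ?lead ` (G - {0})" ?R by (rule R.genideal_ideal[OF subG])
    show "ideal (Idl\<^bsub>?R\<^esub> ?lead ` (G - {0})) ?R" by (rule J.is_ideal)
    show "?lead ` (I - {0}) \<subseteq> Idl\<^bsub>?R\<^esub> ?lead ` (G - {0})"
    proof
      fix x assume "x \<in> ?lead ` (I - {0})"
      then obtain f where f: "f \<in> I" "f \<noteq> 0" "x = ?lead f" by blast
      obtain u where u: "lead_monom mord f = word_mon u" by (rule monomial_word)
      have uV: "set u \<subseteq> V" using lead_mon[of f] f by (simp add: word_mon_V u)
      \<comment> \<open>Hence the leading monomial is divisible by an incomparable pair, the leading
        monomial of a member of \<open>G\<close>.\<close>
      have "\<not> standard (word_mon u)"
        using lead_monom_nonstandard[of f] f by (simp add: u I_def relation_ideal_iff)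
      then obtain a b v where ab: "(a, b) \<in> incomparable" and v: "mset u = mset (a # b # v)" "set v \<subseteq> V"
        using nonstandard_pair[OF uV] unfolding incomparable_def by (metis (mono_tags, lifting) case_prodI mem_Collect_eq)
      have "word_mon u = word_mon v + word_mon [a, b]"
        using word_mon_mset[OF v(1)] by (simp add: add_ac)
      then have "x = single (word_mon v) 1 \<otimes>\<^bsub>?R\<^esub> single (word_mon [a, b]) 1"
        by (simp add: f u mpoly_ring_def mult_single)
      moreover have "single (word_mon [a, b]) 1 \<in> ?lead ` (G - {0})"
      proof (rule image_eqI)
        show "single (word_mon [a, b]) 1 = ?lead (relation a b)"
          by (simp only: relation_props(3)[OF ab])
        show "relation a b \<in> G - {0}"
          using relation_props(2)[OF ab, where 'k = 'k] ab unfolding G_def by force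
      qed
      then have "single (word_mon [a, b]) 1 \<in> Idl\<^bsub>?R\<^esub> ?lead ` (G - {0})"
        using R.genideal_self[OF subG] by blast
      moreover have "single (word_mon v) 1 \<in> carrier ?R"
        using v(2) by (simp add: carrier polys_single word_mon_V)
      ultimately show "x \<in> Idl\<^bsub>?R\<^esub> ?lead ` (G - {0})" using J.I_l_closed by simp
    qed
  qed
  ultimately have "groebner_basis V mord I G"
    using \<open>finite G\<close> GI by (simp add: groebner_basis_def)
  moreover have "quadratic g \<and> squarefree_monomial (lead_monom mord g)" if "g \<in> G" for g
  proof -
    obtain a b where ab: "(a, b) \<in> incomparable" "g = relation a b" using GE[OF \<open>g \<in> G\<close>] by blast
    \<comment> \<open>Squarefreeness is reflexivity of \<open>below\<close>: no tableau is
      incomparable to itself.\<close>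
    then have "a \<noteq> b" using below_refl[of a] by (auto simp: incomparable_def)
    then have "squarefree_monomial (word_mon [a, b])"
      by (auto simp: squarefree_monomial_def lookup_add lookup_single when_def)
    then show ?thesis using relation_props(3,4)[OF ab(1), where 'k = 'k] ab(2) by simp
  qed
  ultimately show ?thesis by (rule that)
qed

end


section \<open>The Koszul property\<close>

text \<open>Lets the mere rearrangement of a word into sorted order count as a descent in the word
  order of the PBW algebra.\<close>

lemma lex_sort: "sort xs = xs \<or> (sort xs, xs) \<in> lex less_than" for xs :: "nat list"
proof (induction xs)
  case (Cons x xs)
  show ?case
  proof (cases "\<forall>y\<in>set xs. x \<le> y")
    case True
    then have "sort (x # xs) = x # sort xs" by (simp add: insort_is_Cons)
    then show ?thesis using Cons.IH by auto
  next
    case False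
    then obtain z where z: "z \<in> set xs" "z < x" by auto
    obtain y ys where y: "sort (x # xs) = y # ys" by (metis length_0_conv length_sort list.exhaust list.discI)
    have "sorted (y # ys)" using y by (metis sorted_sort)
    moreover have "z \<in> set (y # ys)" using y z by (metis list.set_intros(2) set_sort)
    ultimately have "y < x" using z by auto
    moreover have "length ys = length xs" using y by (metis length_Cons length_sort nat.inject)
    ultimately show ?thesis unfolding y by simp
  qed
qed simp

lemma sort_key_id: "sorted (map f xs) \<Longrightarrow> sort_key f xs = xs"
  by (induction xs) (simp_all add: insort_is_Cons)

context weighted_points
begin

definition carrier_Rw :: "(coord, 'k::field) mpoly set"
  where "carrier_Rw = {(\<Sum>d\<le>N. f d) |N f. \<forall>d. f d \<in> Rw_piece n w d}"

text \<open>\<open>mless\<close> does not separate rearrangements of a word, yet an unsorted word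
  has to straighten into a smaller one; the lexicographic comparison of ranks decides these
  cases.\<close>

definition wless :: "tableau list \<Rightarrow> tableau list \<Rightarrow> bool"
  where "wless u v \<longleftrightarrow> length u = length v \<and> (mless (word_mon u) (word_mon v) \<or>
    word_mon u = word_mon v \<and> (map rank u, map rank v) \<in> lex less_than)"

definition nf :: "(coord, 'k::field) mpoly \<Rightarrow> (tableau, 'k) mpoly"
  where "nf r = (THE p. (\<forall>m\<in>keys p. standard m) \<and> evaluate tableau_section p = r)"

text \<open>\<open>word_mon\<close> forgets the order of letters, so without the test for
  \<open>std\<close> every rearrangement of a standard word would receive its coefficient.\<close>

definition cf :: "(coord, 'k::field) mpoly \<Rightarrow> tableau list \<Rightarrow> 'k"
  where "cf r u = (if std u then lookup (nf r) (word_mon u) else 0)"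

lemma piece_carrier: "f \<in> Rw_piece n w d \<Longrightarrow> f \<in> carrier_Rw"
proof -
  assume f: "f \<in> Rw_piece n w d"
  have "f = (\<Sum>e\<le>d. if e = d then f else 0)" by simp
  moreover have "\<forall>e. (if e = d then f else 0) \<in> Rw_piece n w e" using f by (simp add: Rw_piece_zero)
  ultimately show ?thesis unfolding carrier_Rw_def by blast
qed

lemma carrier_add: "r \<in> carrier_Rw \<Longrightarrow> s \<in> carrier_Rw \<Longrightarrow> r + s \<in> carrier_Rw"
proof -
  assume "r \<in> carrier_Rw" "s \<in> carrier_Rw"
  then obtain M f N g where r: "r = (\<Sum>d\<le>M. f d)" "\<And>d. f d \<in> Rw_piece n w d"
    and s: "s = (\<Sum>d\<le>N. g d)" "\<And>d. g d \<in> Rw_piece n w d"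
    unfolding carrier_Rw_def by blast
  define h where "h d = (if d \<le> M then f d else 0) + (if d \<le> N then g d else 0)" for d
  have "r = (\<Sum>d\<le>max M N. if d \<le> M then f d else 0)"
    unfolding r by (intro sum.mono_neutral_cong_left) auto
  moreover have "s = (\<Sum>d\<le>max M N. if d \<le> N then g d else 0)"
    unfolding s by (intro sum.mono_neutral_cong_left) auto
  ultimately have "r + s = (\<Sum>d\<le>max M N. h d)" by (simp add: h_def sum.distrib)
  moreover have "\<forall>d. h d \<in> Rw_piece n w d" using r s by (simp add: h_def Rw_piece_add Rw_piece_zero)
  ultimately show ?thesis unfolding carrier_Rw_def by blast
qed

lemma carrier_sum: "(\<And>i. i \<in> I \<Longrightarrow> f i \<in> carrier_Rw) \<Longrightarrow> sum f I \<in> carrier_Rw"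
  by (induction I rule: infinite_finite_induct) (simp_all add: carrier_add piece_carrier[OF Rw_piece_zero])

lemma carrier_mult: "r \<in> carrier_Rw \<Longrightarrow> s \<in> carrier_Rw \<Longrightarrow> r * s \<in> carrier_Rw"
proof -
  assume "r \<in> carrier_Rw" "s \<in> carrier_Rw"
  then obtain M f N g where r: "r = (\<Sum>d\<le>M. f d)" "\<And>d. f d \<in> Rw_piece n w d"
    and s: "s = (\<Sum>d\<le>N. g d)" "\<And>d. g d \<in> Rw_piece n w d"
    unfolding carrier_Rw_def by blast
  have "r * s = (\<Sum>d\<le>M. \<Sum>e\<le>N. f d * g e)" by (simp add: r(1) s(1) sum_product)
  also have "\<dots> \<in> carrier_Rw"
  proof (intro carrier_sum)
    show "f d * g e \<in> carrier_Rw" for d e by (rule piece_carrier[OF Rw_piece_mult[OF r(2) s(2)]])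
  qed
  finally show ?thesis .
qed

lemma nf_eqI:
  fixes r :: "(coord, 'k::field) mpoly"
  assumes p: "\<And>m. m \<in> keys p \<Longrightarrow> standard m" "evaluate tableau_section p = r"
  shows "nf r = p"
  unfolding nf_def
proof (rule the_equality)
  fix q assume q: "(\<forall>m\<in>keys q. standard m) \<and> evaluate tableau_section q = r"
  have "q - p = 0"
  proof (rule linear_independence)
    show "standard m" if "m \<in> keys (q - p)" for m
      using that keys_diff[of q p] p(1) q by blast
    show "evaluate tableau_section (q - p) = 0" using p(2) q by (simp add: evaluate_diff)
  qed
  then show "q = p" by simp
qed (use p in blast)

lemma standard_piece:
  fixes r :: "(coord, 'k::field) mpoly"
  assumes "r \<in> Rw_piece n w d"
  obtains p where "evaluate tableau_section p = r"
    "\<And>m. m \<in> keys p \<Longrightarrow> \<exists>u. m = word_mon u \<and> std u \<and> length u = d"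
  using spanning[OF assms] by blast

lemma nf_props:
  fixes r :: "(coord, 'k::field) mpoly"
  assumes "r \<in> carrier_Rw"
  shows "m \<in> keys (nf r) \<Longrightarrow> standard m" "evaluate tableau_section (nf r) = r"
proof -
  obtain N f where r: "r = (\<Sum>d\<le>N. f d)" "\<And>d. f d \<in> Rw_piece n w d"
    using assms unfolding carrier_Rw_def by blast
  have "\<exists>p. evaluate tableau_section p = f d \<and> (\<forall>m\<in>keys p. standard m)" for d
    using standard_piece[OF r(2)[of d]] unfolding standard_def by metis
  then obtain P where P: "\<And>d. evaluate tableau_section (P d) = f d" "\<And>d m. m \<in> keys (P d) \<Longrightarrow> standard m"
    by metis
  let ?p = "\<Sum>d\<le>N. P d"
  have std: "standard m" if "m \<in> keys ?p" for m using keys_sum_le[OF that] P(2) by blast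
  moreover have ev: "evaluate tableau_section ?p = r" by (simp add: evaluate_sum P(1) r(1))
  ultimately have "nf r = ?p" by (rule nf_eqI)
  then show "m \<in> keys (nf r) \<Longrightarrow> standard m" "evaluate tableau_section (nf r) = r" using std ev by simp_all
qed

lemma nf_add:
  assumes "r \<in> carrier_Rw" "s \<in> carrier_Rw"
  shows "nf (r + s) = nf r + nf s"
proof (rule nf_eqI)
  show "standard m" if "m \<in> keys (nf r + nf s)" for m
    using that Poly_Mapping.keys_add[of "nf r" "nf s"] nf_props(1)[OF assms(1)] nf_props(1)[OF assms(2)] by blast
qed (simp add: evaluate_add nf_props assms)

lemma nf_scale:
  assumes "r \<in> carrier_Rw"
  shows "nf (Const c * r) = single 0 c * nf r"
proof (rule nf_eqI)
  show "standard m" if "m \<in> keys (single 0 c * nf r)" for m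
    using that nf_props(1)[OF assms, of m] by (auto simp: in_keys_iff lookup_single_zero_mult)
qed (simp add: evaluate_mult evaluate_single nf_props assms Const_def)

lemma cf_support: "r \<in> carrier_Rw \<Longrightarrow> bij_betw word_mon {u. cf r u \<noteq> 0} (keys (nf r))"
proof (rule bij_betw_imageI)
  assume r: "r \<in> carrier_Rw"
  show "inj_on word_mon {u. cf r u \<noteq> 0}"
    by (rule inj_onI) (auto simp: cf_def intro: standard_unique split: if_splits)
  show "word_mon ` {u. cf r u \<noteq> 0} = keys (nf r)"
  proof (intro equalityI subsetI)
    fix m assume m: "m \<in> keys (nf r)"
    then obtain u where "std u" "m = word_mon u" using nf_props(1)[OF r] by (auto simp: standard_def)
    then show "m \<in> word_mon ` {u. cf r u \<noteq> 0}" using m by (auto simp: cf_def in_keys_iff)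
  qed (auto simp: cf_def in_keys_iff split: if_splits)
qed

lemma cf_expand:
  assumes r: "r \<in> carrier_Rw"
  shows "r = (\<Sum>u | cf r u \<noteq> 0. Const (cf r u) * sec u)"
proof -
  have "r = (\<Sum>m\<in>keys (nf r). single 0 (lookup (nf r) m) * mon_eval tableau_section m)"
    using nf_props(2)[OF r] by (simp add: evaluate_def)
  also have "\<dots> = (\<Sum>u | cf r u \<noteq> 0. single 0 (lookup (nf r) (word_mon u)) * mon_eval tableau_section (word_mon u))"
    by (rule sum.reindex_bij_betw[OF cf_support[OF r], symmetric])
  also have "\<dots> = (\<Sum>u | cf r u \<noteq> 0. Const (cf r u) * sec u)"
    by (intro sum.cong) (auto simp: cf_def Const_def sec_eq_mon_eval)
  finally show ?thesis .
qed

lemma cf_sec: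
  assumes "std u"
  shows "cf (sec u :: (coord, 'k::field) mpoly) v = (if v = u then 1 else 0)"
proof -
  have "nf (sec u :: (coord, 'k) mpoly) = single (word_mon u) 1"
    using assms by (intro nf_eqI) (auto simp: standard_def evaluate_single sec_eq_mon_eval)
  then show ?thesis
    using assms standard_unique[of u v] by (auto simp: cf_def lookup_single when_def)
qed

text \<open>The monomial becomes smaller, or it stays the same; in the latter case \<open>v\<close>
  is \<open>u\<close> sorted by rank, and its list of ranks is lexicographically smaller because
  \<open>u\<close> was not sorted.\<close>

lemma cf_straighten:
  assumes u: "set u \<subseteq> V" and nstd: "\<not> std u" and cf: "cf (sec u :: (coord, 'k::field) mpoly) v \<noteq> 0"
  shows "wless v u"
proof -
  have "nf (sec u :: (coord, 'k) mpoly) = normal u"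
    using normal_props[OF u, where 'k = 'k] by (intro nf_eqI) (auto simp: standard_def)
  then have v: "std v" "word_mon v \<in> keys (normal u :: (tableau, 'k) mpoly)"
    using cf by (auto simp: cf_def in_keys_iff split: if_splits)
  then obtain v' where v': "word_mon v = word_mon v'" "std v'" "length v' = length u"
    "word_mon v = word_mon u \<or> mless (word_mon v) (word_mon u)"
    using normal_props(2)[OF u] by blast
  then have len: "length v = length u" using standard_unique[OF v(1) v'(2,1)] by simp
  show ?thesis
  proof (cases "mless (word_mon v) (word_mon u)")
    case False
    then have eq: "word_mon v = word_mon u" using v'(4) by blast
    then have "set v = set u" using keys_word_mon by metis
    then have "std (sort_key rank u)" using std_comparable[OF v(1)] u by (intro chain_std) auto
    moreover have "word_mon (sort_key rank u) = word_mon u" by (rule word_mon_mset) simp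
    ultimately have vs: "v = sort_key rank u" using standard_unique[OF v(1)] eq by simp
    have "sort (map rank u) = map rank v"
      unfolding vs by (rule properties_for_sort) (simp_all add: sorted_sort_key)
    moreover have "map rank v \<noteq> map rank u"
    proof
      assume "map rank v = map rank u"
      then have "sorted (map rank u)" using sorted_sort_key[of rank u] vs by simp
      then have "v = u" unfolding vs by (rule sort_key_id)
      then show False using nstd v(1) by simp
    qed
    ultimately have "(map rank v, map rank u) \<in> lex less_than" using lex_sort[of "map rank u"] by simp
    then show ?thesis using len eq by (simp add: wless_def)
  qed (use len in \<open>simp add: wless_def\<close>)
qed

lemma pbw_algebra_Rw:
  "pbw_algebra (carrier_Rw :: (coord, 'k::field) mpoly set) (Rw_piece n w) Const V tableau_section below wless cf"
proof (unfold_locales, unfold sec_def[symmetric] std_def[symmetric], goal_cases)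
  case 1
  show ?case by (rule finite_tableaux)
next
  case (2 u)
  have "wf (lex less_than)" by (intro wf_lex wf_less_than)
  then have "(map rank u, map rank u) \<notin> lex less_than" by (rule wf_not_refl)
  then show ?case by (simp add: wless_def mless.irrefl)
next
  case (3 u v v')
  have "trans (lex less_than)" by (intro lex_transI trans_less_than)
  then show ?case using 3 unfolding wless_def by (metis mless.trans transD)
next
  case 4
  let ?r = "{(a, b). a \<in> monomials V \<and> b \<in> monomials V \<and> mless a b} <*lex*> lex less_than"
  have "wf (inv_image ?r (\<lambda>u. (word_mon u, map rank u)))"
    by (intro wf_inv_image wf_lex_prod wf_mless wf_lex wf_less_than)
  then show ?case
    by (rule wf_subset) (auto simp: wless_def inv_image_def word_mon_V)
next
  case (5 u v)
  then show ?case by (simp add: wless_def)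
next
  case (6 u v p)
  then show ?case
    using mless.add_right[of "word_mon u" "word_mon v" "word_mon p"]
    by (auto simp: wless_def word_mon_append add.commute intro: lex_append_leftI)
next
  case (7 u v p)
  then show ?case
    using mless.add_right[of "word_mon u" "word_mon v" "word_mon p"]
    by (auto simp: wless_def word_mon_append intro: lex_append_rightI)
next
  case 8
  show ?case using piece_carrier[OF Rw_piece_Const[of 1 n w]] by (simp add: Const_one)
next
  case (9 r s)
  then show ?case by (rule carrier_add)
next
  case (10 r s)
  then show ?case by (rule carrier_mult)
next
  case (11 c)
  show ?case by (rule piece_carrier[OF Rw_piece_Const])
next
  case (12 a)
  then show ?case by (intro piece_carrier[OF tableau_section_V(2)])
next
  case (13 c d)
  show ?case by (simp add: Const_def single_add)
next
  case (14 c d)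
  show ?case by (simp add: Const_def mult_single)
next
  case 15
  show ?case by (rule Const_one)
next
  case (16 r s u)
  then show ?case by (simp add: cf_def nf_add lookup_add)
next
  case (17 r c u)
  then show ?case by (simp add: cf_def nf_scale lookup_single_zero_mult)
next
  case (18 r)
  then show ?case using bij_betw_finite[OF cf_support] finite_keys by blast
next
  case (19 r u)
  then show ?case by (auto simp: cf_def split: if_splits)
next
  case (20 r)
  then show ?case by (rule cf_expand)
next
  case (21 u v)
  then show ?case by (rule cf_sec)
next
  case (22 u v)
  then show ?case by (intro cf_straighten) auto
next
  case (23 r d)
  show ?case
  proof
    assume r: "r \<in> Rw_piece n w d"
    obtain p where p: "evaluate tableau_section p = r"
      "\<And>m. m \<in> keys p \<Longrightarrow> \<exists>u. m = word_mon u \<and> std u \<and> length u = d"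
      using standard_piece[OF r] by blast
    have "nf r = p" using p by (intro nf_eqI) (auto simp: standard_def)
    then have "length u = d" if "cf r u \<noteq> 0" for u
    proof -
      have u: "std u" "word_mon u \<in> keys p"
        using that \<open>nf r = p\<close> by (auto simp: cf_def in_keys_iff split: if_splits)
      then obtain v where "word_mon u = word_mon v" "std v" "length v = d" using p(2) by blast
      then show ?thesis using standard_unique u(1) by blast
    qed
    then show "r \<in> carrier_Rw \<and> (\<forall>u. cf r u \<noteq> 0 \<longrightarrow> length u = d)" using piece_carrier[OF r] by blast
  next
    assume r: "r \<in> carrier_Rw \<and> (\<forall>u. cf r u \<noteq> 0 \<longrightarrow> length u = d)"
    have "(\<Sum>u | cf r u \<noteq> 0. Const (cf r u) * sec u) \<in> Rw_piece n w d"
    proof (intro Rw_piece_sum Rw_piece_scale)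
      fix u assume "u \<in> {u. cf r u \<noteq> 0}"
      then have "std u" "length u = d" using r by (auto simp: cf_def split: if_splits)
      then show "sec u \<in> Rw_piece n w d" using sec_Rw_piece[of u] by (auto simp: std_def)
    qed
    then show "r \<in> Rw_piece n w d" using cf_expand[of r] r by simp
  qed
qed

theorem koszul_Rw: "koszul Const (Rw n w :: (coord, 'k::field) mpoly ring) (Rw_piece n w)"
proof -
  interpret P: pbw_algebra "carrier_Rw :: (coord, 'k) mpoly set" "Rw_piece n w" Const V
    tableau_section below wless cf "\<lambda>u. prod_list (map tableau_section u)"
    "\<lambda>u. set u \<subseteq> V \<and> successively below u"
    by (rule pbw_algebra_Rw reflexive)+
  have "koszul Const P.R (Rw_piece n w)"
    using P.koszul[of "to_nat :: tableau list \<Rightarrow> nat"] by simp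
  moreover have "(Rw n w :: (coord, 'k) mpoly ring) = P.R" by (simp add: Rw_def carrier_Rw_def)
  ultimately show ?thesis by simp
qed

end

theorem theorem1p2:
  fixes n :: nat and w :: "nat \<Rightarrow> nat"
  assumes "n \<ge> 1"
    and "\<forall>i\<in>{1..n}. 0 < w i \<and> even (w i)"
  shows "(\<exists>r. monomial_order (tableaux n w) r \<and>
            (\<exists>G. groebner_basis (tableaux n w) r
                   (relation_ideal n w :: (tableau, 'k::field) mpoly set) G \<and>
                 (\<forall>g\<in>G. quadratic g \<and> squarefree_monomial (lead_monom r g)))) \<and>
         koszul Const (Rw n w :: (coord, 'k) mpoly ring) (Rw_piece n w)"
proof -
  interpret weighted_points n w using assms by unfold_locales auto
  obtain G where "groebner_basis V mord (relation_ideal n w :: (tableau, 'k) mpoly set) G"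
    "\<And>g. g \<in> G \<Longrightarrow> quadratic g \<and> squarefree_monomial (lead_monom mord g)"
    using squarefree_quadratic_groebner_basis[where 'k = 'k] by blast
  then show ?thesis using monomial_order_mord koszul_Rw by blast
qed

end
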